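(* Let $j\ge0$ be an integer and let $$F(z)= z^{2j+1}e^{Az^2}\,\frac{\prod_{\nu=1}^{\omega_1}\left(1+\frac{z^2}{a_\nu}\right)}{\prod_{\mu=1}^{\omega_2}\left(1-\frac{z^2}{b_\mu}\right)},\qquad F(z)\not\equiv z^{2j+1},$$ where $0<\omega_1,\omega_2\le+\infty$, $A\ge0$ and $a_\nu,b_\mu>0$ for all $\nu,\mu$. Let $\alpha\in\mathbb{C}\setminus\{0\}$, and let $(z_n)_{n=1}^{\omega}$ be all $\alpha$-points of $F$ (zeros of $F-\alpha$), ordered so that $|z_{n-1}|\le|z_n|$ and each repeated according to multiplicity. Then: (iv) If $\Im\alpha^2\ne0$, then all $\alpha$-points are simple and satisfy $0<|z_1|<|z_2|<\cdots$; $\Im z_n^2\ne0$ for every $n$, and $z_n\in Q_l\implies z_{n+1}\in Q_{l+\operatorname{sign}(\Im\alpha^2)}$. Moreover, $\Im\alpha\,\Im z_1>0$ and $\Re\alpha\,\Re z_1>0$. (v) If $\Im\alpha=0$, then $0<|z_1|<|z_2|\le|z_3|<|z_4|\le|z_5|<\cdots$, there are no purely imaginary $\alpha$-points, real $\alpha$-points can be simple or double, and the other $\alpha$-points are simple. Moreover, for each natural $n$: $|z_{2n}|=|z_{2n+1}|\implies z_{2n}=\overline{z}_{2n+1}$; $|z_{2n}|<|z_{2n+1}|\implies\operatorname{Arg}z_{2n}=\operatorname{Arg}z_{2n+1}\in\{0,\pi\}$; $\Re z_{2n-1}\,\Re z_{2n}<0$; $\Im z_1=0$; and $\alpha z_1>0$.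 (vi) If $\Re\alpha=0$, then $0<|z_1|\le|z_2|<|z_3|\le|z_4|<|z_5|\le\cdots$, there are no real $\alpha$-points, purely imaginary $\alpha$-points can be simple or double, and the other $\alpha$-points are simple. Moreover, for each natural $n$: $|z_{2n-1}|=|z_{2n}|\implies z_{2n-1}=-\overline{z}_{2n}$; $|z_{2n-1}|<|z_{2n}|\implies\operatorname{Arg}z_{2n-1}=\operatorname{Arg}z_{2n}\in\{-\frac\pi2,\frac\pi2\}$; $\Im z_{2n}\,\Im z_{2n+1}<0$; $\Im\alpha\,\Im z_1>0$; and $|z_1|<|z_2|\implies j=0$.
   Context: For $l\in\mathbb{Z}$, $Q_l:=\{z\ne0:0<\operatorname{Arg}(z\,i^{-l})<\frac\pi2\}$ are the open quadrants ($Q_{l+4}=Q_l$; $\operatorname{Arg}$ is the principal argument). The products are absolutely convergent. An $\alpha$-point is a $z$ with $F(z)=\alpha$; its multiplicity is the order of the zero of $F-\alpha$ there. Each assertion involving particular $z_n$ is made for those indices for which the $\alpha$-points involved exist. *)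

theory Defs
  imports "HOL-Complex_Analysis.Complex_Analysis"
begin

(* Products over the indices 1, ..., n with n possibly infinite: the missing factors of a
   finite product are filled up with 1. *)

definition pad_factors :: "enat \<Rightarrow> (nat \<Rightarrow> complex) \<Rightarrow> nat \<Rightarrow> complex" where
  "pad_factors n f k = (if enat (Suc k) \<le> n then f (Suc k) else 1)"

definition eprod :: "enat \<Rightarrow> (nat \<Rightarrow> complex) \<Rightarrow> complex" where
  "eprod n f = (\<Prod>k. pad_factors n f k)"

definition abs_convergent_eprod :: "enat \<Rightarrow> (nat \<Rightarrow> complex) \<Rightarrow> bool" where
  "abs_convergent_eprod n f \<longleftrightarrow> abs_convergent_prod (pad_factors n f)"

lemma eprod_enat: "eprod (enat n) f = (\<Prod>k=1..n. f k)"
proof -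
  have "eprod (enat n) f = (\<Prod>k<n. pad_factors (enat n) f k)"
    unfolding eprod_def by (rule prodinf_finite) (auto simp: pad_factors_def)
  also have "\<dots> = (\<Prod>k<n. f (Suc k))"
    by (rule prod.cong) (auto simp: pad_factors_def)
  also have "\<dots> = (\<Prod>k=1..n. f k)"
    by (metis One_nat_def atLeast0LessThan image_Suc_atLeastLessThan inj_Suc
        atLeastLessThanSuc_atLeastAtMost prod.reindex comp_def prod.cong)
  finally show ?thesis .
qed

lemma eprod_infinity: "eprod \<infinity> f = (\<Prod>k. f (Suc k))"
  by (simp add: eprod_def pad_factors_def)

definition quadrant :: "int \<Rightarrow> complex set" where
  "quadrant l = {z. z \<noteq> 0 \<and> 0 < Arg (z * \<i> powi (- l)) \<and> Arg (z * \<i> powi (- l)) < pi / 2}"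

(* For a meromorphic quotient F the convention x / 0 = 0 gives F the value 0 at its poles,
   so for \<alpha> \<noteq> 0, the only case in which these notions are used, no pole is an \<alpha>-point. *)

definition alpha_points :: "(complex \<Rightarrow> complex) \<Rightarrow> complex \<Rightarrow> complex set" where
  "alpha_points F \<alpha> = {w. F w = \<alpha>}"

definition alpha_mult :: "(complex \<Rightarrow> complex) \<Rightarrow> complex \<Rightarrow> complex \<Rightarrow> int" where
  "alpha_mult F \<alpha> w = zorder (\<lambda>x. F x - \<alpha>) w"

(* z 1, z 2, ..., z N (N possibly infinite, or 0) lists all \<alpha>-points of F by nondecreasing
   modulus, each as often as its multiplicity; values of z outside 1..N are irrelevant. *)

definition enumerates_alpha_points ::
  "(complex \<Rightarrow> complex) \<Rightarrow> complex \<Rightarrow> enat \<Rightarrow> (nat \<Rightarrow> complex) \<Rightarrow> bool" where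
  "enumerates_alpha_points F \<alpha> N z \<longleftrightarrow>
     (\<forall>n\<ge>1. enat n \<le> N \<longrightarrow> z n \<in> alpha_points F \<alpha>) \<and>
     (\<forall>w\<in>alpha_points F \<alpha>.
        finite {n. 1 \<le> n \<and> enat n \<le> N \<and> z n = w} \<and>
        int (card {n. 1 \<le> n \<and> enat n \<le> N \<and> z n = w}) = alpha_mult F \<alpha> w) \<and>
     (\<forall>n\<ge>2. enat n \<le> N \<longrightarrow> norm (z (n - 1)) \<le> norm (z n))"

end

theory Submission
  imports Defs
begin

text \<open>
  By the symmetries \<open>F(-z) = -F(z)\<close> and \<open>F(cnj z) = cnj (F z)\<close> it suffices to study the closed first
  quadrant. With \<open>z = exp u\<close> it becomes the strip \<open>0 \<le> Im u \<le> pi/2\<close>, where \<open>F(exp u) = exp (L u)\<close>, and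
  \<open>L'\<close> has positive imaginary part inside because every factor contributes a term with this property.
  By the mean value theorem \<open>Im ((L v - L u) * cnj (v - u)) > 0\<close> unless \<open>u\<close> and \<open>v\<close> lie on the same edge.
  Hence \<open>|F|\<close> decreases along vertical segments, the level set \<open>|F| = |\<alpha>|\<close>, completed by pieces of the edges,
  is the graph of a continuous function \<open>Th\<close>, and the argument \<open>Ph\<close> of \<open>F\<close> increases along this graph from 0.
  The \<open>\<alpha>\<close>-points are the reflections of the points where \<open>Ph\<close> passes the values congruent to
  \<open>arg \<alpha>\<close> or \<open>-arg \<alpha>\<close> modulo \<open>pi\<close>; so their order by modulus is that of the values of \<open>Ph\<close>. The same inequality
  near an \<open>\<alpha>\<close>-point bounds its multiplicity.
\<close>

section \<open>Logarithms of the factors in the strip\<close>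

text \<open>The zeros of \<open>F\<close> lie on the imaginary axis and its poles on the real axis,
  that is, on the edges of the strip, where the inequality degenerates too. The logarithm is
  therefore used only at those points of the closed strip where \<open>F\<close> is finite and
  nonzero; on an edge its imaginary part is a nondecreasing step function with values in one residue
  class modulo pi. The curve avoids the excluded points: zeros on the upper edge are below the level
  \<bar>\<alpha>\<bar>, poles on the lower edge above it. While the curve runs along an edge,
  \<open>Ph\<close> is constant, and for real or imaginary \<alpha> it is just such values that
  matter. A value may thus belong to a whole interval, of which at most the ends are
  \<alpha>-points; their multiplicities are read off from the sign of \<bar>F\<bar> -
  \<bar>\<alpha>\<bar> along the edge on both sides. The outcome is that every level which the curve
  passes has total multiplicity 2, except that for real \<alpha> the level 0, on which the curve
  starts, has 1. For \<alpha> on neither axis the levels are met in the interior only, each at one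
  simple \<alpha>-point.\<close>

definition strip :: "complex set" where
  "strip = {u. 0 \<le> Im u \<and> Im u \<le> pi / 2}"

definition same_edge :: "complex \<Rightarrow> complex \<Rightarrow> bool" where
  "same_edge u v \<longleftrightarrow> Im u = Im v \<and> (Im u = 0 \<or> Im u = pi / 2)"

lemma pi_half_convex:
  "(1 - t) * (pi / 2 - x) + t * (pi / 2 - y) = pi / 2 - ((1 - t) * x + t * y)"
  by (simp add: field_simps)

text \<open>The factor \<open>cnj (v - u)\<close> turns the derivative along the segment into
  \<open>(norm (v - u))\<^sup>2\<close> times \<open>f'\<close>, so the real mean value theorem for
  a single imaginary part suffices. Excluding \<open>same_edge\<close> puts the open segment into
  the interior of the strip, even if both ends lie on edges.\<close>

lemma strip_mvt:
  assumes u: "u \<in> strip" and v: "v \<in> strip" and uv: "u \<noteq> v" and ne: "\<not> same_edge u v"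
    and cont: "continuous_on (closed_segment u v) f"
    and der: "\<And>x. 0 < Im x \<Longrightarrow> Im x < pi / 2 \<Longrightarrow> (f has_field_derivative f' x) (at x)"
  shows "\<exists>x. 0 < Im x \<and> Im x < pi / 2 \<and>
           Im ((f v - f u) * cnj (v - u)) = (norm (v - u))\<^sup>2 * Im (f' x)"
proof -
  define D where "D = v - u"
  define p where "p = (\<lambda>\<tau>::real. u + of_real \<tau> * D)"
  define h where "h = (\<lambda>\<tau>::real. Im (f (p \<tau>) * cnj D))"
  have p_img: "p \<tau> \<in> closed_segment u v" if "\<tau> \<in> {0..1}" for \<tau>
  proof -
    have "p \<tau> = (1 - \<tau>) *\<^sub>R u + \<tau> *\<^sub>R v"
      by (simp add: p_def D_def scaleR_conv_of_real algebra_simps)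
    thus ?thesis using that by (auto simp: closed_segment_def)
  qed
  have p_in: "0 < Im (p \<tau>) \<and> Im (p \<tau>) < pi / 2" if "0 < \<tau>" "\<tau> < 1" for \<tau>
  proof -
    have eq: "Im (p \<tau>) = (1 - \<tau>) * Im u + \<tau> * Im v"
      by (simp add: p_def D_def algebra_simps)
    have b: "0 \<le> Im u" "Im u \<le> pi/2" "0 \<le> Im v" "Im v \<le> pi/2"
      using u v by (auto simp: strip_def)
    have "0 < Im u \<or> 0 < Im v" "Im u < pi/2 \<or> Im v < pi/2"
      using ne b unfolding same_edge_def by linarith+
    have 1: "0 < (1 - \<tau>) * Im u + \<tau> * Im v"
      using \<open>0 < Im u \<or> 0 < Im v\<close> b that
      by (auto intro: add_pos_nonneg add_nonneg_pos)
    have "0 < (1 - \<tau>) * (pi/2 - Im u) + \<tau> * (pi/2 - Im v)"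
      using \<open>Im u < pi/2 \<or> Im v < pi/2\<close> b that
      by (elim disjE) (rule add_pos_nonneg add_nonneg_pos; simp)+
    hence 2: "(1 - \<tau>) * Im u + \<tau> * Im v < pi/2" by (simp only: pi_half_convex)
    show ?thesis using 1 2 eq by simp
  qed
  have hc: "continuous_on {0..1} h"
    unfolding h_def
    by (intro continuous_intros continuous_on_compose2[OF cont])
       (auto simp: p_def intro!: continuous_intros p_img[unfolded p_def])
  have hd: "(h has_real_derivative (norm D)\<^sup>2 * Im (f' (p \<tau>))) (at \<tau>)" if "0 < \<tau>" "\<tau> < 1" for \<tau>
  proof -
    have d1: "(f has_field_derivative f' (p \<tau>)) (at (p \<tau>))"
      using der p_in[OF that] by blast
    have d2: "(p has_vector_derivative D) (at \<tau>)"
      unfolding p_def by (auto intro!: derivative_eq_intros simp: has_vector_derivative_def scaleR_conv_of_real)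
    have d3: "((\<lambda>\<tau>. f (p \<tau>)) has_vector_derivative (D * f' (p \<tau>))) (at \<tau>)"
      using field_vector_diff_chain_at[OF d2 d1] by (simp add: o_def)
    have d4: "((\<lambda>\<tau>. f (p \<tau>) * cnj D) has_vector_derivative (D * f' (p \<tau>) * cnj D)) (at \<tau>)"
      by (rule has_vector_derivative_mult_left[OF d3])
    have d5: "((\<lambda>\<tau>. Im (f (p \<tau>) * cnj D)) has_vector_derivative Im (D * f' (p \<tau>) * cnj D)) (at \<tau>)"
      using bounded_linear.has_vector_derivative[OF bounded_linear_Im d4] .
    have "D * f' (p \<tau>) * cnj D = of_real ((norm D)\<^sup>2) * f' (p \<tau>)"
      by (metis complex_norm_square mult.assoc mult.commute of_real_power)
    hence "Im (D * f' (p \<tau>) * cnj D) = (norm D)\<^sup>2 * Im (f' (p \<tau>))"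
      by (simp only: Im_complex_of_real complex.sel times_complex.sel Re_complex_of_real)
    with d5 show ?thesis unfolding h_def by (simp add: has_real_derivative_iff_has_vector_derivative)
  qed
  obtain \<tau> where t: "0 < \<tau>" "\<tau> < 1" "h 1 - h 0 = (1 - 0) * ((norm D)\<^sup>2 * Im (f' (p \<tau>)))"
  proof -
    obtain l \<tau> where l: "0 < \<tau>" "\<tau> < 1" "DERIV h \<tau> :> l" "h 1 - h 0 = (1 - 0) * l"
      using MVT[OF zero_less_one hc] hd by (metis real_differentiable_def)
    with DERIV_unique[OF l(3) hd[OF l(1,2)]] that show ?thesis by blast
  qed
  have "h 1 - h 0 = Im ((f v - f u) * cnj (v - u))"
    by (simp add: h_def p_def D_def algebra_simps)
  thus ?thesis using t p_in[OF t(1,2)] by (auto simp: D_def)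
qed

text \<open>The logarithm of \<open>1 + c exp(2u)\<close>, whose values have nonnegative imaginary part for \<open>u\<close> in the strip. The
  rotation by \<open>-\<i>\<close> moves the cut of \<open>Ln\<close> off the closed upper half-plane, so that the branch stays continuous
  on both edges.\<close>

definition lgf :: "real \<Rightarrow> complex \<Rightarrow> complex" where
  "lgf c u = Ln (- \<i> * (1 + of_real c * exp (2 * u))) + \<i> * (pi / 2)"

lemma exp_lgf:
  assumes "1 + of_real c * exp (2 * u) \<noteq> 0"
  shows "exp (lgf c u) = 1 + of_real c * exp (2 * u)"
proof -
  have "exp (\<i> * (complex_of_real pi / 2)) = \<i>"
    using cis_pi_half by (simp add: cis_conv_exp)
  moreover have "- (\<i> * (1 + complex_of_real c * exp (2 * u)) * \<i>) = 1 + complex_of_real c * exp (2 * u)"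
    by (simp add: complex_eq_iff)
  ultimately show ?thesis using assms by (simp add: lgf_def exp_add)
qed

lemma Im_exp2_nonneg: "u \<in> strip \<Longrightarrow> 0 \<le> Im (exp (2 * u))"
  by (auto simp: strip_def Im_exp intro!: mult_nonneg_nonneg sin_ge_zero)

lemma Im_exp2_pos: "0 < Im u \<Longrightarrow> Im u < pi / 2 \<Longrightarrow> 0 < Im (exp (2 * u))"
  by (auto simp: Im_exp intro!: mult_pos_pos sin_gt_zero)

lemma exp2_bottom: "Im u = 0 \<Longrightarrow> exp (2 * u) = of_real (exp (2 * Re u))"
  by (simp add: complex_eq_iff Re_exp Im_exp)

lemma exp2_top:
  assumes "Im u = pi / 2"
  shows "exp (2 * u) = - of_real (exp (2 * Re u))"
proof -
  have "2 * Im u = pi" using assms by simp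
  thus ?thesis by (intro complex_eqI) (simp_all only: Re_exp Im_exp, simp_all)
qed

lemma one_plus_nz:
  assumes "u \<in> strip" "Im u \<noteq> pi / 2" "c \<ge> 0"
  shows "1 + of_real c * exp (2 * u) \<noteq> 0"
proof
  assume *: "1 + of_real c * exp (2 * u) = 0"
  hence "Im (1 + of_real c * exp (2 * u)) = 0" "Re (1 + of_real c * exp (2 * u)) = 0" by simp_all
  hence i: "c * Im (exp (2 * u)) = 0" and r: "1 + c * Re (exp (2 * u)) = 0" by simp_all
  from r have "c \<noteq> 0" by auto
  with i have "Im (exp (2 * u)) = 0" by simp
  hence "\<not> (0 < Im u \<and> Im u < pi/2)" using Im_exp2_pos by force
  with assms have "Im u = 0" by (auto simp: strip_def)
  hence "Re (exp (2 * u)) > 0" by (simp add: exp2_bottom)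
  with r assms(3) show False by (smt (verit) mult_nonneg_nonneg)
qed

lemma lgf_arg_nonpos:
  assumes "u \<in> strip" "c \<ge> 0" "1 + of_real c * exp (2 * u) \<noteq> 0"
  shows "- \<i> * (1 + of_real c * exp (2 * u)) \<notin> \<real>\<^sub>\<le>\<^sub>0"
proof
  assume "- \<i> * (1 + of_real c * exp (2 * u)) \<in> \<real>\<^sub>\<le>\<^sub>0"
  hence "Re (- \<i> * (1 + of_real c * exp (2 * u))) \<le> 0" "Im (- \<i> * (1 + of_real c * exp (2 * u))) = 0"
    by (auto simp: complex_nonpos_Reals_iff)
  hence "c * Im (exp (2 * u)) \<le> 0" "1 + c * Re (exp (2 * u)) = 0" by simp_all
  moreover have "c * Im (exp (2 * u)) \<ge> 0" using Im_exp2_nonneg[OF assms(1)] assms(2) by simp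
  ultimately show False using assms(3) by (simp add: complex_eq_iff)
qed

lemma continuous_on_lgf:
  assumes "c \<ge> 0"
  shows "continuous_on {u\<in>strip. 1 + of_real c * exp (2 * u) \<noteq> 0} (lgf c)"
  unfolding lgf_def
  using lgf_arg_nonpos[OF _ assms]
  by (intro continuous_intros) auto

lemma lgf_deriv:
  assumes "0 < Im u" "Im u < pi / 2" "c \<ge> 0"
  shows "(lgf c has_field_derivative (2 * of_real c * exp (2 * u) / (1 + of_real c * exp (2 * u)))) (at u)"
proof -
  have s: "u \<in> strip" using assms by (simp add: strip_def)
  have nz: "1 + of_real c * exp (2 * u) \<noteq> 0" using one_plus_nz[OF s] assms by auto
  have np: "- \<i> * (1 + of_real c * exp (2 * u)) \<notin> \<real>\<^sub>\<le>\<^sub>0" using lgf_arg_nonpos[OF s assms(3) nz] .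
  show ?thesis unfolding lgf_def
    apply (rule derivative_eq_intros refl np)+
    using nz mult_divide_mult_cancel_left[of "- \<i>"
      "2 * of_real c * exp (2 * u)" "1 + of_real c * exp (2 * u)"] by (simp add: field_simps)
qed

text \<open>With \<open>w = exp (2 * u)\<close> the quotient is \<open>2 - 2 / (1 + c * w)\<close>,
  and taking reciprocals reverses the sign of the imaginary part.\<close>

lemma Im_lgf_deriv:
  assumes "0 < Im u" "Im u < pi / 2" "c > 0"
  shows "Im (2 * of_real c * exp (2 * u) / (1 + of_real c * exp (2 * u))) > 0"
proof -
  define w where "w = exp (2 * u)"
  have s: "u \<in> strip" using assms by (simp add: strip_def)
  have nz: "1 + of_real c * w \<noteq> 0" using one_plus_nz[OF s] assms by (auto simp: w_def)
  have "2 * of_real c * w / (1 + of_real c * w) = 2 - 2 * cnj (1 + of_real c * w) / of_real ((norm (1 + of_real c * w))\<^sup>2)"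
  proof -
    have "2 * of_real c * w / (1 + of_real c * w) = 2 - 2 / (1 + of_real c * w)"
      using nz by (simp add: field_simps)
    also have "2 / (1 + of_real c * w) = 2 * cnj (1 + of_real c * w) / of_real ((norm (1 + of_real c * w))\<^sup>2)"
    proof -
      have gen: "2 / x = 2 * cnj x / of_real ((norm x)\<^sup>2)" if "x \<noteq> 0" for x :: complex
        using that by (subst complex_norm_square) (simp add: field_simps)
      show ?thesis by (rule gen[OF nz])
    qed
    finally show ?thesis .
  qed
  hence "Im (2 * of_real c * w / (1 + of_real c * w)) = 2 * c * Im w / (norm (1 + of_real c * w))\<^sup>2"
    by (simp del: of_real_power)
  moreover have "Im w > 0" using Im_exp2_pos assms by (simp add: w_def)
  ultimately show ?thesis using assms nz unfolding w_def by simp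
qed

lemma Im_lgf_bottom:
  assumes "Im u = 0" "c \<ge> 0"
  shows "Im (lgf c u) = 0"
proof -
  define r where "r = 1 + c * exp (2 * Re u)"
  have r: "r > 0" unfolding r_def using assms(2) by (smt (verit) mult_nonneg_nonneg exp_ge_zero)
  have eq: "- \<i> * (1 + of_real c * exp (2 * u)) = of_real r * (- \<i>)"
    by (simp add: exp2_bottom[OF assms(1)] r_def)
  show ?thesis unfolding lgf_def eq by (subst Ln_times_of_real[OF r]) (use r in \<open>auto simp: Ln_of_real\<close>)
qed

text \<open>On the upper edge the factor is real, and its argument jumps from 0 to pi as
  \<open>u\<close> moves to the right past the zero. Such jumps make the argument of
  \<open>F\<close> grow along that edge.\<close>

lemma Im_lgf_top:
  assumes "Im u = pi / 2" "c * exp (2 * Re u) \<noteq> 1"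
  shows "Im (lgf c u) = (if c * exp (2 * Re u) > 1 then pi else 0)"
proof -
  define r where "r = 1 - c * exp (2 * Re u)"
  have eq: "- \<i> * (1 + of_real c * exp (2 * u)) = of_real r * (- \<i>)"
      "- \<i> * (1 + of_real c * exp (2 * u)) = of_real (-r) * \<i>"
    by (simp_all add: exp2_top[OF assms(1)] r_def) (simp_all add: algebra_simps)
  show ?thesis
  proof (cases "c * exp (2 * Re u) > 1")
    case True
    hence r: "- r > 0" by (simp add: r_def)
    show ?thesis unfolding lgf_def eq(2) using True
      by (subst Ln_times_of_real[OF r]) (use r in \<open>auto simp: Ln_of_real simp flip: of_real_minus\<close>)
  next
    case False
    hence r: "r > 0" using assms by (simp add: r_def)
    show ?thesis unfolding lgf_def eq(1) using False by (subst Ln_times_of_real[OF r]) (use r in \<open>auto simp: Ln_of_real\<close>)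
  qed
qed

text \<open>Off a common edge the mean value theorem reduces the claim to the sign of the
  derivative. On a common edge the segment may contain a zero of the factor; there the claim says
  that the imaginary part of \<open>lgf c\<close> is nondecreasing in the real part.\<close>

lemma lgf_key:
  assumes u: "u \<in> strip" and v: "v \<in> strip" and c: "c \<ge> 0"
    and nu: "1 + of_real c * exp (2 * u) \<noteq> 0" and nv: "1 + of_real c * exp (2 * v) \<noteq> 0"
  shows "Im ((lgf c v - lgf c u) * cnj (v - u)) \<ge> 0"
    and "c > 0 \<Longrightarrow> u \<noteq> v \<Longrightarrow> \<not> same_edge u v \<Longrightarrow> Im ((lgf c v - lgf c u) * cnj (v - u)) > 0"
proof -
  have interior: "\<exists>x. 0 < Im x \<and> Im x < pi / 2 \<and>
           Im ((lgf c v - lgf c u) * cnj (v - u)) = (norm (v - u))\<^sup>2 *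
             Im (2 * of_real c * exp (2 * x) / (1 + of_real c * exp (2 * x)))"
    if ne: "u \<noteq> v" "\<not> same_edge u v"
  proof (rule strip_mvt[OF u v ne])
    show "continuous_on (closed_segment u v) (lgf c)"
    proof (rule continuous_on_subset[OF continuous_on_lgf[OF c]])
      show "closed_segment u v \<subseteq> {u \<in> strip. 1 + of_real c * exp (2 * u) \<noteq> 0}"
      proof
        fix x assume x: "x \<in> closed_segment u v"
        then obtain t where t: "0 \<le> t" "t \<le> 1" "x = (1 - t) *\<^sub>R u + t *\<^sub>R v"
          by (auto simp: closed_segment_def)
        have Imx: "Im x = (1 - t) * Im u + t * Im v" using t by simp
        have b: "0 \<le> Im u" "Im u \<le> pi/2" "0 \<le> Im v" "Im v \<le> pi/2"
          using u v by (auto simp: strip_def)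
        have xs: "x \<in> strip"
        proof -
          have "0 \<le> (1 - t) * Im u + t * Im v" using b t by simp
          moreover have "0 \<le> (1 - t) * (pi/2 - Im u) + t * (pi/2 - Im v)" using b t by simp
          ultimately show ?thesis unfolding strip_def pi_half_convex using Imx by simp
        qed
        show "x \<in> {u \<in> strip. 1 + of_real c * exp (2 * u) \<noteq> 0}"
        proof (cases "x = u \<or> x = v")
          case True thus ?thesis using nu nv u v by auto
        next
          case False
          hence t': "0 < t" "t < 1" using t by (auto simp: less_le)
          \<comment> \<open>Only the upper edge carries zeros, and an inner point of the segment
            lies on it only if both ends do.\<close>
          have "Im x \<noteq> pi/2"
          proof
            assume "Im x = pi/2"
            hence "(1 - t) * (pi/2 - Im u) + t * (pi/2 - Im v) = 0" using Imx by (simp only: pi_half_convex)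
            moreover have "(1 - t) * (pi/2 - Im u) \<ge> 0" "t * (pi/2 - Im v) \<ge> 0" using b t by simp_all
            ultimately have "(1 - t) * (pi/2 - Im u) = 0" "t * (pi/2 - Im v) = 0" by linarith+
            hence "Im u = pi/2" "Im v = pi/2" using t' by simp_all
            thus False using ne(2) by (simp add: same_edge_def)
          qed
          thus ?thesis using one_plus_nz[OF xs _ c] xs by simp
        qed
      qed
    qed
  qed (rule lgf_deriv[OF _ _ c])
  show "Im ((lgf c v - lgf c u) * cnj (v - u)) \<ge> 0"
  proof (cases "u = v \<or> same_edge u v")
    case False
    then obtain x where x: "0 < Im x" "Im x < pi / 2"
       "Im ((lgf c v - lgf c u) * cnj (v - u)) = (norm (v - u))\<^sup>2 *
             Im (2 * of_real c * exp (2 * x) / (1 + of_real c * exp (2 * x)))" using interior by blast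
    show ?thesis
    proof (cases "c = 0")
      case True thus ?thesis by (simp add: lgf_def)
    next
      case False
      hence "c > 0" using c by simp
      show ?thesis unfolding x(3)
        by (intro mult_nonneg_nonneg less_imp_le[OF Im_lgf_deriv[OF x(1,2) \<open>c > 0\<close>]]) simp
    qed
  next
    case True
    have gen: "Im ((lgf c v - lgf c u) * cnj (v - u)) = (Im (lgf c v) - Im (lgf c u)) * (Re v - Re u)"
      if "Im u = Im v" using that by (simp add: algebra_simps)
    consider "u = v" | "Im u = 0" "Im v = 0" | "Im u = pi/2" "Im v = pi/2"
      using True by (auto simp: same_edge_def)
    thus ?thesis
    proof cases
      case 2 thus ?thesis by (simp add: gen Im_lgf_bottom c)
    next
      case 3
      have "c * exp (2 * Re u) \<noteq> 1" "c * exp (2 * Re v) \<noteq> 1"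
        using nu nv exp2_top[OF 3(1)] exp2_top[OF 3(2)]
        by (metis add.right_inverse mult_minus_right of_real_1 of_real_mult)+
      hence e: "Im (lgf c u) = (if c * exp (2 * Re u) > 1 then pi else 0)"
               "Im (lgf c v) = (if c * exp (2 * Re v) > 1 then pi else 0)"
        using 3 Im_lgf_top by auto
      have m: "c * exp (2 * Re u) \<le> c * exp (2 * Re v)" if "Re u \<le> Re v" using that c
        by (simp add: mult_left_mono)
      have m': "c * exp (2 * Re v) \<le> c * exp (2 * Re u)" if "Re v \<le> Re u" using that c
        by (simp add: mult_left_mono)
      have "Im u = Im v" using 3 by simp
      thus ?thesis unfolding gen[OF \<open>Im u = Im v\<close>] e
        using m m' by (cases "Re u \<le> Re v") (auto intro: mult_nonneg_nonneg simp: mult_nonpos_nonpos)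
    qed simp
  qed
  show "Im ((lgf c v - lgf c u) * cnj (v - u)) > 0" if "c > 0" and ne: "u \<noteq> v" "\<not> same_edge u v"
  proof -
    obtain x where x: "0 < Im x" "Im x < pi / 2"
       "Im ((lgf c v - lgf c u) * cnj (v - u)) = (norm (v - u))\<^sup>2 *
             Im (2 * of_real c * exp (2 * x) / (1 + of_real c * exp (2 * x)))" using interior[OF ne] by blast
    show ?thesis unfolding x(3) using Im_lgf_deriv[OF x(1,2) that(1)] ne by simp
  qed
qed

lemma exp2_key:
  assumes u: "u \<in> strip" and v: "v \<in> strip"
  shows "Im ((exp (2 * v) - exp (2 * u)) * cnj (v - u)) \<ge> 0"
proof (cases "u = v \<or> same_edge u v")
  case False
  hence ne: "u \<noteq> v" "\<not> same_edge u v" by auto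
  have "\<exists>x. 0 < Im x \<and> Im x < pi / 2 \<and>
           Im ((exp (2 * v) - exp (2 * u)) * cnj (v - u)) = (norm (v - u))\<^sup>2 * Im (2 * exp (2 * x))"
    by (rule strip_mvt[OF u v ne]) (auto intro!: continuous_intros derivative_eq_intros)
  then obtain x where x: "0 < Im x" "Im x < pi / 2"
    "Im ((exp (2 * v) - exp (2 * u)) * cnj (v - u)) = (norm (v - u))\<^sup>2 * Im (2 * exp (2 * x))" by blast
  show ?thesis unfolding x(3) using Im_exp2_pos[OF x(1,2)] by simp
next
  case True
  thus ?thesis by (auto simp: same_edge_def exp2_bottom exp2_top)
qed

section \<open>The products\<close>

text \<open>A coefficient 0 gives the factor 1, so finite and infinite products are covered alike,
  and absolute convergence becomes summability of \<open>c\<close>.\<close>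

locale coeff_seq =
  fixes c :: "nat \<Rightarrow> real"
  assumes c_nonneg: "0 \<le> c k" and c_summable: "summable c"
begin

definition gprod :: "complex \<Rightarrow> complex" where
  "gprod x = (\<Prod>k. 1 + of_real (c k) * x)"

definition LS :: "complex \<Rightarrow> complex" where
  "LS u = (\<Sum>k. lgf (c k) u)"

definition regular :: "complex set" where
  "regular = {u \<in> strip. \<forall>k. 1 + of_real (c k) * exp (2 * u) \<noteq> 0}"

lemma convergent_factors: "convergent_prod (\<lambda>k. 1 + of_real (c k) * x :: complex)"
  by (intro abs_convergent_prod_imp_convergent_prod summable_imp_abs_convergent_prod)
     (simp add: norm_mult c_nonneg summable_mult2 c_summable)

lemma gprod_eq_0_iff: "gprod x = 0 \<longleftrightarrow> (\<exists>k. 1 + of_real (c k) * x = 0)"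
  using has_prod_eq_0_iff[OF convergent_prod_has_prod[OF convergent_factors[of x]]]
  unfolding gprod_def by auto

lemma regular_iff: "u \<in> regular \<longleftrightarrow> u \<in> strip \<and> gprod (exp (2 * u)) \<noteq> 0"
  by (auto simp: regular_def gprod_eq_0_iff)

lemma gprod_holomorphic: "gprod holomorphic_on UNIV"
proof (rule holomorphic_uniform_sequence[OF open_UNIV])
  show "(\<lambda>x. \<Prod>k<n. 1 + of_real (c k) * x) holomorphic_on UNIV" for n
    by (intro holomorphic_intros)
  fix x :: complex
  have "uniform_limit (cball x 1) (\<lambda>n y. \<Prod>k<n. 1 + of_real (c k) * y) gprod sequentially"
  proof -
    have "uniformly_convergent_on (cball x 1) (\<lambda>N y. \<Prod>n<N. 1 + (complex_of_real (c n) * y))"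
    proof (rule uniformly_convergent_on_prod)
      show "uniformly_convergent_on (cball x 1) (\<lambda>N y. \<Sum>n<N. norm (of_real (c n) * y))"
      proof (rule Weierstrass_m_test')
        show "summable (\<lambda>n. c n * (norm x + 1))" using c_summable by (rule summable_mult2)
        fix n y assume "y \<in> cball x 1"
        hence "norm y \<le> norm x + 1"
          by (smt (verit) dist_commute dist_norm mem_cball norm_triangle_sub)
        thus "norm (norm (of_real (c n) * y)) \<le> c n * (norm x + 1)"
          using c_nonneg by (simp add: norm_mult mult_left_mono)
      qed
    qed (auto intro!: continuous_intros)
    moreover have "(\<lambda>n. \<Prod>k<n. 1 + of_real (c k) * y) \<longlonglongrightarrow> gprod y" for y
      unfolding gprod_def by (rule has_prod_imp_tendsto'[OF convergent_prod_has_prod[OF convergent_factors]])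
    ultimately show ?thesis
      by (subst (asm) uniformly_convergent_uniform_limit_iff)
         (erule uniform_limit_cong'[THEN iffD1, rotated -1], auto simp: limI)
  qed
  thus "\<exists>d>0. cball x d \<subseteq> UNIV \<and> uniform_limit (cball x d) (\<lambda>n y. \<Prod>k<n. 1 + of_real (c k) * y) gprod sequentially"
    by (intro exI[of _ 1]) auto
qed

lemma lgf_eq_Ln:
  assumes "Re (1 + of_real a * exp (2 * u)) > 0"
  shows "lgf a u = Ln (1 + of_real a * exp (2 * u))"
proof -
  define x where "x = 1 + of_real a * exp (2 * u)"
  have nz: "x \<noteq> 0" using assms unfolding x_def by (metis order_less_irrefl zero_complex.simps(1))
  have "\<bar>Im (Ln x)\<bar> < pi / 2" using Re_Ln_pos_lt_imp assms x_def by simp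
  hence "Ln (- \<i> * x) = Ln (- \<i>) + Ln x"
    using nz by (intro Ln_times_simple) auto
  thus ?thesis by (simp add: lgf_def x_def)
qed

lemma norm_lgf_le:
  assumes "a \<ge> 0" "a * exp (2 * Re u) < 1 / 2"
  shows "norm (lgf a u) \<le> 2 * (a * exp (2 * Re u))"
proof -
  have n: "norm (of_real a * exp (2 * u)) = a * exp (2 * Re u)"
    using assms by (simp add: norm_mult norm_exp_eq_Re)
  have "Re (1 + of_real a * exp (2 * u)) > 0"
    using complex_Re_le_cmod[of "- (of_real a * exp (2 * u))"] n assms(2) by simp
  thus ?thesis using norm_Ln_le[of "of_real a * exp (2 * u)"] n assms by (simp add: lgf_eq_Ln)
qed

text \<open>The majorant has to be uniform on a left half-plane. It is claimed for large
  \<open>k\<close> only, because finitely many coefficients may be too large for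
  \<open>norm_lgf_le\<close>.\<close>

lemma eventually_lgf_bound:
  "\<forall>\<^sub>F k in sequentially. \<forall>u. Re u \<le> R \<longrightarrow> norm (lgf (c k) u) \<le> 2 * exp (2 * R) * c k"
proof -
  have "(\<lambda>k. c k * exp (2 * R)) \<longlonglongrightarrow> 0 * exp (2 * R)"
    by (intro tendsto_intros summable_LIMSEQ_zero c_summable)
  hence "\<forall>\<^sub>F k in sequentially. c k * exp (2 * R) < 1 / 2"
    by (rule order_tendstoD) auto
  thus ?thesis
  proof (rule eventually_mono, intro allI impI)
    fix k u assume k: "c k * exp (2 * R) < 1 / 2" and u: "Re u \<le> R"
    have le: "c k * exp (2 * Re u) \<le> c k * exp (2 * R)"
      using u c_nonneg by (intro mult_left_mono) auto
    have "norm (lgf (c k) u) \<le> 2 * (c k * exp (2 * Re u))"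
      using le k c_nonneg by (intro norm_lgf_le) auto
    also have "\<dots> \<le> 2 * exp (2 * R) * c k" using le by (simp add: mult.commute)
    finally show "norm (lgf (c k) u) \<le> 2 * exp (2 * R) * c k" .
  qed
qed

lemma summable_lgf: "summable (\<lambda>k. lgf (c k) u)"
proof (rule summable_comparison_test_ev)
  show "\<forall>\<^sub>F k in sequentially. norm (lgf (c k) u) \<le> 2 * exp (2 * Re u) * c k"
    using eventually_lgf_bound[of "Re u"] by (rule eventually_mono) auto
  show "summable (\<lambda>k. 2 * exp (2 * Re u) * c k)" using c_summable by (rule summable_mult)
qed

lemma exp_LS:
  assumes "u \<in> regular"
  shows "exp (LS u) = gprod (exp (2 * u))"
proof -
  have "gprod (exp (2 * u)) = (\<Prod>k. exp (lgf (c k) u))"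
    unfolding gprod_def using assms by (intro prodinf_cong) (auto simp: regular_def exp_lgf)
  also have "\<dots> = exp (LS u)" unfolding LS_def by (rule prodinf_exp[OF summable_lgf])
  finally show ?thesis by simp
qed

lemma continuous_on_LS: "continuous_on regular LS"
proof -
  have cR: "continuous_on (regular \<inter> {u. Re u \<le> R}) LS" for R
    unfolding LS_def
  proof (rule uniform_limit_theorem)
    show "uniform_limit (regular \<inter> {u. Re u \<le> R}) (\<lambda>n u. \<Sum>k<n. lgf (c k) u) (\<lambda>u. \<Sum>k. lgf (c k) u) sequentially"
    proof (rule Weierstrass_m_test_ev)
      show "\<forall>\<^sub>F k in sequentially. \<forall>u\<in>regular \<inter> {u. Re u \<le> R}. norm (lgf (c k) u) \<le> 2 * exp (2 * R) * c k"
        using eventually_lgf_bound[of R] by (rule eventually_mono) auto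
      show "summable (\<lambda>k. 2 * exp (2 * R) * c k)" using c_summable by (rule summable_mult)
    qed
    show "\<forall>\<^sub>F n in sequentially. continuous_on (regular \<inter> {u. Re u \<le> R}) (\<lambda>u. \<Sum>k<n. lgf (c k) u)"
      by (intro always_eventually allI continuous_on_sum continuous_on_subset[OF continuous_on_lgf[OF c_nonneg]])
         (auto simp: regular_def)
  qed auto
  show ?thesis
  proof (rule continuous_on_eq_continuous_within[THEN iffD2], rule ballI)
    fix x assume x: "x \<in> regular"
    have "open {u. Re u < Re x + 1}" by (intro open_Collect_less continuous_intros)
    moreover have "continuous_on (regular \<inter> {u. Re u < Re x + 1}) LS"
      by (rule continuous_on_subset[OF cR[of "Re x + 1"]]) auto
    ultimately show "continuous (at x within regular) LS"
      using x at_within_nhd[of x "{u. Re u < Re x + 1}" regular "regular \<inter> {u. Re u < Re x + 1}"]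
      unfolding continuous_on_eq_continuous_within continuous_within by auto
  qed
qed

text \<open>The inequality is linear in the logarithms and so passes to the sum term by term; one
  term with a positive coefficient makes it strict.\<close>

lemma LS_key:
  assumes u: "u \<in> regular" and v: "v \<in> regular"
  shows "Im ((LS v - LS u) * cnj (v - u)) \<ge> 0"
    and "c 0 > 0 \<Longrightarrow> u \<noteq> v \<Longrightarrow> \<not> same_edge u v \<Longrightarrow> Im ((LS v - LS u) * cnj (v - u)) > 0"
proof -
  define t where "t = (\<lambda>k. Im ((lgf (c k) v - lgf (c k) u) * cnj (v - u)))"
  have "(\<lambda>k. (lgf (c k) v - lgf (c k) u) * cnj (v - u)) sums ((LS v - LS u) * cnj (v - u))"
    unfolding LS_def by (intro sums_mult2 sums_diff summable_sums summable_lgf)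
  hence s: "t sums Im ((LS v - LS u) * cnj (v - u))"
    unfolding t_def by (simp add: sums_complex_iff)
  have nn: "t k \<ge> 0" for k
    unfolding t_def using u v by (intro lgf_key c_nonneg) (auto simp: regular_def)
  show "Im ((LS v - LS u) * cnj (v - u)) \<ge> 0"
    using s nn by (metis sums_unique sums_summable suminf_nonneg)
  assume "c 0 > 0" "u \<noteq> v" "\<not> same_edge u v"
  hence "t 0 > 0" unfolding t_def using u v by (intro lgf_key c_nonneg) (auto simp: regular_def)
  thus "Im ((LS v - LS u) * cnj (v - u)) > 0"
    using s nn by (metis sums_unique sums_summable suminf_pos2)
qed

lemma Im_LS_bottom: "Im u = 0 \<Longrightarrow> Im (LS u) = 0"
  using sums_Im[OF summable_sums[OF summable_lgf[of u]]]
  by (simp add: LS_def Im_lgf_bottom c_nonneg sums_iff)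

text \<open>Far to the left all \<open>c k * exp (2 * s)\<close> are below 1 at once, so on the
  upper edge every factor is still positive and no argument has been collected.\<close>

lemma LS_top_eq:
  "\<exists>s0. \<forall>s\<le>s0. Complex s (pi / 2) \<in> regular \<and> Im (LS (Complex s (pi / 2))) = 0"
proof -
  \<comment> \<open>The added 1 makes the bound strict for every coefficient, and positive even if
    all of them vanish.\<close>
  define B where "B = suminf c + 1"
  have B: "c k < B" for k
    using sum_le_suminf[OF c_summable, of "{k}"] c_nonneg by (simp add: B_def)
  have Bpos: "B > 0" using B[of 0] c_nonneg[of 0] by linarith
  show ?thesis
  proof (intro exI[of _ "- ln B / 2"] allI impI)
    fix s assume s: "s \<le> - ln B / 2"
    have lt: "c k * exp (2 * s) < 1" for k
    proof -
      have "exp (2 * s) \<le> exp (- ln B)" using s by simp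
      hence "exp (2 * s) \<le> 1 / B" using Bpos by (simp add: exp_minus inverse_eq_divide)
      hence "c k * exp (2 * s) \<le> c k * (1 / B)" using c_nonneg by (rule mult_left_mono)
      also have "\<dots> < 1" using B[of k] Bpos by simp
      finally show ?thesis .
    qed
    let ?u = "Complex s (pi / 2)"
    have "1 + of_real (c k) * exp (2 * ?u) \<noteq> 0" for k
    proof -
      have "1 + of_real (c k) * exp (2 * ?u) = of_real (1 - c k * exp (2 * s))"
        by (subst exp2_top) auto
      thus ?thesis using lt[of k] by (simp del: of_real_diff)
    qed
    moreover have "Im (lgf (c k) ?u) = 0" for k
      using lt[of k] by (subst Im_lgf_top) auto
    ultimately show "?u \<in> regular \<and> Im (LS ?u) = 0"
      using sums_Im[OF summable_sums[OF summable_lgf[of ?u]]]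
      by (simp add: LS_def sums_iff regular_def strip_def)
  qed
qed

end

text \<open>For signs \<open>p\<close> and \<open>q\<close> these are the four symmetries generated
  by negation and conjugation. Having one sign for each coordinate allows the real and imaginary
  parts of an \<alpha>-point to be followed separately.\<close>

definition refl :: "real \<Rightarrow> real \<Rightarrow> complex \<Rightarrow> complex" where
  "refl p q z = Complex (p * Re z) (q * Im z)"

lemma refl_cases:
  assumes "p \<in> {1, -1}" "q \<in> {1, -1}"
  shows "refl p q = (\<lambda>z. z) \<or> refl p q = (\<lambda>z. - z) \<or> refl p q = cnj \<or> refl p q = (\<lambda>z. - cnj z)"
  using assms by (auto simp: refl_def fun_eq_iff complex_eq_iff)

lemma refl_involutive: "p \<in> {1, -1} \<Longrightarrow> q \<in> {1, -1} \<Longrightarrow> refl p q (refl p q z) = z"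
  by (auto simp: refl_def complex_eq_iff)

lemma norm_refl: "p \<in> {1, -1} \<Longrightarrow> q \<in> {1, -1} \<Longrightarrow> norm (refl p q z) = norm z"
  by (auto simp: refl_def cmod_def)

text \<open>Exchanging the two edges turns \<open>1 - d exp(2u)\<close> into the conjugate of a factor \<open>1 + d exp(2u)\<close>.\<close>

definition flip :: "complex \<Rightarrow> complex" where
  "flip u = cnj u + \<i> * (pi / 2)"

lemma flip_strip: "flip u \<in> strip \<longleftrightarrow> u \<in> strip"
  by (auto simp: flip_def strip_def)

lemma exp_flip: "exp (2 * flip u) = - cnj (exp (2 * u))"
proof -
  have "exp (2 * flip u) = exp (2 * cnj u) * exp (\<i> * pi)"
    by (simp add: flip_def exp_add [symmetric] algebra_simps del: exp_pi_i exp_pi_i')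
  thus ?thesis by (simp add: exp_cnj)
qed

lemma (in coeff_seq) cnj_gprod: "cnj (gprod x) = gprod (cnj x)"
proof -
  have "(\<lambda>n. \<Prod>k<n. 1 + of_real (c k) * y) \<longlonglongrightarrow> gprod y" for y
    unfolding gprod_def by (rule has_prod_imp_tendsto'[OF convergent_prod_has_prod[OF convergent_factors]])
  from tendsto_cnj[OF this[of x]] this[of "cnj x"] show ?thesis
    by (intro LIMSEQ_unique) auto
qed

text \<open>The sequences \<open>c\<close> and \<open>d\<close> stand for the reciprocals of the \<open>a\<^sub>\<nu>\<close> and \<open>b\<^sub>\<mu>\<close>, continued by 0.\<close>

locale lk_function = num: coeff_seq c + den: coeff_seq d
  for c d :: "nat \<Rightarrow> real" +
  fixes j :: nat and A :: real
  assumes c0: "0 < c 0" and A_nonneg: "0 \<le> A"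
begin

section \<open>The function \<open>F\<close> and its logarithm on the strip\<close>

definition Nm :: "complex \<Rightarrow> complex" where
  "Nm x = x ^ (2 * j + 1) * exp (of_real A * x\<^sup>2) * num.gprod (x\<^sup>2)"

definition Dn :: "complex \<Rightarrow> complex" where
  "Dn x = den.gprod (- (x\<^sup>2))"

definition F :: "complex \<Rightarrow> complex" where
  "F x = Nm x / Dn x"

lemma Nm_holomorphic: "Nm holomorphic_on UNIV"
  unfolding Nm_def
  by (intro holomorphic_intros holomorphic_on_compose_gen[OF _ num.gprod_holomorphic, unfolded o_def]) auto

lemma Dn_holomorphic: "Dn holomorphic_on UNIV"
  unfolding Dn_def
  by (intro holomorphic_intros holomorphic_on_compose_gen[OF _ den.gprod_holomorphic, unfolded o_def]) auto

lemma continuous_on_Nm: "continuous_on S Nm" and continuous_on_Dn: "continuous_on S Dn"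
  using Nm_holomorphic Dn_holomorphic
  by (auto intro: holomorphic_on_imp_continuous_on continuous_on_subset)

lemma Nm_0: "Nm 0 = 0" and Dn_0: "Dn 0 = 1"
  by (simp_all add: Nm_def Dn_def den.gprod_def)

lemma F_0: "F 0 = 0" by (simp add: F_def Nm_0)

lemma F_minus: "F (- x) = - F x"
  by (simp add: F_def Nm_def Dn_def)

lemma F_cnj: "F (cnj x) = cnj (F x)"
  by (simp add: F_def Nm_def Dn_def num.cnj_gprod den.cnj_gprod exp_cnj)

lemma F_refl:
  assumes "p \<in> {1, -1}" "q \<in> {1, -1}"
  shows "F (refl p q x) = refl p q (F x)"
  using refl_cases[OF assms] by (elim disjE) (simp_all add: F_minus F_cnj)

text \<open>This is the \<open>L\<close> of the overview. The conjugate of \<open>den.LS\<close> at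
  the flipped point is a logarithm of \<open>Dn (exp u)\<close>, by \<open>Dn_exp\<close>, so one
  kind of branch serves numerator and denominator.\<close>

definition Lt :: "complex \<Rightarrow> complex" where
  "Lt u = of_nat (2 * j + 1) * u + of_real A * exp (2 * u) + num.LS u - cnj (den.LS (flip u))"

definition dom :: "complex set" where
  "dom = {u. u \<in> num.regular \<and> flip u \<in> den.regular}"

lemma Dn_exp: "Dn (exp u) = cnj (den.gprod (exp (2 * flip u)))"
  unfolding Dn_def exp_flip den.cnj_gprod by (simp add: exp_double)

lemma Nm_exp: "Nm (exp u) = exp (of_nat (2 * j + 1) * u) * exp (of_real A * exp (2 * u)) * num.gprod (exp (2 * u))"
  unfolding Nm_def by (simp only: exp_of_nat_mult exp_double)

lemma dom_iff: "u \<in> dom \<longleftrightarrow> u \<in> strip \<and> Nm (exp u) \<noteq> 0 \<and> Dn (exp u) \<noteq> 0"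
  by (auto simp: dom_def num.regular_iff den.regular_iff flip_strip Dn_exp Nm_exp)

lemma exp_Lt:
  assumes "u \<in> dom"
  shows "exp (Lt u) = F (exp u)"
proof -
  have "exp (num.LS u) = num.gprod (exp (2 * u))" "exp (den.LS (flip u)) = den.gprod (exp (2 * flip u))"
    using assms by (auto simp: dom_def num.exp_LS den.exp_LS)
  thus ?thesis
    unfolding F_def Dn_exp Nm_exp Lt_def exp_add exp_diff exp_cnj[symmetric] by simp
qed

lemma continuous_on_Lt: "continuous_on dom Lt"
proof -
  have "continuous_on dom (\<lambda>u. den.LS (flip u))"
    by (rule continuous_on_compose2[OF den.continuous_on_LS])
       (auto simp: dom_def flip_def intro!: continuous_intros)
  moreover have "continuous_on dom num.LS"
    by (rule continuous_on_subset[OF num.continuous_on_LS]) (auto simp: dom_def)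
  ultimately show ?thesis unfolding Lt_def by (intro continuous_intros)
qed

text \<open>The linear term contributes a real number. In the denominator term
  \<open>flip v - flip u = cnj (v - u)\<close>, and the minus sign is compensated by the outer
  conjugation, which reverses the imaginary part. Strictness is supplied by the numerator factor
  with coefficient \<open>c 0\<close>.\<close>

lemma Lt_key:
  assumes u: "u \<in> dom" and v: "v \<in> dom"
  shows "Im ((Lt v - Lt u) * cnj (v - u)) \<ge> 0"
    and "u \<noteq> v \<Longrightarrow> \<not> same_edge u v \<Longrightarrow> Im ((Lt v - Lt u) * cnj (v - u)) > 0"
proof -
  let ?D = "cnj (v - u)"
  have "(Lt v - Lt u) * ?D = of_nat (2 * j + 1) * ((v - u) * ?D) + of_real A * ((exp (2 * v) - exp (2 * u)) * ?D)
      + (num.LS v - num.LS u) * ?D - cnj ((den.LS (flip v) - den.LS (flip u)) * cnj (flip v - flip u))"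
    by (simp add: Lt_def flip_def algebra_simps)
  moreover have "(v - u) * ?D = of_real ((norm (v - u))\<^sup>2)" by (metis complex_norm_square of_real_power)
  ultimately have eq: "Im ((Lt v - Lt u) * ?D) = A * Im ((exp (2 * v) - exp (2 * u)) * ?D)
      + Im ((num.LS v - num.LS u) * ?D) + Im ((den.LS (flip v) - den.LS (flip u)) * cnj (flip v - flip u))"
    by (simp del: of_real_power complex_cnj_diff complex_cnj_mult times_complex.sel of_nat_Suc)
       (simp del: of_real_power complex_cnj_diff complex_cnj_mult)
  have 1: "A * Im ((exp (2 * v) - exp (2 * u)) * ?D) \<ge> 0"
    using exp2_key[of u v] A_nonneg u v by (intro mult_nonneg_nonneg) (auto simp: dom_iff)
  have 2: "Im ((num.LS v - num.LS u) * ?D) \<ge> 0"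
    using num.LS_key(1) u v by (auto simp: dom_def)
  have 3: "Im ((den.LS (flip v) - den.LS (flip u)) * cnj (flip v - flip u)) \<ge> 0"
    using den.LS_key(1) u v by (auto simp: dom_def)
  show "Im ((Lt v - Lt u) * ?D) \<ge> 0" using 1 2 3 unfolding eq by linarith
  assume "u \<noteq> v" "\<not> same_edge u v"
  hence "Im ((num.LS v - num.LS u) * ?D) > 0"
    using num.LS_key(2)[OF _ _ c0] u v by (auto simp: dom_def)
  thus "Im ((Lt v - Lt u) * ?D) > 0" using 1 3 unfolding eq by linarith
qed

lemma Re_Lt: "u \<in> dom \<Longrightarrow> exp (Re (Lt u)) = norm (F (exp u))"
  by (simp flip: exp_Lt add: norm_exp_eq_Re)

lemma F_exp_polar: "u \<in> dom \<Longrightarrow> F (exp u) = of_real (norm (F (exp u))) * cis (Im (Lt u))"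
  by (metis exp_Lt exp_eq_polar norm_exp_eq_Re)

lemma F_real: "Im x = 0 \<Longrightarrow> Im (F x) = 0"
  using F_cnj[of x] by (metis complex_is_Real_iff Reals_cnj_iff)

lemma F_imag:
  assumes "Re x = 0"
  shows "Re (F x) = 0"
proof -
  have "- cnj x = x" using assms by (simp add: complex_eq_iff)
  hence "F x = - cnj (F x)" using F_cnj[of x] F_minus[of "cnj x"] by simp
  from arg_cong[OF this, of Re] show ?thesis by simp
qed

lemma Im_Lt_bottom:
  assumes "u \<in> dom" "Im u = 0"
  shows "\<exists>n::int. Im (Lt u) = of_int n * pi"
proof -
  have "F (exp u) \<noteq> 0" using assms by (simp flip: exp_Lt)
  moreover have "Im (F (exp u)) = 0" by (rule F_real) (simp add: Im_exp assms)
  ultimately have "sin (Im (Lt u)) = 0" by (subst (asm) F_exp_polar[OF assms(1)]) simp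
  thus ?thesis using sin_zero_iff_int2 by blast
qed

lemma Im_Lt_top:
  assumes "u \<in> dom" "Im u = pi / 2"
  shows "\<exists>n::int. Im (Lt u) = pi / 2 + of_int n * pi"
proof -
  have "F (exp u) \<noteq> 0" using assms by (simp flip: exp_Lt)
  moreover have "Re (F (exp u)) = 0" by (rule F_imag) (simp add: Re_exp assms)
  ultimately have "cos (Im (Lt u)) = 0" by (subst (asm) F_exp_polar[OF assms(1)]) simp
  then obtain n where "Im (Lt u) = of_int n * pi + pi / 2" using cos_zero_iff_int2 by auto
  thus ?thesis by (auto intro!: exI[of _ n])
qed

lemma Nm_eq_0:
  assumes "u \<in> strip" "Nm (exp u) = 0"
  shows "Im u = pi / 2"
proof -
  have "num.gprod (exp (2 * u)) = 0" using assms by (simp add: Nm_exp)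
  thus ?thesis using one_plus_nz[OF assms(1) _ num.c_nonneg] by (auto simp: num.gprod_eq_0_iff)
qed

lemma Dn_eq_0:
  assumes "u \<in> strip" "Dn (exp u) = 0"
  shows "Im u = 0"
proof -
  have "den.gprod (exp (2 * flip u)) = 0" using assms by (simp add: Dn_exp)
  hence "Im (flip u) = pi / 2"
    using one_plus_nz[OF _ _ den.c_nonneg, of "flip u"] assms by (auto simp: den.gprod_eq_0_iff flip_strip)
  thus ?thesis by (simp add: flip_def)
qed

text \<open>Far to the left on the upper edge only the power \<open>z ^ (2 * j + 1)\<close>
  contributes to the argument, and along the edge the argument does not decrease to the right. This
  bound is the source of the assertion \<open>j = 0\<close>.\<close>

lemma Im_Lt_top_ge:
  assumes u: "u \<in> dom" "Im u = pi / 2"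
  shows "Im (Lt u) \<ge> real (2 * j + 1) * (pi / 2)"
proof -
  obtain s0 where s0: "\<And>s. s \<le> s0 \<Longrightarrow> Complex s (pi / 2) \<in> num.regular"
     "\<And>s. s \<le> s0 \<Longrightarrow> Im (num.LS (Complex s (pi / 2))) = 0"
    using num.LS_top_eq by blast
  define s where "s = min s0 (Re u - 1)"
  define v where "v = Complex s (pi / 2)"
  have fl: "Im (flip v) = 0" by (simp add: v_def flip_def)
  have vs: "v \<in> strip" by (simp add: v_def strip_def)
  have "flip v \<in> den.regular"
    using one_plus_nz[OF _ _ den.c_nonneg, of "flip v"] fl vs
    by (auto simp: den.regular_def flip_strip)
  hence v: "v \<in> dom" using s0(1)[of s] by (simp add: dom_def v_def s_def)
  have "Im (Lt v) = real (2 * j + 1) * (pi / 2)"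
    using s0(2)[of s] exp2_top[of v] den.Im_LS_bottom[OF fl]
    by (simp add: Lt_def v_def s_def)
  moreover have "Im ((Lt u - Lt v) * cnj (u - v)) = (Im (Lt u) - Im (Lt v)) * (Re u - s)"
    using u by (simp add: v_def)
  moreover have "Im ((Lt u - Lt v) * cnj (u - v)) \<ge> 0" by (rule Lt_key(1)[OF v u(1)])
  moreover have "Re u - s > 0" by (simp add: s_def)
  ultimately show ?thesis by (simp add: zero_le_mult_iff)
qed

end

section \<open>The level curve\<close>

locale lk_level = lk_function +
  fixes \<rho> :: real
  assumes rho_pos: "0 < \<rho>"
begin

text \<open>Multiplying \<open>norm F - \<rho>\<close> by the norm of the denominator keeps its sign
  and gives a function that is continuous at the poles too, where it is positive.\<close>

definition M :: "real \<Rightarrow> real \<Rightarrow> real" where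
  "M s t = norm (Nm (exp (Complex s t))) - \<rho> * norm (Dn (exp (Complex s t)))"

lemma M_le_iff:
  assumes "Complex s t \<in> dom"
  shows "M s t \<le> 0 \<longleftrightarrow> Re (Lt (Complex s t)) \<le> ln \<rho>" "M s t \<ge> 0 \<longleftrightarrow> Re (Lt (Complex s t)) \<ge> ln \<rho>"
proof -
  have "norm (F (exp (Complex s t))) = norm (Nm (exp (Complex s t))) / norm (Dn (exp (Complex s t)))"
    by (simp add: F_def norm_divide)
  moreover have "norm (Dn (exp (Complex s t))) > 0" using assms by (simp add: dom_iff)
  ultimately have "M s t \<le> 0 \<longleftrightarrow> norm (F (exp (Complex s t))) \<le> \<rho>" "M s t \<ge> 0 \<longleftrightarrow> norm (F (exp (Complex s t))) \<ge> \<rho>"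
    by (simp_all add: M_def divide_le_eq le_divide_eq)
  moreover have "r \<le> \<rho> \<longleftrightarrow> ln r \<le> ln \<rho>" "\<rho> \<le> r \<longleftrightarrow> ln \<rho> \<le> ln r" if "r > 0" for r
    using that rho_pos by simp_all
  moreover have "norm (F (exp (Complex s t))) > 0" by (simp flip: Re_Lt[OF assms])
  moreover have "ln (norm (F (exp (Complex s t)))) = Re (Lt (Complex s t))" by (simp flip: Re_Lt[OF assms])
  ultimately show "M s t \<le> 0 \<longleftrightarrow> Re (Lt (Complex s t)) \<le> ln \<rho>" "M s t \<ge> 0 \<longleftrightarrow> Re (Lt (Complex s t)) \<ge> ln \<rho>"
    by metis+
qed

lemma M_eq_iff:
  assumes "Complex s t \<in> dom"
  shows "M s t = 0 \<longleftrightarrow> norm (F (exp (Complex s t))) = \<rho>"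
proof -
  have "norm (Dn (exp (Complex s t))) > 0" using assms by (simp add: dom_iff)
  thus ?thesis by (simp add: M_def F_def norm_divide field_simps)
qed

text \<open>For a vertical pair \<open>v - u\<close> is a positive multiple of \<open>\<i>\<close>,
  so \<open>Lt_key\<close> says that \<open>Re Lt\<close>, the logarithm of the modulus of
  \<open>F\<close>, decreases. Zeros and poles are handled without a logarithm:
  \<open>M s t \<le> 0\<close> rules out a pole at \<open>t\<close>, and at a zero \<open>M\<close>
  is negative.\<close>

lemma M_neg:
  assumes "0 \<le> t" "t < t'" "t' \<le> pi / 2" "M s t \<le> 0"
  shows "M s t' < 0"
proof -
  let ?u = "Complex s t" and ?v = "Complex s t'"
  have us: "?u \<in> strip" and vs: "?v \<in> strip" using assms by (auto simp: strip_def)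
  have "Nm (exp ?u) \<noteq> 0" using Nm_eq_0[OF us] assms by auto
  moreover from this have "Dn (exp ?u) \<noteq> 0" using assms(4) by (auto simp: M_def)
  ultimately have u: "?u \<in> dom" using us by (simp add: dom_iff)
  have Dv: "Dn (exp ?v) \<noteq> 0" using Dn_eq_0[OF vs] assms by auto
  show ?thesis
  proof (cases "Nm (exp ?v) = 0")
    case True thus ?thesis using Dv rho_pos by (simp add: M_def)
  next
    case False
    hence v: "?v \<in> dom" using Dv vs by (simp add: dom_iff)
    have "?u \<noteq> ?v" "\<not> same_edge ?u ?v" using assms by (auto simp: same_edge_def)
    from Lt_key(2)[OF u v this] have "Re (Lt ?v) < Re (Lt ?u)"
      using assms by (simp add: zero_less_mult_iff)
    moreover have "Re (Lt ?u) \<le> ln \<rho>" using M_le_iff(1)[OF u] assms by simp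
    ultimately show ?thesis using M_le_iff(2)[OF v] by linarith
  qed
qed

lemma continuous_M: "continuous_on UNIV (\<lambda>p. M (fst p) (snd p))"
  unfolding M_def Complex_eq
  by (intro continuous_intros continuous_on_compose2[OF continuous_on_Nm[of UNIV]]
       continuous_on_compose2[OF continuous_on_Dn[of UNIV]]) auto

lemma continuous_M': "continuous_on S f \<Longrightarrow> continuous_on S g \<Longrightarrow> continuous_on S (\<lambda>x. M (f x) (g x))"
  using continuous_on_compose2[OF continuous_M, of S "\<lambda>x. (f x, g x)"]
  by (auto intro!: continuous_intros)

text \<open>Where the level \<open>\<rho>\<close> is not attained on the segment over \<open>s\<close>, the curve follows the edge on which \<open>|F|\<close>
  is closest to it.\<close>

definition clamped :: "real \<Rightarrow> real \<Rightarrow> bool" where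
  "clamped s t \<longleftrightarrow> 0 \<le> t \<and> t \<le> pi / 2 \<and> (M s t = 0 \<or> t = 0 \<and> M s t \<le> 0 \<or> t = pi / 2 \<and> M s t \<ge> 0)"

definition Th :: "real \<Rightarrow> real" where "Th s = (SOME t. clamped s t)"

lemma clamped_Th: "clamped s (Th s)"
proof -
  have "\<exists>t. clamped s t"
  proof (cases "M s 0 \<le> 0 \<or> M s (pi / 2) \<ge> 0")
    case True
    thus ?thesis by (auto simp: clamped_def intro: exI[of _ 0] exI[of _ "pi / 2"])
  next
    case False
    have "\<exists>t\<ge>0. t \<le> pi / 2 \<and> M s t = 0"
      by (rule IVT2') (use False in \<open>auto intro!: continuous_M' continuous_intros\<close>)
    thus ?thesis by (auto simp: clamped_def)
  qed
  thus ?thesis unfolding Th_def by (rule someI_ex)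
qed

lemma Th_range: "0 \<le> Th s" "Th s \<le> pi / 2"
  using clamped_Th[of s] by (auto simp: clamped_def)

lemma M_Th_le: "Th s < pi / 2 \<Longrightarrow> M s (Th s) \<le> 0"
  and M_Th_ge: "0 < Th s \<Longrightarrow> M s (Th s) \<ge> 0"
  using clamped_Th[of s] by (auto simp: clamped_def)

text \<open>By \<open>M_neg\<close> the sign of \<open>M\<close> changes at most once along a
  vertical segment, and \<open>Th s\<close> marks the change. This determines \<open>Th s\<close>,
  although it is defined by a choice.\<close>

lemma Th_gt_iff:
  assumes "0 \<le> t" "t < pi / 2"
  shows "t < Th s \<longleftrightarrow> 0 < M s t"
proof
  assume t: "t < Th s"
  hence "M s (Th s) \<ge> 0" using assms M_Th_ge by simp
  thus "0 < M s t" using M_neg[OF assms(1) t Th_range(2), of s] by linarith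
next
  assume M: "0 < M s t"
  show "t < Th s"
  proof (rule ccontr)
    assume n: "\<not> t < Th s"
    hence "M s (Th s) \<le> 0" using M_Th_le assms by simp
    moreover have "Th s < t" using n M calculation by (cases "Th s = t") auto
    ultimately have "M s t < 0" using M_neg[OF Th_range(1) \<open>Th s < t\<close>] assms by simp
    thus False using M by simp
  qed
qed

lemma Th_lt_iff:
  assumes "0 < t" "t \<le> pi / 2"
  shows "Th s < t \<longleftrightarrow> M s t < 0"
proof
  assume t: "Th s < t"
  hence "M s (Th s) \<le> 0" using assms M_Th_le by simp
  thus "M s t < 0" using M_neg[OF Th_range(1) t assms(2)] by blast
next
  assume M: "M s t < 0"
  show "Th s < t"
  proof (rule ccontr)
    assume n: "\<not> Th s < t"
    hence ge: "M s (Th s) \<ge> 0" using M_Th_ge assms by simp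
    hence "t < Th s" using n M by (cases "Th s = t") auto
    hence "M s (Th s) < 0" using M_neg[of t "Th s" s] Th_range assms M by simp
    thus False using ge by simp
  qed
qed

lemma Th_eqI: "0 \<le> t \<Longrightarrow> t \<le> pi / 2 \<Longrightarrow> M s t = 0 \<Longrightarrow> Th s = t"
  using Th_gt_iff[of t s] Th_lt_iff[of t s] Th_range[of s] by fastforce

lemma Th_bottom_iff: "Th s = 0 \<longleftrightarrow> M s 0 \<le> 0"
  using Th_gt_iff[of 0 s] Th_range[of s] by fastforce

lemma Th_top_iff: "Th s = pi / 2 \<longleftrightarrow> M s (pi / 2) \<ge> 0"
  using Th_lt_iff[of "pi / 2" s] Th_range[of s] by fastforce

text \<open>For fixed \<open>t\<close> the conditions \<open>t < Th s\<close> and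
  \<open>Th s < t\<close> are strict inequalities for \<open>M\<close>, which is continuous in
  \<open>s\<close>; hence they persist nearby. Bounds outside the range of \<open>Th\<close> hold
  trivially.\<close>

lemma continuous_on_Th: "continuous_on UNIV Th"
proof (rule continuous_at_imp_continuous_on, rule ballI)
  fix s
  have Mc: "((\<lambda>x. M x t) \<longlongrightarrow> M s t) (at s)" for t
    using continuous_M'[of UNIV "\<lambda>x. x" "\<lambda>_. t"]
    by (auto simp: continuous_on_eq_continuous_at isCont_def intro!: continuous_intros)
  show "isCont Th s" unfolding isCont_def
  proof (rule order_tendstoI)
    fix a assume a: "a < Th s"
    show "\<forall>\<^sub>F x in at s. a < Th x"
    proof (cases "a < 0")
      case True thus ?thesis using Th_range(1) by (intro always_eventually) (meson less_le_trans)
    next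
      case False
      hence a': "0 \<le> a" "a < pi / 2" using a Th_range(2)[of s] by auto
      hence "0 < M s a" using a Th_gt_iff by blast
      from order_tendstoD(1)[OF Mc this] show ?thesis using Th_gt_iff[OF a'] by simp
    qed
  next
    fix a assume a: "Th s < a"
    show "\<forall>\<^sub>F x in at s. Th x < a"
    proof (cases "a > pi / 2")
      case True thus ?thesis using Th_range(2) by (intro always_eventually) (meson le_less_trans)
    next
      case False
      hence a': "0 < a" "a \<le> pi / 2" using a Th_range(1)[of s] by auto
      hence "M s a < 0" using a Th_lt_iff by blast
      from order_tendstoD(2)[OF Mc this] show ?thesis using Th_lt_iff[OF a'] by simp
    qed
  qed
qed

definition curve :: "real \<Rightarrow> complex" where "curve s = Complex s (Th s)"

lemma curve_dom: "curve s \<in> dom"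
proof -
  have st: "curve s \<in> strip" using Th_range by (auto simp: curve_def strip_def)
  have "Nm (exp (curve s)) \<noteq> 0"
  proof
    assume N: "Nm (exp (curve s)) = 0"
    hence t: "Th s = pi / 2" using Nm_eq_0[OF st] by (simp add: curve_def)
    hence "Dn (exp (curve s)) \<noteq> 0" using Dn_eq_0[OF st] by (auto simp: curve_def)
    hence "M s (Th s) < 0" using N rho_pos by (simp add: M_def curve_def)
    thus False using M_Th_ge[of s] t by simp
  qed
  moreover have "Dn (exp (curve s)) \<noteq> 0"
  proof
    assume D: "Dn (exp (curve s)) = 0"
    hence t: "Th s = 0" using Dn_eq_0[OF st] by (simp add: curve_def)
    hence "Nm (exp (curve s)) \<noteq> 0" using Nm_eq_0[OF st] by (auto simp: curve_def)
    hence "M s (Th s) > 0" using D by (simp add: M_def curve_def)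
    thus False using M_Th_le[of s] t by simp
  qed
  ultimately show ?thesis using st by (simp add: dom_iff)
qed

section \<open>The argument of \<open>F\<close> along the curve\<close>

definition Ph :: "real \<Rightarrow> real" where "Ph s = Im (Lt (curve s))"

lemma continuous_on_Ph: "continuous_on S Ph"
proof -
  have "continuous_on UNIV curve"
    unfolding curve_def Complex_eq by (intro continuous_intros continuous_on_Th)
  hence "continuous_on UNIV (\<lambda>s. Lt (curve s))"
    by (rule continuous_on_compose2[OF continuous_on_Lt]) (auto simp: curve_dom)
  hence "continuous_on UNIV Ph" unfolding Ph_def by (intro continuous_intros)
  thus ?thesis by (rule continuous_on_subset) simp
qed

lemma isCont_Ph: "isCont Ph s"
  using continuous_on_Ph[of UNIV] by (simp add: continuous_on_eq_continuous_at)

text \<open>The imaginary part in \<open>Lt_key\<close> is the increment of \<open>Ph\<close> times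
  \<open>s' - s\<close>, minus the increment of \<open>Re Lt\<close> times that of
  \<open>Th\<close>. The latter product is nonnegative, so the former is positive.\<close>

lemma Ph_strict:
  assumes s: "s < s'" and ne: "\<not> (Th s = 0 \<and> Th s' = 0)" "\<not> (Th s = pi / 2 \<and> Th s' = pi / 2)"
  shows "Ph s < Ph s'"
proof -
  have "Im ((Lt (curve s') - Lt (curve s)) * cnj (curve s' - curve s)) > 0"
    using ne s by (intro Lt_key curve_dom) (auto simp: curve_def same_edge_def)
  hence "(Ph s' - Ph s) * (s' - s) > (Re (Lt (curve s')) - Re (Lt (curve s))) * (Th s' - Th s)"
    by (simp add: Ph_def curve_def algebra_simps)
  moreover have "(Re (Lt (curve s')) - Re (Lt (curve s))) * (Th s' - Th s) \<ge> 0"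
  proof -
    \<comment> \<open>Below the upper edge the modulus on the curve is at most \<rho>, above the
      lower edge at least \<rho>. So the higher of two curve points has at least the modulus of the
      other.\<close>
    have up: "Th s < pi / 2 \<Longrightarrow> Re (Lt (curve s)) \<le> ln \<rho>" "0 < Th s \<Longrightarrow> Re (Lt (curve s)) \<ge> ln \<rho>" for s
      using M_le_iff[of s "Th s"] curve_dom[of s] M_Th_le[of s] M_Th_ge[of s] by (auto simp: curve_def)
    consider "Th s < Th s'" | "Th s' < Th s" | "Th s = Th s'" by linarith
    thus ?thesis
    proof cases
      case 1
      hence "Th s < pi / 2" "Th s' > 0" using Th_range[of s] Th_range[of s'] by linarith+
      with up[of s] up[of s'] 1 show ?thesis by (intro mult_nonneg_nonneg) linarith+
    next
      case 2
      hence "Th s' < pi / 2" "Th s > 0" using Th_range[of s] Th_range[of s'] by linarith+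
      with up[of s] up[of s'] 2 show ?thesis by (intro mult_nonpos_nonpos) linarith+
    qed simp
  qed
  ultimately have "(Ph s' - Ph s) * (s' - s) > 0" by linarith
  thus "Ph s < Ph s'" using s by (simp add: zero_less_mult_iff)
qed

lemma Ph_mono:
  assumes "s \<le> s'"
  shows "Ph s \<le> Ph s'"
proof (cases "s = s' \<or> \<not> ((Th s = 0 \<and> Th s' = 0) \<or> (Th s = pi / 2 \<and> Th s' = pi / 2))")
  case True thus ?thesis using Ph_strict[of s s'] assms by (cases "s = s'") force+
next
  case False
  have "Im ((Lt (curve s') - Lt (curve s)) * cnj (curve s' - curve s)) \<ge> 0"
    by (intro Lt_key curve_dom)
  moreover have "Th s' = Th s" using False by auto
  ultimately have "(Ph s' - Ph s) * (s' - s) \<ge> 0" by (simp add: Ph_def curve_def)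
  thus ?thesis using False assms by (simp add: zero_le_mult_iff)
qed

text \<open>Near the origin \<open>F\<close> is small, so the curve starts on the lower edge, and
  for small modulus every logarithm in \<open>Lt\<close> is real there.\<close>

lemma Ph_start: "\<exists>s0. \<forall>s\<le>s0. Th s = 0 \<and> M s 0 < 0 \<and> Ph s = 0"
proof -
  have "continuous_on UNIV (\<lambda>x. norm (Nm x) - \<rho> * norm (Dn x))"
    by (intro continuous_intros continuous_on_Nm continuous_on_Dn)
  hence "((\<lambda>x. norm (Nm x) - \<rho> * norm (Dn x)) \<longlongrightarrow> norm (Nm 0) - \<rho> * norm (Dn 0)) (nhds 0)"
    unfolding continuous_on_eq_continuous_at[OF open_UNIV] isCont_def
    by (subst tendsto_at_iff_tendsto_nhds[symmetric]) blast
  moreover have "((\<lambda>s. exp (of_real s) :: complex) \<longlongrightarrow> 0) at_bot"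
    using tendsto_of_real[OF exp_at_bot, where ?'a = complex] by (simp add: exp_of_real)
  ultimately have "((\<lambda>s. M s 0) \<longlongrightarrow> - \<rho>) at_bot"
    unfolding M_def complex_of_real_def[symmetric] Nm_0 Dn_0
    by (auto dest: filterlim_compose)
  hence "\<forall>\<^sub>F s in at_bot. M s 0 < 0" using rho_pos by (intro order_tendstoD) auto
  then obtain s1 where s1: "\<And>s. s \<le> s1 \<Longrightarrow> M s 0 < 0" by (auto simp: eventually_at_bot_linorder)
  obtain s2 where s2: "\<And>s. s \<le> s2 \<Longrightarrow> Im (den.LS (Complex s (pi / 2))) = 0"
    using den.LS_top_eq by blast
  show ?thesis
  proof (intro exI[of _ "min s1 s2"] allI impI)
    fix s assume s: "s \<le> min s1 s2"
    have M: "M s 0 < 0" using s1 s by simp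
    have T: "Th s = 0" using Th_bottom_iff M by simp
    have fl: "flip (Complex s 0) = Complex s (pi / 2)" by (simp add: flip_def complex_eq_iff)
    have "Ph s = 0"
      using s2[of s] s num.Im_LS_bottom[of "Complex s 0"] exp2_bottom[of "Complex s 0"]
      by (simp add: Ph_def curve_def T Lt_def fl)
    thus "Th s = 0 \<and> M s 0 < 0 \<and> Ph s = 0" using T M by simp
  qed
qed

lemma Ph_nonneg: "0 \<le> Ph s"
proof -
  obtain s0 where "\<And>s. s \<le> s0 \<Longrightarrow> Ph s = 0" using Ph_start by blast
  hence "Ph (min s s0) = 0" by simp
  thus ?thesis using Ph_mono[of "min s s0" s] by simp
qed

text \<open>A point with \<open>Th s > 0\<close> does not share the lower edge with the starting
  points, so \<open>Ph_strict\<close> compares it with them. Equivalently, the curve stays on the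
  lower edge as long as \<open>Ph\<close> is 0.\<close>

lemma Ph_pos:
  assumes "0 < Th s"
  shows "0 < Ph s"
proof -
  obtain s0 where s0: "\<And>s. s \<le> s0 \<Longrightarrow> Th s = 0" "\<And>s. s \<le> s0 \<Longrightarrow> Ph s = 0" using Ph_start by blast
  define s' where "s' = min s0 (s - 1)"
  have "Ph s' < Ph s" using s0[of s'] assms by (intro Ph_strict) (auto simp: s'_def)
  thus ?thesis using s0[of s'] by (simp add: s'_def)
qed

lemma Ph_IVT:
  assumes "0 \<le> y" "y \<le> Ph s"
  shows "\<exists>s'\<le>s. Ph s' = y"
proof -
  obtain s0 where s0: "\<And>s. s \<le> s0 \<Longrightarrow> Ph s = 0" using Ph_start by blast
  have "Ph (min s0 s) \<le> y" using s0[of "min s0 s"] assms by simp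
  from IVT'[OF this assms(2) _ continuous_on_Ph] show ?thesis by (meson min.cobounded2 order_trans)
qed

lemma Ph_bottom: "M s 0 \<le> 0 \<Longrightarrow> \<exists>n::int. Ph s = of_int n * pi"
  using Im_Lt_bottom[OF curve_dom, of s] by (simp add: Ph_def curve_def Th_bottom_iff)

lemma Ph_top: "0 \<le> M s (pi / 2) \<Longrightarrow> \<exists>n::int. Ph s = pi / 2 + of_int n * pi"
  using Im_Lt_top[OF curve_dom, of s] Th_top_iff[of s] by (simp add: Ph_def curve_def)

lemma F_curve:
  assumes "M s (Th s) = 0"
  shows "F (exp (curve s)) = of_real \<rho> * cis (Ph s)"
  using F_exp_polar[OF curve_dom, of s] M_eq_iff[of s "Th s"] curve_dom[of s] assms
  by (simp add: Ph_def curve_def)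

text \<open>Reflection into the closed first quadrant followed by \<open>Ln\<close> gives a point of
  the strip on the level \<rho>; over each \<open>s\<close> the only such point is that of the
  curve, by \<open>Th_eqI\<close>.\<close>

lemma alpha_point_curve:
  assumes "norm (F w) = \<rho>"
  obtains p q where "p \<in> {1, -1}" "q \<in> {1, -1}" "w = refl p q (exp (curve (ln (norm w))))"
     "M (ln (norm w)) (Th (ln (norm w))) = 0" "w \<noteq> 0"
proof -
  have w0: "w \<noteq> 0" using assms rho_pos by (auto simp: F_0)
  define p q where "p = (if Re w < 0 then -1 else 1 :: real)" "q = (if Im w < 0 then -1 else 1 :: real)"
  have pq: "p \<in> {1, -1}" "q \<in> {1, -1}" by (auto simp: p_q_def)
  define w' where "w' = refl p q w"
  have re: "Re w' \<ge> 0" "Im w' \<ge> 0" by (auto simp: w'_def refl_def p_q_def)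
  have nw: "norm w' = norm w" unfolding w'_def by (rule norm_refl[OF pq])
  hence w'0: "w' \<noteq> 0" using w0 by auto
  define s t where "s = ln (norm w)" "t = Im (Ln w')"
  have e: "exp (Complex s t) = w'"
  proof -
    have "Ln w' = Complex s t" using w'0 nw by (simp add: complex_eq_iff s_t_def)
    thus ?thesis using w'0 exp_Ln by metis
  qed
  have t: "0 \<le> t" "t \<le> pi / 2"
    using Im_Ln_pos_le[OF w'0] Re_Ln_pos_le[OF w'0] re by (auto simp: s_t_def)
  have "norm (F w') = \<rho>" using assms by (simp add: w'_def F_refl[OF pq] norm_refl[OF pq])
  have dom: "Complex s t \<in> dom"
    using \<open>norm (F w') = \<rho>\<close> rho_pos t e by (auto simp: dom_iff strip_def F_def)
  hence M: "M s t = 0" using \<open>norm (F w') = \<rho>\<close> M_eq_iff e by simp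
  hence T: "Th s = t" using t by (intro Th_eqI)
  have "w = refl p q w'" by (simp add: w'_def refl_involutive[OF pq])
  thus ?thesis using that[OF pq] M T e w0 by (simp add: curve_def s_t_def)
qed

end

section \<open>Multiplicities\<close>

text \<open>The range of the angle matters at an edge: for order at least 3 the half-turn of
  admissible directions, multiplied by the order minus 1, covers \<open>[0, 2 * pi)\<close>.\<close>

lemma exists_direction_Im_neg:
  assumes "C \<noteq> 0"
  shows "\<exists>\<psi>. 0 \<le> \<psi> \<and> \<psi> < 2 * pi \<and> Im (C * cis \<psi>) < 0"
proof -
  define \<theta> where "\<theta> = Arg C"
  define \<psi> where "\<psi> = (if \<theta> \<le> - pi / 2 then - pi / 2 - \<theta> else 3 * pi / 2 - \<theta>)"
  have \<theta>: "- pi < \<theta>" "\<theta> \<le> pi" using mpi_less_Arg Arg_le_pi by (auto simp: \<theta>_def)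
  have "sin (\<theta> + \<psi>) = - 1"
    using sin_3over2_pi by (auto simp: \<psi>_def)
  moreover have "C = of_real (norm C) * cis \<theta>" using assms using rcis_cmod_Arg[of C] by (simp add: \<theta>_def rcis_def)
  hence "C * cis \<psi> = of_real (norm C) * cis (\<theta> + \<psi>)" by (metis cis_mult mult.assoc)
  hence "Im (C * cis \<psi>) = norm C * sin (\<theta> + \<psi>)" by simp
  ultimately have "Im (C * cis \<psi>) < 0" using assms by simp
  moreover have "0 \<le> \<psi> \<and> \<psi> < 2 * pi" using \<theta> pi_gt_zero by (simp add: \<psi>_def)
  ultimately show ?thesis by blast
qed

context lk_function
begin

text \<open>This factorisation asks only for a continuous cofactor, so a substitution carries it
  through negation and conjugation, and it yields limits along rays directly.\<close>

definition has_order :: "complex \<Rightarrow> nat \<Rightarrow> bool" where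
  "has_order w n \<longleftrightarrow> (\<exists>h. isCont h w \<and> h w \<noteq> 0 \<and> (\<forall>\<^sub>F x in nhds w. F x = F w + (x - w) ^ n * h x))"

lemma has_order_minus:
  assumes "has_order w n"
  shows "has_order (- w) n"
proof -
  obtain h where h: "isCont h w" "h w \<noteq> 0" "\<forall>\<^sub>F x in nhds w. F x = F w + (x - w) ^ n * h x"
    using assms by (auto simp: has_order_def)
  define h' where "h' = (\<lambda>x. - ((-1) ^ n * h (- x)))"
  have lim: "filterlim uminus (nhds w) (nhds (- w))"
    using tendsto_minus[OF filterlim_ident, of "- w"] by simp
  have "\<forall>\<^sub>F x in nhds (- w). F (- x) = F w + (- x - w) ^ n * h (- x)"
    using eventually_compose_filterlim[OF h(3) lim] .
  hence "\<forall>\<^sub>F x in nhds (- w). F x = F (- w) + (x - (- w)) ^ n * h' x"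
  proof (rule eventually_mono)
    fix x assume *: "F (- x) = F w + (- x - w) ^ n * h (- x)"
    have "(- x - w) ^ n = (-1) ^ n * (x + w) ^ n"
      unfolding power_mult_distrib[symmetric] by simp
    hence "F x = - (F w + (-1) ^ n * (x + w) ^ n * h (- x))"
      using * F_minus[of x] by (metis add.inverse_inverse)
    thus "F x = F (- w) + (x - (- w)) ^ n * h' x"
      unfolding h'_def F_minus by simp
  qed
  moreover have "isCont h' (- w)"
  proof -
    have "isCont (\<lambda>x. h (- x)) (- w)"
      by (rule isCont_o2[where g = h and f = uminus]) (use h(1) in auto)
    thus ?thesis unfolding h'_def by (intro continuous_intros)
  qed
  moreover have "h' (- w) \<noteq> 0" using h(2) by (simp add: h'_def)
  ultimately show ?thesis by (auto simp: has_order_def)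
qed

lemma has_order_cnj:
  assumes "has_order w n"
  shows "has_order (cnj w) n"
proof -
  obtain h where h: "isCont h w" "h w \<noteq> 0" "\<forall>\<^sub>F x in nhds w. F x = F w + (x - w) ^ n * h x"
    using assms by (auto simp: has_order_def)
  define h' where "h' = (\<lambda>x. cnj (h (cnj x)))"
  have lim: "filterlim cnj (nhds w) (nhds (cnj w))"
    using tendsto_cnj[OF filterlim_ident, of "cnj w"] by simp
  have "\<forall>\<^sub>F x in nhds (cnj w). F (cnj x) = F w + (cnj x - w) ^ n * h (cnj x)"
    using eventually_compose_filterlim[OF h(3) lim] .
  hence "\<forall>\<^sub>F x in nhds (cnj w). F x = F (cnj w) + (x - cnj w) ^ n * h' x"
  proof (rule eventually_mono)
    fix x assume "F (cnj x) = F w + (cnj x - w) ^ n * h (cnj x)"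
    from arg_cong[OF this, of cnj] show "F x = F (cnj w) + (x - cnj w) ^ n * h' x"
      by (simp add: F_cnj h'_def)
  qed
  moreover have "isCont h' (cnj w)"
  proof -
    have "isCont (\<lambda>x. h (cnj x)) (cnj w)"
      by (rule isCont_o2[where g = h and f = cnj]) (use h(1) in \<open>auto intro: isCont_cnj\<close>)
    thus ?thesis unfolding h'_def by (rule isCont_cnj)
  qed
  moreover have "h' (cnj w) \<noteq> 0" using h(2) by (simp add: h'_def)
  ultimately show ?thesis by (auto simp: has_order_def)
qed

lemma has_order_refl:
  assumes "p \<in> {1, -1}" "q \<in> {1, -1}" "has_order w n"
  shows "has_order (refl p q w) n"
  using refl_cases[OF assms(1,2)] assms(3) has_order_minus has_order_cnj by auto

text \<open>\<open>F - \<alpha>\<close> is not locally zero: otherwise the entire function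
  \<open>Nm - \<alpha> * Dn\<close> would vanish identically, whereas its value at 0 is
  \<open>- \<alpha>\<close>. Clearing the denominator avoids any appeal to the connectedness of the
  domain of \<open>F\<close>.\<close>

lemma alpha_mult_order:
  assumes w: "F w = \<alpha>" and \<alpha>: "\<alpha> \<noteq> 0"
  shows "\<exists>n\<ge>1. alpha_mult F \<alpha> w = int n \<and> has_order w n"
proof -
  have D: "Dn w \<noteq> 0" using assms by (auto simp: F_def)
  have "open {x. Dn x \<noteq> 0}"
    using open_Collect_neq[OF continuous_on_Dn continuous_on_const] .
  then obtain r where r: "r > 0" "ball w r \<subseteq> {x. Dn x \<noteq> 0}"
    using D open_contains_ball by blast
  define f where "f = (\<lambda>x. F x - \<alpha>)"
  have hol: "f holomorphic_on ball w r"
    unfolding f_def F_def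
    by (intro holomorphic_intros holomorphic_on_subset[OF Nm_holomorphic] holomorphic_on_subset[OF Dn_holomorphic])
       (use r in auto)
  have nc: "\<exists>x\<in>ball w r. f x \<noteq> 0"
  proof (rule ccontr)
    assume "\<not> (\<exists>x\<in>ball w r. f x \<noteq> 0)"
    hence z: "Nm x - \<alpha> * Dn x = 0" if "x \<in> ball w r" for x
      using that r(2) divide_eq_eq[of "Nm x" "Dn x" \<alpha>] by (auto simp: f_def F_def)
    have "Nm 0 - \<alpha> * Dn 0 = 0"
    proof (rule analytic_continuation_open[of "ball w r" UNIV "\<lambda>x. Nm x - \<alpha> * Dn x" "\<lambda>x. 0"])
      show "(\<lambda>x. Nm x - \<alpha> * Dn x) holomorphic_on UNIV"
        by (intro holomorphic_intros Nm_holomorphic Dn_holomorphic)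
    qed (use r z in auto)
    thus False using \<alpha> by (simp add: Nm_0 Dn_0)
  qed
  define n where "n = zorder f w"
  define g where "g = zor_poly f w"
  have "f w = 0" using w by (simp add: f_def)
  moreover have "w \<in> ball w r" using r by simp
  ultimately obtain e where e: "n > 0" "e > 0"
     "g holomorphic_on cball w e" "\<forall>x\<in>cball w e. f x = g x * (x - w) ^ nat n \<and> g x \<noteq> 0"
    using zorder_exist_zero[OF hol open_ball connected_ball \<open>w \<in> ball w r\<close> nc]
    unfolding n_def g_def by (auto split: if_splits)
  have "isCont g w"
    using holomorphic_on_imp_continuous_on[OF e(3)] e(2)
    by (intro continuous_on_interior[of "cball w e"]) auto
  moreover have "g w \<noteq> 0" using e by auto
  moreover have "\<forall>\<^sub>F x in nhds w. F x = F w + (x - w) ^ nat n * g x"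
  proof -
    have "\<forall>\<^sub>F x in nhds w. x \<in> ball w e" using e by (intro eventually_nhds_in_open) auto
    thus ?thesis
    proof (rule eventually_mono)
      fix x assume "x \<in> ball w e"
      hence "f x = g x * (x - w) ^ nat n" using e(4) by auto
      thus "F x = F w + (x - w) ^ nat n * g x" using w by (simp add: f_def algebra_simps)
    qed
  qed
  ultimately have "has_order w (nat n)" by (auto simp: has_order_def)
  moreover have "alpha_mult F \<alpha> w = int (nat n)" using e by (simp add: alpha_mult_def n_def f_def)
  moreover have "nat n \<ge> 1" using e by linarith
  ultimately show ?thesis by blast
qed

text \<open>In the direction \<open>\<phi>\<close> the increment of \<open>Lt\<close> behaves like
  \<open>C * \<epsilon> ^ n * cis (n * \<phi>)\<close>. The key inequality multiplies it by
  \<open>cis (- \<phi>)\<close>, so in the limit it constrains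
  \<open>C * cis ((n - 1) * \<phi>)\<close> for each direction that stays in the strip.\<close>

lemma order_expansion:
  assumes u: "u \<in> dom" and n: "n \<ge> 1" and o: "has_order (exp u) n"
  obtains C where "C \<noteq> 0"
    "\<And>\<phi>. ((\<lambda>\<epsilon>. (F (exp (u + of_real \<epsilon> * cis \<phi>)) / F (exp u) - 1) / of_real \<epsilon> ^ n) \<longlongrightarrow> C * cis (real n * \<phi>)) (at_right 0)"
    "\<And>\<phi>. (\<forall>\<^sub>F \<epsilon> in at_right 0. u + of_real \<epsilon> * cis \<phi> \<in> strip) \<Longrightarrow> Im (C * cis (real (n - 1) * \<phi>)) \<ge> 0"
proof -
  define w where "w = exp u"
  obtain h where h: "isCont h w" "h w \<noteq> 0" "\<forall>\<^sub>F x in nhds w. F x = F w + (x - w) ^ n * h x"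
    using o by (auto simp: has_order_def w_def)
  have Fw: "F w \<noteq> 0" using u by (simp add: w_def flip: exp_Lt)
  have w0: "w \<noteq> 0" by (simp add: w_def)
  \<comment> \<open>The factor \<open>w ^ n\<close> comes from the substitution
    \<open>x = exp u\<close>, whose derivative at \<open>u\<close> is \<open>w\<close>; the division
    by \<open>F w\<close> comes from passing to the logarithm.\<close>
  define C where "C = w ^ n * h w / F w"
  define p where "p = (\<lambda>\<phi> \<epsilon>. u + complex_of_real \<epsilon> * cis \<phi>)"
  have p_lim: "(p \<phi> \<longlongrightarrow> u) (at_right 0)" for \<phi>
    unfolding p_def by (auto intro!: tendsto_eq_intros)
  have ep_lim: "((\<lambda>\<epsilon>. exp (p \<phi> \<epsilon>)) \<longlongrightarrow> w) (at_right 0)" for \<phi>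
    unfolding w_def by (intro tendsto_intros p_lim)
  have quot: "((\<lambda>\<epsilon>. (exp (p \<phi> \<epsilon>) - w) / of_real \<epsilon>) \<longlongrightarrow> w * cis \<phi>) (at_right 0)" for \<phi>
  proof -
    have "((\<lambda>z. exp (u + z * cis \<phi>)) has_field_derivative (exp u * cis \<phi>)) (at 0)"
      by (auto intro!: derivative_eq_intros)
    hence "(\<lambda>z. (exp (u + z * cis \<phi>) - exp u) / z) \<midarrow>0\<rightarrow> w * cis \<phi>"
      by (simp add: DERIV_def w_def)
    moreover have "filterlim complex_of_real (at 0) (at_right 0)"
      by (intro filterlim_atI tendsto_eq_intros) (auto simp: eventually_at_filter)
    ultimately show ?thesis unfolding p_def w_def by (rule filterlim_compose)
  qed
  have lim: "((\<lambda>\<epsilon>. (F (exp (p \<phi> \<epsilon>)) / F w - 1) / of_real \<epsilon> ^ n) \<longlongrightarrow> C * cis (real n * \<phi>)) (at_right 0)" for \<phi>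
  proof -
    have "((\<lambda>\<epsilon>. ((exp (p \<phi> \<epsilon>) - w) / of_real \<epsilon>) ^ n * h (exp (p \<phi> \<epsilon>)) / F w) \<longlongrightarrow> (w * cis \<phi>) ^ n * h w / F w) (at_right 0)"
      by (intro tendsto_intros quot isCont_tendsto_compose[OF h(1) ep_lim] Fw)
    moreover have "(w * cis \<phi>) ^ n * h w / F w = C * cis (real n * \<phi>)"
      by (simp add: C_def power_mult_distrib Complex.DeMoivre)
    moreover have "\<forall>\<^sub>F \<epsilon> in at_right 0. ((exp (p \<phi> \<epsilon>) - w) / of_real \<epsilon>) ^ n * h (exp (p \<phi> \<epsilon>)) / F w
        = (F (exp (p \<phi> \<epsilon>)) / F w - 1) / of_real \<epsilon> ^ n"
      using eventually_compose_filterlim[OF h(3) ep_lim]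
    proof (rule eventually_mono)
      fix \<epsilon> assume *: "F (exp (p \<phi> \<epsilon>)) = F w + (exp (p \<phi> \<epsilon>) - w) ^ n * h (exp (p \<phi> \<epsilon>))"
      show "((exp (p \<phi> \<epsilon>) - w) / of_real \<epsilon>) ^ n * h (exp (p \<phi> \<epsilon>)) / F w
        = (F (exp (p \<phi> \<epsilon>)) / F w - 1) / of_real \<epsilon> ^ n"
        unfolding * using Fw by (simp add: add_divide_distrib power_divide)
    qed
    ultimately show ?thesis using Lim_transform_eventually by force
  qed
  have key: "Im (C * cis (real (n - 1) * \<phi>)) \<ge> 0"
    if st: "\<forall>\<^sub>F \<epsilon> in at_right 0. p \<phi> \<epsilon> \<in> strip" for \<phi>
  proof -
    have ev_dom: "\<forall>\<^sub>F \<epsilon> in at_right 0. p \<phi> \<epsilon> \<in> dom"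
    proof -
      have "((\<lambda>\<epsilon>. Nm (exp (p \<phi> \<epsilon>))) \<longlongrightarrow> Nm w) (at_right 0)" "((\<lambda>\<epsilon>. Dn (exp (p \<phi> \<epsilon>))) \<longlongrightarrow> Dn w) (at_right 0)"
        using continuous_on_Nm[of UNIV] continuous_on_Dn[of UNIV] ep_lim
        by (auto intro: isCont_tendsto_compose simp: continuous_on_eq_continuous_at)
      moreover have "Nm w \<noteq> 0" "Dn w \<noteq> 0" using u by (auto simp: dom_iff w_def)
      ultimately have "\<forall>\<^sub>F \<epsilon> in at_right 0. Nm (exp (p \<phi> \<epsilon>)) \<noteq> 0" "\<forall>\<^sub>F \<epsilon> in at_right 0. Dn (exp (p \<phi> \<epsilon>)) \<noteq> 0"
        by (auto dest: tendsto_imp_eventually_ne)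
      with st show ?thesis by eventually_elim (simp add: dom_iff)
    qed
    define \<delta> where "\<delta> = (\<lambda>\<epsilon>. Lt (p \<phi> \<epsilon>) - Lt u)"
    have \<delta>0: "(\<delta> \<longlongrightarrow> 0) (at_right 0)"
    proof -
      have "((\<lambda>\<epsilon>. Lt (p \<phi> \<epsilon>)) \<longlongrightarrow> Lt u) (at_right 0)"
        by (rule continuous_on_tendsto_compose[OF continuous_on_Lt p_lim u ev_dom])
      thus ?thesis unfolding \<delta>_def by (simp add: LIM_zero)
    qed
    \<comment> \<open>With the value 1 at 0, this writes \<open>exp \<delta> - 1\<close> as
      \<open>\<delta>\<close> times a factor tending to 1, also where \<open>\<delta>\<close>
      vanishes.\<close>
    define g where "g = (\<lambda>z::complex. if z = 0 then 1 else (exp z - 1) / z)"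
    have "(\<lambda>z. (exp z - exp 0) / z) \<midarrow>0\<rightarrow> (1::complex)"
      using DERIV_exp[of "0::complex"] by (simp add: DERIV_def)
    hence "g \<midarrow>0\<rightarrow> 1" unfolding g_def by (rule Lim_transform_eventually) (auto simp: eventually_at_filter)
    hence "isCont g 0" by (simp add: isCont_def g_def)
    from isCont_tendsto_compose[OF this \<delta>0] have g1: "((\<lambda>\<epsilon>. g (\<delta> \<epsilon>)) \<longlongrightarrow> 1) (at_right 0)"
      by (simp add: g_def)
    have "((\<lambda>\<epsilon>. (F (exp (p \<phi> \<epsilon>)) / F w - 1) / of_real \<epsilon> ^ n / g (\<delta> \<epsilon>)) \<longlongrightarrow> C * cis (real n * \<phi>) / 1) (at_right 0)"
      by (intro tendsto_intros lim g1) simp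
    moreover have "\<forall>\<^sub>F \<epsilon> in at_right 0. (F (exp (p \<phi> \<epsilon>)) / F w - 1) / of_real \<epsilon> ^ n / g (\<delta> \<epsilon>) = \<delta> \<epsilon> / of_real \<epsilon> ^ n"
      using ev_dom tendsto_imp_eventually_ne[OF g1, of 0, simplified]
    proof eventually_elim
      case (elim \<epsilon>)
      have "F (exp (p \<phi> \<epsilon>)) / F w = exp (\<delta> \<epsilon>)"
        using elim(1) u by (simp add: \<delta>_def exp_diff exp_Lt w_def)
      hence "F (exp (p \<phi> \<epsilon>)) / F w - 1 = \<delta> \<epsilon> * g (\<delta> \<epsilon>)" by (simp add: g_def)
      thus ?case using elim(2) by simp
    qed
    ultimately have \<delta>lim: "((\<lambda>\<epsilon>. \<delta> \<epsilon> / of_real \<epsilon> ^ n) \<longlongrightarrow> C * cis (real n * \<phi>) / 1) (at_right 0)"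
      by (rule Lim_transform_eventually)
    have "((\<lambda>\<epsilon>. Im (\<delta> \<epsilon> / of_real \<epsilon> ^ n * cnj (cis \<phi>))) \<longlongrightarrow> Im (C * cis (real n * \<phi>) / 1 * cnj (cis \<phi>))) (at_right 0)"
      by (rule tendsto_Im[OF tendsto_mult[OF \<delta>lim tendsto_const]])
    moreover have "\<forall>\<^sub>F \<epsilon> in at_right 0. 0 \<le> Im (\<delta> \<epsilon> / of_real \<epsilon> ^ n * cnj (cis \<phi>))"
      using ev_dom eventually_at_right_less[of 0]
    proof eventually_elim
      case (elim \<epsilon>)
      have "Im ((Lt (p \<phi> \<epsilon>) - Lt u) * cnj (p \<phi> \<epsilon> - u)) \<ge> 0" by (rule Lt_key(1)[OF u elim(1)])
      also have "(Lt (p \<phi> \<epsilon>) - Lt u) * cnj (p \<phi> \<epsilon> - u) = of_real (\<epsilon> ^ Suc n) * (\<delta> \<epsilon> / of_real \<epsilon> ^ n * cnj (cis \<phi>))"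
        using elim(2) by (simp add: \<delta>_def p_def)
      finally have "0 \<le> \<epsilon> ^ Suc n * Im (\<delta> \<epsilon> / of_real \<epsilon> ^ n * cnj (cis \<phi>))"
        by (simp only: Im_complex_of_real Re_complex_of_real times_complex.sel)
      thus ?case using elim(2) by (simp add: zero_le_mult_iff)
    qed
    ultimately have "0 \<le> Im (C * cis (real n * \<phi>) / 1 * cnj (cis \<phi>))"
      by (rule tendsto_lowerbound) simp
    hence "0 \<le> Im (C * cis (real n * \<phi>) * cnj (cis \<phi>))" by (simp only: div_by_1)
    also have "C * cis (real n * \<phi>) * cnj (cis \<phi>) = C * cis (real (n - 1) * \<phi>)"
      using n by (simp add: cis_cnj cis_mult of_nat_diff algebra_simps)
    finally show ?thesis .
  qed
  show ?thesis
    by (rule that[of C]) (use lim key h(2) Fw w0 in \<open>auto simp: C_def p_def w_def\<close>)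
qed

text \<open>At an interior point every direction is admissible, so for \<open>n\<close> at least 2
  the angle \<open>(n - 1) * \<phi>\<close> can be made one at which the imaginary part is
  negative.\<close>

lemma order_interior:
  assumes u: "u \<in> dom" and n: "n \<ge> 1" and o: "has_order (exp u) n" and i: "0 < Im u" "Im u < pi / 2"
  shows "n = 1"
proof (rule ccontr)
  assume "n \<noteq> 1"
  obtain C where C: "C \<noteq> 0"
    "\<And>\<phi>. (\<forall>\<^sub>F \<epsilon> in at_right 0. u + of_real \<epsilon> * cis \<phi> \<in> strip) \<Longrightarrow> Im (C * cis (real (n - 1) * \<phi>)) \<ge> 0"
    using order_expansion[OF u n o] by metis
  obtain \<psi> where \<psi>: "Im (C * cis \<psi>) < 0" using exists_direction_Im_neg[OF C(1)] by blast
  define \<phi> where "\<phi> = \<psi> / real (n - 1)"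
  have "((\<lambda>\<epsilon>. Im (u + of_real \<epsilon> * cis \<phi>)) \<longlongrightarrow> Im u) (at_right 0)"
    by (auto intro!: tendsto_eq_intros)
  hence "\<forall>\<^sub>F \<epsilon> in at_right 0. 0 < Im (u + of_real \<epsilon> * cis \<phi>)" "\<forall>\<^sub>F \<epsilon> in at_right 0. Im (u + of_real \<epsilon> * cis \<phi>) < pi / 2"
    using order_tendstoD i by blast+
  hence "\<forall>\<^sub>F \<epsilon> in at_right 0. u + of_real \<epsilon> * cis \<phi> \<in> strip"
    by eventually_elim (simp add: strip_def)
  from C(2)[OF this] \<psi> n \<open>n \<noteq> 1\<close> show False by (simp add: \<phi>_def)
qed

text \<open>On an edge only a half disc of directions is available, which still excludes orders above 2.\<close>

lemma order_edge:
  assumes u: "u \<in> dom" and n: "n \<ge> 1" and o: "has_order (exp u) n" and e: "Im u = (if b then 0 else pi / 2)"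
  obtains C where "C \<noteq> 0" "n = 1 \<or> n = 2 \<and> (if b then C > 0 else C < 0)"
    "((\<lambda>\<epsilon>. (Re (F (exp (u + of_real \<epsilon>)) / F (exp u)) - 1) / \<epsilon> ^ n) \<longlongrightarrow> C) (at_right 0)"
    "((\<lambda>\<epsilon>. (Re (F (exp (u - of_real \<epsilon>)) / F (exp u)) - 1) / \<epsilon> ^ n) \<longlongrightarrow> C * (-1) ^ n) (at_right 0)"
    "\<And>\<epsilon>. F (exp (u + of_real \<epsilon>)) / F (exp u) = of_real (Re (F (exp (u + of_real \<epsilon>)) / F (exp u)))"
proof -
  obtain C where C: "C \<noteq> 0"
    "\<And>\<phi>. ((\<lambda>\<epsilon>. (F (exp (u + of_real \<epsilon> * cis \<phi>)) / F (exp u) - 1) / of_real \<epsilon> ^ n) \<longlongrightarrow> C * cis (real n * \<phi>)) (at_right 0)"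
    "\<And>\<phi>. (\<forall>\<^sub>F \<epsilon> in at_right 0. u + of_real \<epsilon> * cis \<phi> \<in> strip) \<Longrightarrow> Im (C * cis (real (n - 1) * \<phi>)) \<ge> 0"
    by (rule order_expansion[OF u n o]) blast
  \<comment> \<open>The sign turns the angles in \<open>[0, pi]\<close> into the directions leading
    into the strip: upwards from the lower edge, downwards from the upper one.\<close>
  define \<sigma> :: real where "\<sigma> = (if b then 1 else -1)"
  have ev: "\<forall>\<^sub>F \<epsilon> in at_right 0. u + of_real \<epsilon> * cis (\<sigma> * \<phi>) \<in> strip" if "0 \<le> \<phi>" "\<phi> \<le> pi" for \<phi>
  proof -
    have "((\<lambda>\<epsilon>. \<epsilon> * sin \<phi>) \<longlongrightarrow> 0) (at_right 0)" by (auto intro!: tendsto_eq_intros)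
    hence "\<forall>\<^sub>F \<epsilon> in at_right 0. \<epsilon> * sin \<phi> < pi / 2" by (rule order_tendstoD) simp
    with eventually_at_right_less[of 0] show ?thesis
    proof eventually_elim
      case (elim \<epsilon>)
      have "0 \<le> \<epsilon> * sin \<phi>" using elim that sin_ge_zero by simp
      thus ?case using elim e by (auto simp: strip_def \<sigma>_def split: if_splits)
    qed
  qed
  have key: "Im (C * cis (real (n - 1) * (\<sigma> * \<phi>))) \<ge> 0" if "0 \<le> \<phi>" "\<phi> \<le> pi" for \<phi>
    by (rule C(3)[OF ev[OF that]])
  \<comment> \<open>Along an edge \<open>F\<close> is real throughout or imaginary throughout, so
    quotients of its values are real.\<close>
  have real: "Im (F (exp (u + of_real \<epsilon>)) / F (exp u)) = 0" for \<epsilon>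
  proof (cases b)
    case True
    have "Im (F (exp (u + of_real \<epsilon>))) = 0" "Im (F (exp u)) = 0"
      by (rule F_real; use e True in \<open>simp add: Im_exp\<close>)+
    thus ?thesis by (simp add: Im_divide)
  next
    case False
    have "Re (F (exp (u + of_real \<epsilon>))) = 0" "Re (F (exp u)) = 0"
      using e False cos_pi_half by (simp_all only: Re_exp F_imag plus_complex.sel Im_complex_of_real
          add_0_right if_False mult_zero_right)
    thus ?thesis by (simp add: Im_divide)
  qed
  have Fr: "F (exp (u + of_real \<epsilon>)) / F (exp u) = of_real (Re (F (exp (u + of_real \<epsilon>)) / F (exp u)))" for \<epsilon>
    using real[of \<epsilon>] by (simp add: complex_eq_iff)
  define R where "R = (\<lambda>\<epsilon>. Re (F (exp (u + of_real \<epsilon>)) / F (exp u)))"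
  have lim1: "((\<lambda>\<epsilon>. complex_of_real ((R \<epsilon> - 1) / \<epsilon> ^ n)) \<longlongrightarrow> C) (at_right 0)"
    using C(2)[of 0] by (subst (asm) cis_zero, subst (asm) mult_1_right, subst (asm) Fr) (simp add: R_def)
  have lim2: "((\<lambda>\<epsilon>. complex_of_real ((R (- \<epsilon>) - 1) / \<epsilon> ^ n)) \<longlongrightarrow> C * (-1) ^ n) (at_right 0)"
  proof -
    have "cis (real n * pi) = (-1) ^ n" using Complex.DeMoivre[of pi n] by (simp add: mult.commute)
    moreover have "u + complex_of_real \<epsilon> * cis pi = u + complex_of_real (- \<epsilon>)" for \<epsilon> by simp
    ultimately have "((\<lambda>\<epsilon>. (F (exp (u + of_real (- \<epsilon>))) / F (exp u) - 1) / of_real \<epsilon> ^ n) \<longlongrightarrow> C * (-1) ^ n) (at_right 0)"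
      using C(2)[of pi] by simp
    thus ?thesis by (subst (asm) Fr) (simp add: R_def)
  qed
  have ImC: "Im C = 0"
    by (rule tendsto_unique[OF trivial_limit_at_right_real tendsto_Im[OF lim1]]) simp
  define c where "c = Re C"
  have Cc: "C = of_real c" using ImC by (simp add: c_def complex_eq_iff)
  have l1: "((\<lambda>\<epsilon>. (R \<epsilon> - 1) / \<epsilon> ^ n) \<longlongrightarrow> c) (at_right 0)"
    using tendsto_Re[OF lim1] by (simp add: c_def)
  have l2: "((\<lambda>\<epsilon>. (R (- \<epsilon>) - 1) / \<epsilon> ^ n) \<longlongrightarrow> c * (-1) ^ n) (at_right 0)"
  proof -
    have "C * (-1) ^ n = of_real (c * (-1) ^ n)" by (simp add: Cc)
    from tendsto_Re[OF lim2[unfolded this]] show ?thesis by (simp only: Re_complex_of_real)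
  qed
  have n2: "n \<le> 2"
  proof (rule ccontr)
    assume "\<not> n \<le> 2"
    hence n3: "real (n - 1) \<ge> 2" by simp
    obtain \<psi> where \<psi>: "0 \<le> \<psi>" "\<psi> < 2 * pi" "Im (C * cis \<psi>) < 0" using exists_direction_Im_neg[OF C(1)] by blast
    \<comment> \<open>On the upper edge the angles run backwards, so \<open>\<psi> - 2 * pi\<close>
      is reached in place of \<open>\<psi>\<close>.\<close>
    define \<phi> where "\<phi> = (if b then \<psi> / real (n - 1) else (2 * pi - \<psi>) / real (n - 1))"
    have quarter: "0 \<le> x / real (n - 1) \<and> x / real (n - 1) \<le> pi" if "0 \<le> x" "x \<le> 2 * pi" for x
    proof -
      have "x / real (n - 1) \<le> x / 2"
        by (intro divide_left_mono; use n3 that in linarith)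
      also have "\<dots> \<le> pi" using that by simp
      finally show ?thesis using that by simp
    qed
    have "0 \<le> \<phi>" "\<phi> \<le> pi" using quarter[of \<psi>] quarter[of "2 * pi - \<psi>"] \<psi> by (auto simp: \<phi>_def simp del: diff_Suc_1)
    from key[OF this] have "0 \<le> Im (C * cis (if b then \<psi> else \<psi> - 2 * pi))"
      using n3 by (cases b) (simp_all add: \<phi>_def \<sigma>_def)
    moreover have "cis (\<psi> - 2 * pi) = cis \<psi>" by (simp add: cis_divide[symmetric])
    ultimately have "0 \<le> Im (C * cis \<psi>)" by (metis (full_types))
    thus False using \<psi>(3) by linarith
  qed
  \<comment> \<open>For order 2 the direction perpendicular to the edge decides the sign of
    \<open>C\<close>.\<close>
  have csgn: "if b then c > 0 else c < 0" if "n = 2"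
  proof -
    have "0 \<le> Im (C * cis (real (n - 1) * (\<sigma> * (pi / 2))))" by (rule key) auto
    moreover have "Im (C * cis (real (n - 1) * (\<sigma> * (pi / 2)))) = c * sin (\<sigma> * (pi / 2))"
      unfolding Cc that by simp
    ultimately have "0 \<le> c * sin (\<sigma> * (pi / 2))" by linarith
    moreover have "c \<noteq> 0" using C(1) unfolding Cc by simp
    ultimately show ?thesis by (cases b) (simp_all add: \<sigma>_def)
  qed
  have "n = 1 \<or> n = 2" using n n2 by linarith
  hence n12: "n = 1 \<or> n = 2 \<and> (if b then c > 0 else c < 0)" using csgn by blast
  have c0': "c \<noteq> 0" using C(1) unfolding Cc by simp
  show ?thesis
    by (rule that[OF c0' n12 l1[unfolded R_def] l2[unfolded R_def of_real_minus add_uminus_conv_diff] Fr])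
qed

end

section \<open>The points of the curve on a given level of the argument\<close>

lemma eventually_sign_of_expansion:
  fixes g :: "real \<Rightarrow> real"
  assumes l: "((\<lambda>\<epsilon>. (g \<epsilon> - 1) / \<epsilon> ^ n) \<longlongrightarrow> C) (at_right 0)" and n: "n \<ge> 1"
  shows "C > 0 \<Longrightarrow> \<forall>\<^sub>F \<epsilon> in at_right 0. \<bar>g \<epsilon>\<bar> > 1"
    and "C < 0 \<Longrightarrow> \<forall>\<^sub>F \<epsilon> in at_right 0. \<bar>g \<epsilon>\<bar> < 1"
proof -
  show "\<forall>\<^sub>F \<epsilon> in at_right 0. \<bar>g \<epsilon>\<bar> > 1" if "C > 0"
    using order_tendstoD(1)[OF l that] eventually_at_right_less[of 0]
  proof eventually_elim
    case (elim \<epsilon>)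
    thus ?case by (simp add: zero_less_divide_iff)
  qed
  \<comment> \<open>A negative \<open>C\<close> gives only \<open>g \<epsilon> < 1\<close>; the
    bound \<open>- 1 < g \<epsilon>\<close> comes from the convergence of \<open>g\<close> to
    1.\<close>
  have "((\<lambda>\<epsilon>. (g \<epsilon> - 1) / \<epsilon> ^ n * \<epsilon> ^ n) \<longlongrightarrow> C * 0 ^ n) (at_right 0)"
    by (intro tendsto_mult l tendsto_power tendsto_ident_at)
  hence l0: "((\<lambda>\<epsilon>. (g \<epsilon> - 1) / \<epsilon> ^ n * \<epsilon> ^ n) \<longlongrightarrow> 0) (at_right 0)" using n by (simp add: power_0_left)
  show "\<forall>\<^sub>F \<epsilon> in at_right 0. \<bar>g \<epsilon>\<bar> < 1" if "C < 0"
    using order_tendstoD(2)[OF l that] eventually_at_right_less[of 0] order_tendstoD(1)[OF l0, of "-1", simplified]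
  proof eventually_elim
    case (elim \<epsilon>)
    thus ?case by (simp add: divide_less_0_iff)
  qed
qed

lemma eventually_at_left_to_0: "eventually P (at_left a) \<longleftrightarrow> (\<forall>\<^sub>F \<epsilon> in at_right 0. P (a - \<epsilon>))" for a :: real
  unfolding eventually_at_left_to_right eventually_at_right_to_0[of _ "- a"] by simp

context lk_level
begin

definition edge :: "bool \<Rightarrow> real" where "edge b = (if b then 0 else pi / 2)"

text \<open>The curve is on the lower (\<open>b = True\<close>) or upper (\<open>b = False\<close>) edge precisely where \<open>E b \<le> 0\<close>.\<close>

definition E :: "bool \<Rightarrow> real \<Rightarrow> real" where
  "E b s = (if b then M s 0 else - M s (pi / 2))"

lemma Th_edge_iff: "Th s = edge b \<longleftrightarrow> E b s \<le> 0"
  using Th_bottom_iff[of s] Th_top_iff[of s] by (cases b) (simp_all add: edge_def E_def)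

lemma isCont_E: "isCont (E b) s"
proof -
  have "continuous_on UNIV (E b)"
    by (cases b) (auto simp: E_def intro!: continuous_intros continuous_M')
  thus ?thesis by (simp add: continuous_on_eq_continuous_at)
qed

text \<open>Along the edge the modulus of \<open>F\<close> compared with \<rho> follows the sign of
  the leading term: it changes side for order 1, while for order 2 the sign of \<open>C\<close>
  prescribed by the edge makes \<open>E b\<close> positive on both sides.\<close>

lemma order_sides:
  assumes e: "E b s = 0" and n: "n \<ge> 1" and o: "has_order (exp (curve s)) n"
  shows "n = 2 \<and> (\<forall>\<^sub>F x in at_left s. E b x > 0) \<and> (\<forall>\<^sub>F x in at_right s. E b x > 0) \<or>
         n = 1 \<and> ((\<forall>\<^sub>F x in at_left s. E b x < 0) \<and> (\<forall>\<^sub>F x in at_right s. E b x > 0) \<or>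
                  (\<forall>\<^sub>F x in at_left s. E b x > 0) \<and> (\<forall>\<^sub>F x in at_right s. E b x < 0))"
proof -
  have T: "Th s = edge b" using Th_edge_iff e by simp
  have M0: "M s (Th s) = 0" using e unfolding T by (cases b) (auto simp: E_def edge_def)
  have Im: "Im (curve s) = (if b then 0 else pi / 2)" by (simp add: curve_def T edge_def)
  obtain C where C: "C \<noteq> 0" "n = 1 \<or> n = 2 \<and> (if b then C > 0 else C < 0)"
    "((\<lambda>\<epsilon>. (Re (F (exp (curve s + of_real \<epsilon>)) / F (exp (curve s))) - 1) / \<epsilon> ^ n) \<longlongrightarrow> C) (at_right 0)"
    "((\<lambda>\<epsilon>. (Re (F (exp (curve s - of_real \<epsilon>)) / F (exp (curve s))) - 1) / \<epsilon> ^ n) \<longlongrightarrow> C * (-1) ^ n) (at_right 0)"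
    "\<And>\<epsilon>. F (exp (curve s + of_real \<epsilon>)) / F (exp (curve s)) = of_real (Re (F (exp (curve s + of_real \<epsilon>)) / F (exp (curve s))))"
    using order_edge[OF curve_dom n o Im] by blast
  define R where "R = (\<lambda>\<epsilon>. Re (F (exp (curve s + of_real \<epsilon>)) / F (exp (curve s))))"
  have nF: "norm (F (exp (curve s))) = \<rho>"
    using F_curve[OF M0] rho_pos by (simp add: norm_mult)
  define \<sigma> :: real where "\<sigma> = (if b then 1 else -1)"
  \<comment> \<open>At a zero of \<open>Dn\<close> division by 0 gives \<open>F\<close> the value 0,
    which looks like a small modulus. This alternative is carried along and excluded near
    \<open>s\<close> by \<open>D\<close>.\<close>
  have sgnE: "\<bar>R \<epsilon>\<bar> > 1 \<Longrightarrow> \<sigma> * E b (s + \<epsilon>) > 0" "\<bar>R \<epsilon>\<bar> < 1 \<Longrightarrow> \<sigma> * E b (s + \<epsilon>) < 0 \<or> Dn (exp (Complex (s + \<epsilon>) (edge b))) = 0" for \<epsilon>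
  proof -
    have cu: "curve s + of_real \<epsilon> = Complex (s + \<epsilon>) (edge b)"
      by (simp add: curve_def T complex_eq_iff)
    let ?N = "norm (Nm (exp (Complex (s + \<epsilon>) (edge b))))" and ?D = "norm (Dn (exp (Complex (s + \<epsilon>) (edge b))))"
    have "\<bar>R \<epsilon>\<bar> = norm (F (exp (curve s + of_real \<epsilon>)) / F (exp (curve s)))"
      by (subst C(5)) (simp add: R_def)
    also have "\<dots> = ?N / ?D / \<rho>"
      by (simp only: norm_divide nF cu) (simp add: F_def norm_divide)
    finally have R: "\<bar>R \<epsilon>\<bar> = ?N / ?D / \<rho>" .
    have sE: "\<sigma> * E b (s + \<epsilon>) = ?N - \<rho> * ?D"
      by (simp add: \<sigma>_def E_def edge_def M_def)
    show "\<sigma> * E b (s + \<epsilon>) > 0" if "\<bar>R \<epsilon>\<bar> > 1"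
    proof -
      have "?D > 0" using that unfolding R by (cases "?D = 0") auto
      thus ?thesis using that rho_pos unfolding R sE by (simp add: field_simps)
    qed
    show "\<sigma> * E b (s + \<epsilon>) < 0 \<or> Dn (exp (Complex (s + \<epsilon>) (edge b))) = 0" if "\<bar>R \<epsilon>\<bar> < 1"
    proof (cases "?D = 0")
      case False
      hence "?D > 0" by simp
      thus ?thesis using that rho_pos unfolding R sE by (simp add: field_simps)
    qed simp
  qed
  have D: "\<forall>\<^sub>F x in at s. Dn (exp (Complex x (edge b))) \<noteq> 0"
  proof -
    have "continuous_on UNIV (\<lambda>x. Dn (exp (Complex x (edge b))))"
      unfolding Complex_eq
      by (intro continuous_on_compose2[OF continuous_on_Dn[of UNIV]] continuous_intros) auto
    hence "((\<lambda>x. Dn (exp (Complex x (edge b)))) \<longlongrightarrow> Dn (exp (Complex s (edge b)))) (at s)"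
      by (simp add: continuous_on_def)
    moreover have "Dn (exp (Complex s (edge b))) \<noteq> 0"
      using curve_dom[of s] by (simp add: dom_iff curve_def T)
    ultimately show ?thesis by (rule tendsto_imp_eventually_ne)
  qed
  have DR: "\<forall>\<^sub>F \<epsilon> in at_right 0. Dn (exp (Complex (s + \<epsilon>) (edge b))) \<noteq> 0"
    using D unfolding eventually_at_split eventually_at_right_to_0[of _ s] by (simp add: add.commute)
  have DL: "\<forall>\<^sub>F \<epsilon> in at_right 0. Dn (exp (Complex (s + - \<epsilon>) (edge b))) \<noteq> 0"
    using D unfolding eventually_at_split eventually_at_left_to_0[of _ s] by simp
  have lR: "((\<lambda>\<epsilon>. (R \<epsilon> - 1) / \<epsilon> ^ n) \<longlongrightarrow> C) (at_right 0)"
    using C(3) by (simp add: R_def)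
  have lL: "((\<lambda>\<epsilon>. (R (- \<epsilon>) - 1) / \<epsilon> ^ n) \<longlongrightarrow> C * (-1) ^ n) (at_right 0)"
    using C(4) by (simp add: R_def)
  have pos: "\<forall>\<^sub>F x in at_right s. \<sigma> * E b x > 0" if "C > 0"
    using eventually_sign_of_expansion(1)[OF lR n that]
    unfolding eventually_at_right_to_0[of _ s] by eventually_elim (use sgnE(1) in \<open>simp add: add.commute\<close>)
  have neg: "\<forall>\<^sub>F x in at_right s. \<sigma> * E b x < 0" if "C < 0"
    using eventually_sign_of_expansion(2)[OF lR n that] DR
    unfolding eventually_at_right_to_0[of _ s]
  proof eventually_elim
    case (elim \<epsilon>) thus ?case using sgnE(2)[of \<epsilon>] by (simp add: add.commute)
  qed
  have posL: "\<forall>\<^sub>F x in at_left s. \<sigma> * E b x > 0" if "C * (-1) ^ n > 0"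
    using eventually_sign_of_expansion(1)[OF lL n that]
    unfolding eventually_at_left_to_0[of _ s]
  proof eventually_elim
    case (elim \<epsilon>) thus ?case using sgnE(1)[of "- \<epsilon>"] by simp
  qed
  have negL: "\<forall>\<^sub>F x in at_left s. \<sigma> * E b x < 0" if "C * (-1) ^ n < 0"
    using eventually_sign_of_expansion(2)[OF lL n that] DL
    unfolding eventually_at_left_to_0[of _ s]
  proof eventually_elim
    case (elim \<epsilon>) thus ?case using sgnE(2)[of "- \<epsilon>"] by simp
  qed
  consider "n = 1" "C > 0" | "n = 1" "C < 0" | "n = 2" "b" "C > 0" | "n = 2" "\<not> b" "C < 0"
    using C(1,2) by (cases b) (auto simp: neq_iff)
  thus ?thesis
  proof cases
    case 1 thus ?thesis using pos negL by (cases b) (simp_all add: \<sigma>_def)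
  next
    case 2 thus ?thesis using neg posL by (cases b) (simp_all add: \<sigma>_def)
  next
    case 3 thus ?thesis using pos posL by (simp add: \<sigma>_def)
  next
    case 4 thus ?thesis using neg negL by (simp add: \<sigma>_def)
  qed
qed

section \<open>Levels of the argument and their total multiplicities\<close>

definition lev :: "bool \<Rightarrow> nat \<Rightarrow> real" where "lev b k = edge b + real k * pi"

text \<open>The condition \<open>E b s \<ge> 0\<close> removes the stretches on which the curve
  follows the edge away from the level set; by \<open>Lv_iff\<close> exactly the points of modulus
  level \<rho> remain.\<close>

definition Lv :: "bool \<Rightarrow> nat \<Rightarrow> real set" where
  "Lv b k = {s. Ph s = lev b k \<and> E b s \<ge> 0}"

text \<open>The total multiplicity of the \<open>\<alpha>\<close>-points of modulus \<open>exp s\<close>: in the interior of the strip there are two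
  simple ones, mirror images of each other; on an edge there is a single one, which is double if and only if
  \<open>E b\<close> has a strict local minimum.\<close>

definition wt :: "bool \<Rightarrow> real \<Rightarrow> nat" where
  "wt b s = (if E b s > 0 \<or> (\<forall>\<^sub>F x in at_left s. E b x > 0) \<and> (\<forall>\<^sub>F x in at_right s. E b x > 0)
             then 2 else 1)"

lemma Ph_edge:
  assumes "E b s \<le> 0"
  shows "\<exists>n::int. Ph s = edge b + of_int n * pi"
  using Ph_bottom[of s] Ph_top[of s] assms by (cases b) (auto simp: E_def edge_def)

lemma lev_ne: "edge b + of_int n * pi \<noteq> edge (\<not> b) + of_int m * pi"
proof
  assume "edge b + of_int n * pi = edge (\<not> b) + of_int m * pi"
  hence "pi * (2 * of_int n + (if b then 0 else 1)) = pi * (2 * of_int m + (if b then 1 else 0))"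
    by (cases b) (simp_all add: edge_def algebra_simps)
  hence "real_of_int (2 * n + (if b then 0 else 1)) = real_of_int (2 * m + (if b then 1 else 0))"
    by (simp add: split: if_splits)
  hence "2 * n + (if b then 0 else 1) = 2 * m + (if b then 1 else 0)" by linarith
  thus False by (cases b) presburger+
qed

lemma Th_not_other_edge:
  assumes "Ph s = lev b k"
  shows "Th s \<noteq> edge (\<not> b)"
proof
  assume "Th s = edge (\<not> b)"
  then obtain n :: int where "Ph s = edge (\<not> b) + of_int n * pi"
    using Th_edge_iff Ph_edge by blast
  with assms lev_ne[of b "int k" n] show False by (simp add: lev_def)
qed

lemma Lv_iff: "s \<in> Lv b k \<longleftrightarrow> Ph s = lev b k \<and> M s (Th s) = 0"
proof (cases "Ph s = lev b k")
  case True
  note ne = Th_not_other_edge[OF True]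
  show ?thesis
  proof (cases "E b s \<le> 0")
    case le: True
    hence T: "Th s = edge b" using Th_edge_iff by simp
    have "E b s \<ge> 0 \<longleftrightarrow> M s (Th s) = 0"
      unfolding T using le by (cases b) (auto simp: E_def edge_def)
    thus ?thesis using True by (simp add: Lv_def)
  next
    case False
    hence "Th s \<noteq> edge b" using Th_edge_iff by simp
    hence "0 < Th s" "Th s < pi / 2" using ne Th_range[of s] by (cases b; simp add: edge_def)+
    hence "M s (Th s) = 0" using M_Th_le[of s] M_Th_ge[of s] by linarith
    thus ?thesis using True False by (simp add: Lv_def)
  qed
qed (simp add: Lv_def)

text \<open>By \<open>Ph_strict\<close> equal values of \<open>Ph\<close> at different places occur
  only on a common edge, and the residue modulo pi decides on which.\<close>

lemma level_pair:
  assumes "s < s'" "Ph s = lev b k" "Ph s' = lev b k"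
  shows "E b s \<le> 0" "E b s' \<le> 0"
proof -
  have "Th s = 0 \<and> Th s' = 0 \<or> Th s = pi / 2 \<and> Th s' = pi / 2"
    using Ph_strict[OF assms(1)] assms by force
  hence "Th s = edge b \<and> Th s' = edge b"
    using Th_not_other_edge[OF assms(2)] Th_not_other_edge[OF assms(3)] by (cases b) (auto simp: edge_def)
  thus "E b s \<le> 0" "E b s' \<le> 0" using Th_edge_iff by blast+
qed

lemma level_between:
  assumes "s < s'" "Ph s = lev b k" "Ph s' = lev b k" "s \<le> x" "x \<le> s'"
  shows "Ph x = lev b k" "E b x \<le> 0"
proof -
  show P: "Ph x = lev b k" using Ph_mono[of s x] Ph_mono[of x s'] assms by simp
  show "E b x \<le> 0" using level_pair[OF _ assms(2) P] level_pair[OF assms(1-3)] assms(4)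
    by (cases "s = x") auto
qed

lemma edge_sides:
  assumes "E b s = 0"
  shows "wt b s = 2 \<and> (\<forall>\<^sub>F x in at_left s. E b x > 0) \<and> (\<forall>\<^sub>F x in at_right s. E b x > 0) \<or>
         wt b s = 1 \<and> ((\<forall>\<^sub>F x in at_left s. E b x < 0) \<and> (\<forall>\<^sub>F x in at_right s. E b x > 0) \<or>
                  (\<forall>\<^sub>F x in at_left s. E b x > 0) \<and> (\<forall>\<^sub>F x in at_right s. E b x < 0))"
    and "n \<ge> 1 \<Longrightarrow> has_order (exp (curve s)) n \<Longrightarrow> n = wt b s"
proof -
  have np: "\<not> ((\<forall>\<^sub>F x in G. E b x > 0) \<and> (\<forall>\<^sub>F x in G. E b x < 0))" if "G \<noteq> bot" for G
  proof
    assume "(\<forall>\<^sub>F x in G. E b x > 0) \<and> (\<forall>\<^sub>F x in G. E b x < 0)"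
    hence "\<forall>\<^sub>F x in G. False" by (auto elim: eventually_elim2)
    thus False using that by simp
  qed
  have gen: "n = wt b s" and gen2: "n = 2 \<and> (\<forall>\<^sub>F x in at_left s. E b x > 0) \<and> (\<forall>\<^sub>F x in at_right s. E b x > 0) \<or>
         n = 1 \<and> ((\<forall>\<^sub>F x in at_left s. E b x < 0) \<and> (\<forall>\<^sub>F x in at_right s. E b x > 0) \<or>
                  (\<forall>\<^sub>F x in at_left s. E b x > 0) \<and> (\<forall>\<^sub>F x in at_right s. E b x < 0))"
    if "n \<ge> 1" "has_order (exp (curve s)) n" for n
    using order_sides[OF assms that] np[of "at_left s"] np[of "at_right s"] assms
    by (auto simp: wt_def trivial_limit_at_left_real trivial_limit_at_right_real)
  show "n \<ge> 1 \<Longrightarrow> has_order (exp (curve s)) n \<Longrightarrow> n = wt b s" by (rule gen)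
  have "F (exp (curve s)) \<noteq> 0" using curve_dom[of s] by (simp flip: exp_Lt)
  \<comment> \<open>The point is an \<alpha>-point for its own value of \<open>F\<close>, so it has
    an order and the sign pattern follows without a prescribed \<alpha>.\<close>
  from alpha_mult_order[OF HOL.refl this] obtain m where "m \<ge> 1" "has_order (exp (curve s)) m" by blast
  from gen2[OF this] gen[OF this] show "wt b s = 2 \<and> (\<forall>\<^sub>F x in at_left s. E b x > 0) \<and> (\<forall>\<^sub>F x in at_right s. E b x > 0) \<or>
         wt b s = 1 \<and> ((\<forall>\<^sub>F x in at_left s. E b x < 0) \<and> (\<forall>\<^sub>F x in at_right s. E b x > 0) \<or>
                  (\<forall>\<^sub>F x in at_left s. E b x > 0) \<and> (\<forall>\<^sub>F x in at_right s. E b x < 0))" by simp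
qed

lemma left_nonpos_sides:
  assumes e: "E b s = 0" and s': "s' < s" "\<And>x. s' < x \<Longrightarrow> x < s \<Longrightarrow> E b x \<le> 0"
  shows "wt b s = 1" "\<forall>\<^sub>F x in at_right s. E b x > 0"
proof -
  have le: "\<forall>\<^sub>F x in at_left s. E b x \<le> 0"
    using eventually_at_left_real[OF s'(1)] s'(2) by (auto elim: eventually_mono)
  have "\<not> (\<forall>\<^sub>F x in at_left s. E b x > 0)"
  proof
    assume "\<forall>\<^sub>F x in at_left s. E b x > 0"
    with le have "\<forall>\<^sub>F x in at_left s. False" by eventually_elim simp
    thus False by simp
  qed
  thus "wt b s = 1" "\<forall>\<^sub>F x in at_right s. E b x > 0" using edge_sides(1)[OF e] by auto
qed

lemma right_nonpos_sides:
  assumes e: "E b s = 0" and s': "s < s'" "\<And>x. s < x \<Longrightarrow> x < s' \<Longrightarrow> E b x \<le> 0"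
  shows "wt b s = 1" "\<not> (\<forall>\<^sub>F x in at_right s. E b x > 0)"
proof -
  have le: "\<forall>\<^sub>F x in at_right s. E b x \<le> 0"
    using eventually_at_right_real[OF s'(1)] s'(2) by (auto elim: eventually_mono)
  show "\<not> (\<forall>\<^sub>F x in at_right s. E b x > 0)"
  proof
    assume "\<forall>\<^sub>F x in at_right s. E b x > 0"
    with le have "\<forall>\<^sub>F x in at_right s. False" by eventually_elim simp
    thus False by simp
  qed
  thus "wt b s = 1" using edge_sides(1)[OF e] by auto
qed

text \<open>Between two points of one level the curve stays on the edge. Hence \<open>E b\<close> is
  not positive just after the left point, but is positive just after the right one; a middle one of
  three points would have to satisfy both.\<close>

lemma Lv_pair:
  assumes "s \<in> Lv b k" "s' \<in> Lv b k" "s < s'"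
  shows "Lv b k = {s, s'}" "wt b s = 1" "wt b s' = 1"
proof -
  have no_gap: "E b x = 0 \<and> E b y = 0 \<and> wt b x = 1 \<and> wt b y = 1 \<and>
      \<not> (\<forall>\<^sub>F z in at_right x. E b z > 0) \<and> (\<forall>\<^sub>F z in at_right y. E b z > 0)"
    if xy: "x \<in> Lv b k" "y \<in> Lv b k" "x < y" for x y
  proof -
    have P: "Ph x = lev b k" "Ph y = lev b k" using xy by (auto simp: Lv_def)
    have e: "E b x = 0" "E b y = 0" using level_pair[OF xy(3) P] xy by (auto simp: Lv_def)
    have bt: "E b z \<le> 0" if "x < z" "z < y" for z
      using level_between(2)[OF xy(3) P] that by simp
    show ?thesis using left_nonpos_sides[OF e(2) xy(3) bt] right_nonpos_sides[OF e(1) xy(3) bt] e by blast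
  qed
  have "z = s \<or> z = s'" if z: "z \<in> Lv b k" for z
  proof (rule ccontr)
    assume "\<not> (z = s \<or> z = s')"
    then consider "z < s" | "s < z" "z < s'" | "s' < z" by linarith
    thus False
      by cases (use no_gap[OF z assms(1)] no_gap[OF assms(1) z] no_gap[OF z assms(2)] no_gap[OF assms(2) z]
           no_gap[OF assms] in blast)+
  qed
  thus "Lv b k = {s, s'}" using assms by blast
  show "wt b s = 1" "wt b s' = 1" using no_gap[OF assms] by blast+
qed

lemma Lv_cases:
  obtains "Lv b k = {}" | s where "Lv b k = {s}"
    | s s' where "s < s'" "Lv b k = {s, s'}" "wt b s = 1" "wt b s' = 1"
proof (cases "\<exists>s s'. s \<in> Lv b k \<and> s' \<in> Lv b k \<and> s < s'")
  case True
  then obtain s s' where "s \<in> Lv b k" "s' \<in> Lv b k" "s < s'" by blast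
  with Lv_pair that(3) show ?thesis by metis
next
  case False
  hence "x = y" if "x \<in> Lv b k" "y \<in> Lv b k" for x y using that by (meson linorder_neqE)
  thus ?thesis using that(1,2) by blast
qed

lemma wt_range: "wt b s = 1 \<or> wt b s = 2" by (simp add: wt_def)

lemma finite_Lv: "finite (Lv b k)"
  by (rule Lv_cases[of b k]) auto

lemma level_sum_le: "sum (wt b) (Lv b k) \<le> 2"
proof (rule Lv_cases[of b k])
  fix s assume "Lv b k = {s}" thus ?thesis using wt_range[of b s] by auto
qed auto

text \<open>On an edge the values of \<open>Ph\<close> are spaced by pi, so continuity keeps
  \<open>Ph\<close> constant until the curve leaves the edge.\<close>

lemma eventually_same_level:
  assumes P: "Ph s = lev b k" and ev: "\<forall>\<^sub>F x in at s within S. E b x \<le> 0"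
  shows "\<forall>\<^sub>F x in at s within S. Ph x = lev b k"
proof -
  have "(Ph \<longlongrightarrow> lev b k) (at s within S)"
    using isCont_Ph[of s] P by (metis isCont_def tendsto_within_subset top_greatest)
  hence "\<forall>\<^sub>F x in at s within S. lev b k - pi < Ph x" "\<forall>\<^sub>F x in at s within S. Ph x < lev b k + pi"
    by (auto intro: order_tendstoD)
  with ev show ?thesis
  proof eventually_elim
    case (elim x)
    then obtain n :: int where n: "Ph x = edge b + of_int n * pi" using Ph_edge by blast
    have "real k * pi - pi < of_int n * pi" "of_int n * pi < real k * pi + pi"
      using elim n by (auto simp: lev_def)
    hence "(real k - 1) * pi < of_int n * pi" "of_int n * pi < (real k + 1) * pi"
      by (simp_all add: algebra_simps)
    hence "real k - 1 < of_int n" "of_int n < real k + 1" by simp_all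
    hence "n = int k" by linarith
    thus ?case using n by (simp add: lev_def)
  qed
qed

text \<open>The last point of a level is interior or a place where the curve leaves the edge to the
  right, for otherwise the level would continue.\<close>

lemma last_of_level:
  assumes P: "Ph s0 = lev b k" and s1: "Ph s1 > lev b k"
  obtains s where "s0 \<le> s" "s \<in> Lv b k" "\<And>x. Ph x = lev b k \<Longrightarrow> x \<le> s"
     "E b s > 0 \<or> (\<forall>\<^sub>F x in at_right s. E b x > 0)"
proof -
  define J where "J = {x. Ph x = lev b k}"
  have bdd: "x \<le> s1" if "x \<in> J" for x
    using Ph_mono[of s1 x] s1 that by (fastforce simp: J_def)
  hence ba: "bdd_above J" by (rule bdd_aboveI)
  have "closed J"
  proof -
    have "J = Ph -` {lev b k} \<inter> UNIV" by (auto simp: J_def)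
    thus ?thesis by (metis closed_UNIV closed_singleton continuous_closed_preimage continuous_on_Ph inf_commute)
  qed
  moreover have ne: "J \<noteq> {}" using P by (auto simp: J_def)
  ultimately have s: "Sup J \<in> J" using ba closed_contains_Sup by blast
  define s where "s = Sup J"
  have Ps: "Ph s = lev b k" using s by (simp add: s_def J_def)
  have mx: "x \<le> s" if "Ph x = lev b k" for x
    using that cSup_upper[OF _ ba] by (simp add: s_def J_def)
  have nr: "\<not> (\<forall>\<^sub>F x in at_right s. E b x \<le> 0)"
  proof
    assume "\<forall>\<^sub>F x in at_right s. E b x \<le> 0"
    hence "\<forall>\<^sub>F x in at_right s. Ph x = lev b k" by (rule eventually_same_level[OF Ps])
    with eventually_at_right_less[of s] have "\<forall>\<^sub>F x in at_right s. False"
      by eventually_elim (use mx in force)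
    thus False by simp
  qed
  have Es: "E b s \<ge> 0"
  proof (rule ccontr)
    assume "\<not> E b s \<ge> 0"
    hence "\<forall>\<^sub>F x in at s. E b x < 0"
      using order_tendstoD(2)[OF isCont_E[of s b, unfolded isCont_def], of 0] by simp
    hence "\<forall>\<^sub>F x in at_right s. E b x < 0" by (simp add: eventually_at_split)
    hence "\<forall>\<^sub>F x in at_right s. E b x \<le> 0" by (rule eventually_mono) simp
    thus False using nr by blast
  qed
  have "\<not> (\<forall>\<^sub>F x in at_right s. E b x < 0)"
  proof
    assume "\<forall>\<^sub>F x in at_right s. E b x < 0"
    hence "\<forall>\<^sub>F x in at_right s. E b x \<le> 0" by (rule eventually_mono) simp
    thus False using nr by blast
  qed
  hence "E b s > 0 \<or> (\<forall>\<^sub>F x in at_right s. E b x > 0)"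
    using edge_sides(1)[where b = b and s = s] Es by fastforce
  thus ?thesis using that[of s] mx P Ps Es by (auto simp: Lv_def)
qed

lemma first_of_level:
  assumes P: "Ph s0 = lev b k" and s1: "Ph s1 < lev b k"
  obtains s where "s \<le> s0" "s \<in> Lv b k" "\<And>x. Ph x = lev b k \<Longrightarrow> s \<le> x"
     "E b s > 0 \<or> (\<forall>\<^sub>F x in at_left s. E b x > 0)"
proof -
  define J where "J = {x. Ph x = lev b k}"
  have bdd: "s1 \<le> x" if "x \<in> J" for x
    using Ph_mono[of x s1] s1 that by (fastforce simp: J_def)
  hence ba: "bdd_below J" by (rule bdd_belowI)
  have "closed J"
  proof -
    have "J = Ph -` {lev b k} \<inter> UNIV" by (auto simp: J_def)
    thus ?thesis by (metis closed_UNIV closed_singleton continuous_closed_preimage continuous_on_Ph inf_commute)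
  qed
  moreover have ne: "J \<noteq> {}" using P by (auto simp: J_def)
  ultimately have s: "Inf J \<in> J" using ba closed_contains_Inf by blast
  define s where "s = Inf J"
  have Ps: "Ph s = lev b k" using s by (simp add: s_def J_def)
  have mx: "s \<le> x" if "Ph x = lev b k" for x
    using that cInf_lower[OF _ ba] by (simp add: s_def J_def)
  have nr: "\<not> (\<forall>\<^sub>F x in at_left s. E b x \<le> 0)"
  proof
    assume "\<forall>\<^sub>F x in at_left s. E b x \<le> 0"
    hence "\<forall>\<^sub>F x in at_left s. Ph x = lev b k" by (rule eventually_same_level[OF Ps])
    moreover have "\<forall>\<^sub>F x in at_left s. x < s" by (simp add: eventually_at_filter)
    ultimately have "\<forall>\<^sub>F x in at_left s. False"
      by eventually_elim (use mx in force)
    thus False by simp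
  qed
  have Es: "E b s \<ge> 0"
  proof (rule ccontr)
    assume "\<not> E b s \<ge> 0"
    hence "\<forall>\<^sub>F x in at s. E b x < 0"
      using order_tendstoD(2)[OF isCont_E[of s b, unfolded isCont_def], of 0] by simp
    hence "\<forall>\<^sub>F x in at_left s. E b x < 0" by (simp add: eventually_at_split)
    hence "\<forall>\<^sub>F x in at_left s. E b x \<le> 0" by (rule eventually_mono) simp
    thus False using nr by blast
  qed
  have "\<not> (\<forall>\<^sub>F x in at_left s. E b x < 0)"
  proof
    assume "\<forall>\<^sub>F x in at_left s. E b x < 0"
    hence "\<forall>\<^sub>F x in at_left s. E b x \<le> 0" by (rule eventually_mono) simp
    thus False using nr by blast
  qed
  hence "E b s > 0 \<or> (\<forall>\<^sub>F x in at_left s. E b x > 0)"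
    using edge_sides(1)[where b = b and s = s] Es by fastforce
  thus ?thesis using that[of s] mx P Ps Es by (auto simp: Lv_def)
qed

text \<open>Values of \<open>Ph\<close> on both sides of the level provide a first and a last point.
  If they coincide, the point is interior or the curve leaves the edge on both sides, and the weight
  is 2; otherwise they are the two points of weight 1 in \<open>Lv_pair\<close>.\<close>

lemma level_sum_eq:
  assumes s0: "Ph s0 < lev b k" and s1: "Ph s1 > lev b k"
  shows "sum (wt b) (Lv b k) = 2"
proof -
  have "0 \<le> lev b k" by (simp add: lev_def edge_def)
  then obtain s where P: "Ph s = lev b k" using Ph_IVT[of "lev b k" s1] s1 by auto
  obtain r where r: "s \<le> r" "r \<in> Lv b k" "\<And>x. Ph x = lev b k \<Longrightarrow> x \<le> r"
     "E b r > 0 \<or> (\<forall>\<^sub>F x in at_right r. E b x > 0)" by (rule last_of_level[OF P s1]) blast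
  obtain l where l: "l \<le> s" "l \<in> Lv b k" "\<And>x. Ph x = lev b k \<Longrightarrow> l \<le> x"
     "E b l > 0 \<or> (\<forall>\<^sub>F x in at_left l. E b x > 0)" by (rule first_of_level[OF P s0]) blast
  show ?thesis
  proof (cases "l = r")
    case True
    have "x = r" if "x \<in> Lv b k" for x
      using r(3)[of x] l(3)[of x] that True by (simp add: Lv_def)
    hence "Lv b k = {r}" using r(2) by blast
    moreover have "wt b r = 2"
      unfolding wt_def by (rule if_P) (use r(4) l(4)[unfolded True] in blast)
    ultimately show ?thesis by simp
  next
    case False
    hence "l < r" using r l by simp
    from Lv_pair[OF l(2) r(2) this] False show ?thesis by simp
  qed
qed

text \<open>Up to such a point \<open>Ph\<close> is 0, which keeps the curve on the lower edge. So
  \<open>E True\<close> is nonpositive to the left, which leaves only weight 1 and a departure from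
  the edge to the right; a second point would contradict this departure.\<close>

lemma Lv_bottom_0:
  assumes "s \<in> Lv True 0"
  shows "Lv True 0 = {s}" "wt True s = 1"
proof -
  have gen: "E True x = 0 \<and> wt True x = 1 \<and> (\<forall>\<^sub>F y in at_right x. E True y > 0)" if "x \<in> Lv True 0" for x
  proof -
    have P: "Ph x = 0" using that by (simp add: Lv_def lev_def edge_def)
    have E: "E True y \<le> 0" if "y \<le> x" for y
    proof -
      have "Ph y = 0" using Ph_mono[OF that] Ph_nonneg[of y] P by simp
      hence "Th y = 0" using Ph_pos[of y] Th_range(1)[of y] by linarith
      thus ?thesis using Th_edge_iff[of y True] by (simp add: edge_def)
    qed
    hence e: "E True x = 0" using that by (force simp: Lv_def)
    show ?thesis using left_nonpos_sides[OF e, where s' = "x - 1"] E e by simp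
  qed
  show "wt True s = 1" using gen assms by blast
  have "x = s" if "x \<in> Lv True 0" for x
  proof (rule ccontr)
    assume "x \<noteq> s"
    hence "x < s \<or> s < x" by linarith
    thus False
    proof
      assume "x < s"
      from right_nonpos_sides(2)[where b = True and s = x and s' = s] level_between(2)[OF this, where b = True and k = 0] that assms gen[OF that] this
      show False by (simp add: Lv_def)
    next
      assume "s < x"
      from right_nonpos_sides(2)[where b = True and s = s and s' = x] level_between(2)[OF this, where b = True and k = 0] that assms gen[OF assms] this
      show False by (simp add: Lv_def)
    qed
  qed
  thus "Lv True 0 = {s}" using assms by blast
qed

lemma level_sum_bottom_0: "sum (wt True) (Lv True 0) \<le> 1"
  by (cases "Lv True 0 = {}") (use Lv_bottom_0 in force)+

lemma level_sum_bottom_0_eq: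
  assumes "Ph s1 > 0"
  shows "sum (wt True) (Lv True 0) = 1"
proof -
  obtain s0 where "Ph s0 = lev True 0" using Ph_start by (auto simp: lev_def edge_def)
  then obtain s where "s \<in> Lv True 0" using last_of_level[where ?s0.0 = s0 and b = True and k = 0 and ?s1.0 = s1] assms
    by (auto simp: lev_def edge_def)
  from Lv_bottom_0[OF this] show ?thesis by simp
qed

end

section \<open>Enumerations of \<open>\<alpha>\<close>-points\<close>

lemma enumerates_alpha_points_norm_mono:
  assumes z: "enumerates_alpha_points F \<alpha> N z" and m: "1 \<le> m" "m \<le> n" "enat n \<le> N"
  shows "norm (z m) \<le> norm (z n)"
  using m(2,3)
proof (induction n rule: dec_induct)
  case (step i)
  have "enat i \<le> N" using step.prems by (meson enat_ord_simps(1) le_SucI order_refl order_trans)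
  hence "norm (z m) \<le> norm (z i)" by (rule step.IH)
  also have "norm (z i) \<le> norm (z (Suc i))"
  proof -
    have "\<forall>n\<ge>2. enat n \<le> N \<longrightarrow> norm (z (n - 1)) \<le> norm (z n)"
      using z unfolding enumerates_alpha_points_def by (elim conjE)
    moreover have "2 \<le> Suc i" using step.hyps m(1) by simp
    ultimately have "norm (z (Suc i - 1)) \<le> norm (z (Suc i))" using step.prems by blast
    thus ?thesis by simp
  qed
  finally show ?case .
qed simp

text \<open>The levels below that of \<open>z n\<close> are full, and all their indices precede
  \<open>n\<close>; the first \<open>n\<close> indices lie in levels up to that of
  \<open>z n\<close>. Counting both families encloses \<open>n\<close> between partial sums of the
  capacities \<open>c\<close>.\<close>

lemma enumeration_level_index:
  fixes key :: "complex \<Rightarrow> nat"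
  assumes z: "enumerates_alpha_points F \<alpha> N z"
    and mono: "\<And>w w'. w \<in> alpha_points F \<alpha> \<Longrightarrow> w' \<in> alpha_points F \<alpha> \<Longrightarrow> norm w \<le> norm w' \<Longrightarrow> key w \<le> key w'"
    and fin: "\<And>k. finite {w \<in> alpha_points F \<alpha>. key w = k}"
    and le: "\<And>k. (\<Sum>w | w \<in> alpha_points F \<alpha> \<and> key w = k. alpha_mult F \<alpha> w) \<le> int (c k)"
    and eq: "\<And>k w. w \<in> alpha_points F \<alpha> \<Longrightarrow> k < key w \<Longrightarrow>
               (\<Sum>w | w \<in> alpha_points F \<alpha> \<and> key w = k. alpha_mult F \<alpha> w) = int (c k)"
    and n: "1 \<le> n" "enat n \<le> N"
  shows "(\<Sum>i<key (z n). c i) < n" "n \<le> (\<Sum>i\<le>key (z n). c i)"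
proof -
  define I where "I = (\<lambda>k. {m. 1 \<le> m \<and> enat m \<le> N \<and> key (z m) = k})"
  have pt: "z m \<in> alpha_points F \<alpha>" if "1 \<le> m" "enat m \<le> N" for m
    using z that by (auto simp: enumerates_alpha_points_def)
  have I: "finite (I k)" "int (card (I k)) = (\<Sum>w | w \<in> alpha_points F \<alpha> \<and> key w = k. alpha_mult F \<alpha> w)" for k
  proof -
    let ?A = "{w \<in> alpha_points F \<alpha>. key w = k}" and ?J = "\<lambda>w. {m. 1 \<le> m \<and> enat m \<le> N \<and> z m = w}"
    have e: "I k = (\<Union>w\<in>?A. ?J w)" using pt by (auto simp: I_def)
    have f: "finite (?J w)" "int (card (?J w)) = alpha_mult F \<alpha> w" if "w \<in> ?A" for w
      using z that by (auto simp: enumerates_alpha_points_def)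
    show "finite (I k)" unfolding e using fin f by blast
    have "card (I k) = (\<Sum>w\<in>?A. card (?J w))"
      unfolding e by (rule card_UN_disjoint) (use fin f in auto)
    thus "int (card (I k)) = (\<Sum>w | w \<in> alpha_points F \<alpha> \<and> key w = k. alpha_mult F \<alpha> w)"
      using f by simp
  qed
  have card_UN: "card (\<Union>i\<in>S. I i) = (\<Sum>i\<in>S. card (I i))" if "finite S" for S
    by (rule card_UN_disjoint) (use that I in \<open>auto simp: I_def\<close>)
  have "(\<Sum>i<key (z n). c i) = (\<Sum>i<key (z n). card (I i))"
  proof (rule sum.cong[OF HOL.refl])
    fix i assume "i \<in> {..<key (z n)}"
    thus "c i = card (I i)" using I(2)[of i] eq[OF pt[OF n], of i] by simp
  qed
  also have "\<dots> = card (\<Union>i<key (z n). I i)" by (rule card_UN[symmetric]) simp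
  also have "\<dots> \<le> card {1..<n}"
  proof (rule card_mono)
    show "(\<Union>i<key (z n). I i) \<subseteq> {1..<n}"
    proof
      fix m assume "m \<in> (\<Union>i<key (z n). I i)"
      hence m: "1 \<le> m" "enat m \<le> N" "key (z m) < key (z n)" by (auto simp: I_def)
      have "\<not> n \<le> m"
      proof
        assume "n \<le> m"
        from mono[OF pt[OF n] pt[OF m(1,2)] enumerates_alpha_points_norm_mono[OF z n(1) this m(2)]] m(3)
        show False by simp
      qed
      thus "m \<in> {1..<n}" using m by simp
    qed
  qed simp
  also have "card {1..<n} < n" using n(1) by simp
  finally show "(\<Sum>i<key (z n). c i) < n" .
  have "n = card {1..n}" by simp
  also have "\<dots> \<le> card (\<Union>i\<le>key (z n). I i)"
  proof (rule card_mono)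
    show "finite (\<Union>i\<le>key (z n). I i)" using I(1) by blast
    show "{1..n} \<subseteq> (\<Union>i\<le>key (z n). I i)"
    proof
      fix m assume m: "m \<in> {1..n}"
      hence mN: "enat m \<le> N" using n(2) by (meson atLeastAtMost_iff enat_ord_simps(1) order_trans)
      have "key (z m) \<le> key (z n)"
        using mono[OF pt[OF _ mN] pt[OF n]] enumerates_alpha_points_norm_mono[OF z _ _ n(2), of m] m by simp
      thus "m \<in> (\<Union>i\<le>key (z n). I i)" using m mN by (auto simp: I_def)
    qed
  qed
  also have "\<dots> = (\<Sum>i\<le>key (z n). card (I i))" by (rule card_UN) simp
  also have "\<dots> \<le> (\<Sum>i\<le>key (z n). c i)"
  proof (rule sum_mono)
    fix i show "card (I i) \<le> c i" using le[of i] I(2)[of i] by linarith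
  qed
  finally show "n \<le> (\<Sum>i\<le>key (z n). c i)" .
qed

lemma enumeration_distinct_of_mult_1:
  assumes z: "enumerates_alpha_points F \<alpha> N z"
    and mn: "1 \<le> m" "enat m \<le> N" "1 \<le> n" "enat n \<le> N" "m \<noteq> n" and mult: "alpha_mult F \<alpha> (z m) = 1"
  shows "z m \<noteq> z n"
proof
  assume eq: "z m = z n"
  let ?J = "{k. 1 \<le> k \<and> enat k \<le> N \<and> z k = z m}"
  have J: "finite ?J" "int (card ?J) = 1"
    using z mn(1,2) mult by (auto simp: enumerates_alpha_points_def)
  have "{m, n} \<subseteq> ?J" using mn eq by auto
  from card_mono[OF J(1) this] J(2) mn(5) show False by simp
qed

section \<open>The \<alpha>-points as reflected points of the curve\<close>

locale lk_alpha = lk_function +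
  fixes \<alpha> :: complex
  assumes alpha_nz: "\<alpha> \<noteq> 0"
begin

sublocale lk_level c d j A "norm \<alpha>"
  by unfold_locales (use alpha_nz in simp)

abbreviation AP :: "complex set" where "AP \<equiv> alpha_points F \<alpha>"

abbreviation mult :: "complex \<Rightarrow> int" where "mult \<equiv> alpha_mult F \<alpha>"

definition lnorm :: "complex \<Rightarrow> real" where "lnorm w = ln (norm w)"

text \<open>\<open>F\<close> commutes with the reflections, so the signs that carry the curve point
  to \<open>w\<close> also carry its value under \<open>F\<close> to \<alpha>. The coordinates of
  \<open>w\<close> and of \<alpha> are thus linked by common signs.\<close>

lemma AP_polar:
  assumes "w \<in> AP"
  obtains p q where "p \<in> {1, -1}" "q \<in> {1, -1}" "refl p q (exp (curve (lnorm w))) = w"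
    "M (lnorm w) (Th (lnorm w)) = 0" "w \<noteq> 0"
    "Re \<alpha> = p * norm \<alpha> * cos (Ph (lnorm w))" "Im \<alpha> = q * norm \<alpha> * sin (Ph (lnorm w))"
    "Re w = p * norm w * cos (Th (lnorm w))" "Im w = q * norm w * sin (Th (lnorm w))"
proof -
  have Fw: "F w = \<alpha>" using assms by (simp add: alpha_points_def)
  hence "norm (F w) = norm \<alpha>" by simp
  from alpha_point_curve[OF this, folded lnorm_def] obtain p q where pq: "p \<in> {1, -1}" "q \<in> {1, -1}"
    and w: "w = refl p q (exp (curve (lnorm w)))"
    and M: "M (lnorm w) (Th (lnorm w)) = 0" and w0: "w \<noteq> 0"
    by blast
  have "\<alpha> = refl p q (F (exp (curve (lnorm w))))"
    using arg_cong[OF w, of F] unfolding Fw F_refl[OF pq] .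
  hence a: "\<alpha> = refl p q (of_real (norm \<alpha>) * cis (Ph (lnorm w)))" using F_curve[OF M] by simp
  have ec: "exp (curve (lnorm w)) = of_real (norm w) * cis (Th (lnorm w))"
    using w0 by (simp add: curve_def exp_eq_polar lnorm_def)
  have ww: "w = refl p q (of_real (norm w) * cis (Th (lnorm w)))"
    using w unfolding ec .
  show ?thesis
    by (rule that[OF pq w[symmetric] M w0])
       (use arg_cong[OF a, of Re] arg_cong[OF a, of Im] arg_cong[OF ww, of Re] arg_cong[OF ww, of Im]
         in \<open>simp_all only: refl_def complex.sel Re_complex_of_real times_complex.sel Im_complex_of_real
            cis.sel mult_zero_left diff_zero add_0_right mult.assoc\<close>)
qed

lemma AP_I:
  assumes "p \<in> {1, -1}" "q \<in> {1, -1}" "M s (Th s) = 0"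
    and "Re \<alpha> = p * norm \<alpha> * cos (Ph s)" "Im \<alpha> = q * norm \<alpha> * sin (Ph s)"
  shows "refl p q (exp (curve s)) \<in> AP" "lnorm (refl p q (exp (curve s))) = s"
proof -
  have "F (refl p q (exp (curve s))) = refl p q (of_real (norm \<alpha>) * cis (Ph s))"
    using F_refl[OF assms(1,2)] F_curve[OF assms(3)] by simp
  also have "\<dots> = \<alpha>" using assms(4,5) by (simp add: refl_def complex_eq_iff)
  finally show "refl p q (exp (curve s)) \<in> AP" by (simp add: alpha_points_def)
  show "lnorm (refl p q (exp (curve s))) = s"
    by (simp add: lnorm_def norm_refl[OF assms(1,2)] norm_exp_eq_Re curve_def)
qed

lemma norm_less_iff_lnorm: "w \<noteq> 0 \<Longrightarrow> w' \<noteq> 0 \<Longrightarrow> norm w < norm w' \<longleftrightarrow> lnorm w < lnorm w'"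
  by (simp add: lnorm_def)

lemma AP_nz: "w \<in> AP \<Longrightarrow> w \<noteq> 0"
  by (erule AP_polar)

lemma lnorm_mono:
  assumes "w \<in> AP" "norm w \<le> norm w'"
  shows "lnorm w \<le> lnorm w'"
proof -
  have "0 < norm w" using AP_nz[OF assms(1)] by simp
  thus ?thesis unfolding lnorm_def using assms(2) by (intro ln_mono) auto
qed

lemma AP_mult_order:
  assumes "w \<in> AP"
  obtains n where "n \<ge> 1" "mult w = int n" "has_order (exp (curve (lnorm w))) n"
proof -
  have Fw: "F w = \<alpha>" using assms by (simp add: alpha_points_def)
  obtain n where n: "n \<ge> 1" "mult w = int n" "has_order w n"
    using alpha_mult_order[OF Fw alpha_nz] by blast
  obtain p q where pq: "p \<in> {1, -1}" "q \<in> {1, -1}" and w: "refl p q (exp (curve (lnorm w))) = w"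
    by (rule AP_polar[OF assms]) (rule that)
  have r: "refl p q w = exp (curve (lnorm w))"
    using arg_cong[OF w, of "refl p q"] unfolding refl_involutive[OF pq] by (rule sym)
  show ?thesis by (rule that[OF n(1,2) has_order_refl[OF pq n(3), unfolded r]])
qed

lemma mult_interior:
  assumes "w \<in> AP" "0 < Th (lnorm w)" "Th (lnorm w) < pi / 2"
  shows "mult w = 1"
proof -
  obtain n where n: "n \<ge> 1" "mult w = int n" "has_order (exp (curve (lnorm w))) n"
    by (rule AP_mult_order[OF assms(1)]) (rule that)
  have "n = 1" by (rule order_interior[OF curve_dom n(1,3)]) (use assms in \<open>auto simp: curve_def\<close>)
  thus ?thesis using n by simp
qed

lemma mult_edge:
  assumes "w \<in> AP" "E b (lnorm w) = 0"
  shows "mult w = int (wt b (lnorm w))"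
proof -
  obtain n where n: "n \<ge> 1" "mult w = int n" "has_order (exp (curve (lnorm w))) n"
    by (rule AP_mult_order[OF assms(1)]) (rule that)
  have "n = wt b (lnorm w)" by (rule edge_sides(2)[OF assms(2) n(1,3)])
  thus ?thesis using n by simp
qed

end

text \<open>Real \<open>\<alpha>\<close> (\<open>b = True\<close>) and purely imaginary \<open>\<alpha>\<close> (\<open>b = False\<close>) are treated together: \<open>b\<close> is also the edge of
  the strip on which \<open>\<alpha>\<close>-points may lie.\<close>

locale lk_axis = lk_alpha +
  fixes b :: bool
  assumes axis: "if b then Im \<alpha> = 0 else Re \<alpha> = 0"
begin

lemma AP_level:
  assumes "w \<in> AP"
  shows "\<exists>k. Ph (lnorm w) = lev b k \<and> lnorm w \<in> Lv b k"
proof -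
  obtain p q where pq: "p \<in> {1, -1}" "q \<in> {1, -1}" and M: "M (lnorm w) (Th (lnorm w)) = 0"
    and a: "Re \<alpha> = p * norm \<alpha> * cos (Ph (lnorm w))" "Im \<alpha> = q * norm \<alpha> * sin (Ph (lnorm w))"
    by (rule AP_polar[OF assms]) (rule that)
  have "\<exists>n::int. Ph (lnorm w) = edge b + of_int n * pi"
  proof (cases b)
    case True
    hence "sin (Ph (lnorm w)) = 0" using axis a(2) pq alpha_nz by auto
    thus ?thesis using True by (auto simp: edge_def sin_zero_iff_int2)
  next
    case False
    hence "cos (Ph (lnorm w)) = 0" using axis a(1) pq alpha_nz by auto
    then obtain n :: int where "Ph (lnorm w) = of_int n * pi + pi / 2" by (auto simp: cos_zero_iff_int2)
    thus ?thesis using False by (auto simp: edge_def)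
  qed
  then obtain n :: int where n: "Ph (lnorm w) = edge b + of_int n * pi" by blast
  \<comment> \<open>As \<open>Ph\<close> is nonnegative and \<open>edge b\<close> is less than pi,
    the multiple of pi is not negative, and natural numbers can index the levels.\<close>
  have "edge b < pi" by (simp add: edge_def)
  hence "- 1 * pi < of_int n * pi" using Ph_nonneg[of "lnorm w"] n by linarith
  hence "- 1 < real_of_int n" by (simp only: mult_less_cancel_right_pos[OF pi_gt_zero])
  hence "n \<ge> 0" by linarith
  hence "Ph (lnorm w) = lev b (nat n)" using n by (simp add: lev_def)
  thus ?thesis using M Lv_iff by blast
qed

definition key :: "complex \<Rightarrow> nat" where
  "key w = (THE k. Ph (lnorm w) = lev b k)"

lemma lev_inj: "lev b k = lev b l \<longleftrightarrow> k = l"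
  by (simp add: lev_def)

lemma lev_less_iff: "lev b k < lev b l \<longleftrightarrow> k < l"
  by (simp add: lev_def)

lemma key_eq: "Ph (lnorm w) = lev b k \<Longrightarrow> key w = k"
  unfolding key_def by (rule the_equality) (simp_all add: lev_inj)

lemma Ph_key: "w \<in> AP \<Longrightarrow> Ph (lnorm w) = lev b (key w)" and key_Lv: "w \<in> AP \<Longrightarrow> lnorm w \<in> Lv b (key w)"
  using AP_level key_eq by blast+

lemma key_mono: "w \<in> AP \<Longrightarrow> w' \<in> AP \<Longrightarrow> norm w \<le> norm w' \<Longrightarrow> key w \<le> key w'"
  using Ph_mono[OF lnorm_mono] Ph_key lev_less_iff by (metis linorder_not_le)

text \<open>This is the reflection in the axis through \<alpha>; it fixes \<alpha> and so permutes
  the \<alpha>-points.\<close>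

definition partner :: "complex \<Rightarrow> complex" where
  "partner w = (if b then cnj w else - cnj w)"

lemma partner_eq: "b \<Longrightarrow> partner w = cnj w" "\<not> b \<Longrightarrow> partner w = - cnj w"
  unfolding partner_def by simp_all

lemma cos_sin_lev:
  "b \<Longrightarrow> cos (lev b k) = (-1) ^ k" "b \<Longrightarrow> sin (lev b k) = 0"
  "\<not> b \<Longrightarrow> cos (lev b k) = 0" "\<not> b \<Longrightarrow> sin (lev b k) = (-1) ^ k"
  by (simp_all add: lev_def edge_def cos_add sin_add cos_npi sin_npi)

text \<open>Equal moduli mean the same curve point up to reflection. The nonzero coordinate of
  \<alpha> determines one of the two signs, and \<open>partner\<close> changes the other.\<close>

lemma same_norm_AP:
  assumes "w \<in> AP" "w' \<in> AP" "lnorm w = lnorm w'"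
  shows "w' = w \<or> w' = partner w"
proof -
  obtain p q where 1: "p \<in> {1, -1}" "q \<in> {1, -1}" "refl p q (exp (curve (lnorm w))) = w"
    "Re \<alpha> = p * norm \<alpha> * cos (Ph (lnorm w))" "Im \<alpha> = q * norm \<alpha> * sin (Ph (lnorm w))"
    by (rule AP_polar[OF assms(1)]) (rule that)
  obtain p' q' where 2: "p' \<in> {1, -1}" "q' \<in> {1, -1}" "refl p' q' (exp (curve (lnorm w))) = w'"
    "Re \<alpha> = p' * norm \<alpha> * cos (Ph (lnorm w))" "Im \<alpha> = q' * norm \<alpha> * sin (Ph (lnorm w))"
    by (rule AP_polar[OF assms(2), folded assms(3)]) (rule that)
  define X where "X = exp (curve (lnorm w))"
  have w: "w = refl p q X" and w': "w' = refl p' q' X" using 1(3) 2(3) by (simp_all only: X_def)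
  show ?thesis
  proof (cases b)
    case True
    have c: "cos (Ph (lnorm w)) \<noteq> 0" using cos_sin_lev(1)[OF True, of "key w"] Ph_key[OF assms(1)] by simp
    have "p * norm \<alpha> * cos (Ph (lnorm w)) = p' * norm \<alpha> * cos (Ph (lnorm w))"
      by (rule trans[OF 1(4)[symmetric] 2(4)])
    hence "p = p'" using alpha_nz c by simp
    moreover have "q' = q \<or> q' = - q" using 1 2 by auto
    ultimately show ?thesis using True
      unfolding w w' partner_eq(1)[OF True] by (auto simp: refl_def complex_eq_iff)
  next
    case False
    have c: "sin (Ph (lnorm w)) \<noteq> 0" using cos_sin_lev(4)[OF False, of "key w"] Ph_key[OF assms(1)] by simp
    have "q * norm \<alpha> * sin (Ph (lnorm w)) = q' * norm \<alpha> * sin (Ph (lnorm w))"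
      by (rule trans[OF 1(5)[symmetric] 2(5)])
    hence "q = q'" using alpha_nz c by simp
    moreover have "p' = p \<or> p' = - p" using 1 2 by auto
    ultimately show ?thesis using False
      unfolding w w' partner_eq(2)[OF False] by (auto simp: refl_def complex_eq_iff)
  qed
qed

lemma partner_AP: "w \<in> AP \<Longrightarrow> partner w \<in> AP"
  using axis F_cnj[of w] F_minus[of "cnj w"]
  by (auto simp: partner_def alpha_points_def complex_eq_iff)

lemma lnorm_partner: "lnorm (partner w) = lnorm w"
  by (simp add: partner_def lnorm_def)

lemma partner_eq_iff:
  assumes "w \<in> AP"
  shows "partner w = w \<longleftrightarrow> E b (lnorm w) = 0"
proof -
  obtain p q where 1: "p \<in> {1, -1}" "q \<in> {1, -1}" "w \<noteq> 0"
    "Re w = p * norm w * cos (Th (lnorm w))" "Im w = q * norm w * sin (Th (lnorm w))"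
    by (rule AP_polar[OF assms]) (rule that)
  have "partner w = w \<longleftrightarrow> (if b then sin (Th (lnorm w)) = 0 else cos (Th (lnorm w)) = 0)"
  proof -
    have "Im w = 0 \<longleftrightarrow> sin (Th (lnorm w)) = 0" unfolding 1(5) using 1(1-3) by auto
    moreover have "Re w = 0 \<longleftrightarrow> cos (Th (lnorm w)) = 0" unfolding 1(4) using 1(1-3) by auto
    moreover have "partner w = w \<longleftrightarrow> (if b then Im w = 0 else Re w = 0)"
      by (auto simp: partner_def complex_eq_iff)
    ultimately show ?thesis by simp
  qed
  also have "\<dots> \<longleftrightarrow> Th (lnorm w) = edge b"
  proof (cases b)
    case True
    have "Th (lnorm w) < pi" using Th_range(2)[of "lnorm w"] pi_gt_zero by linarith
    hence "sin (Th (lnorm w)) = 0 \<longleftrightarrow> Th (lnorm w) = 0"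
      using Th_range(1)[of "lnorm w"] sin_gt_zero[of "Th (lnorm w)"]
      by (cases "Th (lnorm w) = 0") auto
    thus ?thesis using True by (simp add: edge_def)
  next
    case False
    have "cos (Th (lnorm w)) = 0 \<longleftrightarrow> Th (lnorm w) = pi / 2"
    proof (cases "Th (lnorm w) = pi / 2")
      case lt: False
      hence "cos (Th (lnorm w)) > 0"
        using Th_range[of "lnorm w"] pi_gt_zero by (intro cos_gt_zero_pi) linarith+
      thus ?thesis using lt by simp
    next
      case True
      thus ?thesis by (simp only: cos_pi_half simp_thms)
    qed
    thus ?thesis using False by (simp add: edge_def)
  qed
  also have "\<dots> \<longleftrightarrow> E b (lnorm w) = 0"
    using Th_edge_iff[of "lnorm w" b] key_Lv[OF assms] by (auto simp: Lv_def)
  finally show ?thesis .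
qed

lemma interior_of_E_pos:
  assumes "w \<in> AP" "E b (lnorm w) \<noteq> 0"
  shows "0 < Th (lnorm w)" "Th (lnorm w) < pi / 2" "mult w = 1"
proof -
  have "E b (lnorm w) > 0" using key_Lv[OF assms(1)] assms(2) by (simp add: Lv_def)
  hence "Th (lnorm w) \<noteq> edge b" using Th_edge_iff[of "lnorm w" b] by auto
  moreover have "Th (lnorm w) \<noteq> edge (\<not> b)" by (rule Th_not_other_edge[OF Ph_key[OF assms(1)]])
  ultimately show 1: "0 < Th (lnorm w)" "Th (lnorm w) < pi / 2"
    using Th_range[of "lnorm w"] by (cases b; simp add: edge_def)+
  show "mult w = 1" by (rule mult_interior[OF assms(1) 1])
qed

lemma level_nonempty:
  assumes "s \<in> Lv b k"
  shows "\<exists>w\<in>AP. lnorm w = s"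
proof -
  have M: "M s (Th s) = 0" and P: "Ph s = lev b k" using assms Lv_iff by auto
  show ?thesis
  proof (cases b)
    case True
    have "Re \<alpha> = norm \<alpha> \<or> Re \<alpha> = - norm \<alpha>"
      using axis True by (simp add: cmod_eq_Re abs_if)
    moreover have "cos (Ph s) = (-1) ^ k" using cos_sin_lev(1)[OF True] P by simp
    ultimately have "\<exists>p\<in>{1,-1}. Re \<alpha> = p * norm \<alpha> * cos (Ph s)" by (cases "even k") auto
    then obtain p where p: "p \<in> {1, -1}" "Re \<alpha> = p * norm \<alpha> * cos (Ph s)" by blast
    have "Im \<alpha> = 1 * norm \<alpha> * sin (Ph s)" using axis True cos_sin_lev(2)[OF True] P by simp
    from AP_I[OF p(1) _ M p(2) this] show ?thesis by blast
  next
    case False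
    have "Im \<alpha> = norm \<alpha> \<or> Im \<alpha> = - norm \<alpha>"
      using axis False by (simp add: cmod_eq_Im abs_if)
    moreover have "sin (Ph s) = (-1) ^ k" using cos_sin_lev(4)[OF False] P by simp
    ultimately have "\<exists>q\<in>{1,-1}. Im \<alpha> = q * norm \<alpha> * sin (Ph s)" by (cases "even k") auto
    then obtain q where q: "q \<in> {1, -1}" "Im \<alpha> = q * norm \<alpha> * sin (Ph s)" by blast
    have "Re \<alpha> = 1 * norm \<alpha> * cos (Ph s)" using axis False cos_sin_lev(3)[OF False] P by simp
    from AP_I[OF _ q(1) M this q(2)] show ?thesis by blast
  qed
qed

lemma fibre_sum:
  assumes "s \<in> Lv b k"
  shows "finite {w \<in> AP. lnorm w = s}" "(\<Sum>w | w \<in> AP \<and> lnorm w = s. mult w) = int (wt b s)"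
proof -
  obtain w where w: "w \<in> AP" "lnorm w = s" using level_nonempty[OF assms] by blast
  have "x = w \<or> x = partner w" if "x \<in> AP" "lnorm x = s" for x
    using same_norm_AP[OF w(1), of x] w(2) that by simp
  hence e: "{w \<in> AP. lnorm w = s} = {w, partner w}"
    using w partner_AP[OF w(1)] lnorm_partner[of w] by blast
  show "finite {w \<in> AP. lnorm w = s}" unfolding e by simp
  show "(\<Sum>w | w \<in> AP \<and> lnorm w = s. mult w) = int (wt b s)"
  proof (cases "E b s = 0")
    case True
    thus ?thesis unfolding e using partner_eq_iff[OF w(1)] mult_edge[OF w(1)] w(2) by simp
  next
    case False
    hence "E b s > 0" using assms by (simp add: Lv_def)
    hence "wt b s = 2" by (simp add: wt_def)
    thus ?thesis unfolding e
      using partner_eq_iff[OF w(1)] interior_of_E_pos(3)[OF w(1)]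
        interior_of_E_pos(3)[OF partner_AP[OF w(1)]] lnorm_partner[of w] w(2) False by simp
  qed
qed

lemma level_fibre:
  shows "finite {w \<in> AP. key w = k}" "(\<Sum>w | w \<in> AP \<and> key w = k. mult w) = int (sum (wt b) (Lv b k))"
proof -
  have e: "{w \<in> AP. key w = k} = (\<Union>s\<in>Lv b k. {w \<in> AP. lnorm w = s})"
    using key_Lv key_eq by (auto simp: Lv_def)
  show "finite {w \<in> AP. key w = k}" unfolding e using finite_Lv fibre_sum(1) by blast
  have "(\<Sum>w | w \<in> AP \<and> key w = k. mult w) = (\<Sum>s\<in>Lv b k. \<Sum>w | w \<in> AP \<and> lnorm w = s. mult w)"
    unfolding e by (rule sum.UNION_disjoint) (use finite_Lv fibre_sum(1) in auto)
  also have "\<dots> = int (sum (wt b) (Lv b k))" using fibre_sum(2) by simp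
  finally show "(\<Sum>w | w \<in> AP \<and> key w = k. mult w) = int (sum (wt b) (Lv b k))" .
qed

definition level_count :: "nat \<Rightarrow> nat" where
  "level_count k = (if b \<and> k = 0 then 1 else 2)"

lemma level_count_le: "sum (wt b) (Lv b k) \<le> level_count k"
  using level_sum_le[of b k] level_sum_bottom_0 by (auto simp: level_count_def)

lemma level_count_eq:
  assumes "w \<in> AP" "k < key w"
  shows "sum (wt b) (Lv b k) = level_count k"
proof -
  have gt: "Ph (lnorm w) > lev b k" using Ph_key assms lev_less_iff by simp
  show ?thesis
  proof (cases "b \<and> k = 0")
    case True
    hence "level_count k = 1" unfolding level_count_def by simp
    thus ?thesis using True level_sum_bottom_0_eq[of "lnorm w"] gt by (simp add: lev_def edge_def)
  next
    case False
    obtain s0 where "Ph s0 = 0" using Ph_start by blast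
    moreover have "lev b k > 0" using False by (cases b) (auto simp: lev_def edge_def add_pos_nonneg)
    ultimately show ?thesis using level_sum_eq[of s0 b k "lnorm w"] gt False by (auto simp: level_count_def)
  qed
qed

lemma key_index:
  assumes z: "enumerates_alpha_points F \<alpha> N z" and n: "1 \<le> n" "enat n \<le> N"
  shows "key (z n) = (if b then n div 2 else (n - 1) div 2)"
proof -
  have 1: "(\<Sum>i<key (z n). level_count i) < n" "n \<le> (\<Sum>i\<le>key (z n). level_count i)"
    using enumeration_level_index[OF z key_mono level_fibre(1) _ _ n, of level_count]
      level_count_le level_count_eq unfolding level_fibre(2) by (auto simp del: of_nat_sum)
  \<comment> \<open>Truncated subtraction gives 0 at \<open>k = 0\<close> in the first case too, as
    the empty sum requires.\<close>
  have s: "(\<Sum>i<k. level_count i) = (if b then 2 * k - 1 else 2 * k)" for k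
    by (induction k) (auto simp: level_count_def)
  have "(\<Sum>i\<le>k. level_count i) = (if b then 2 * k + 1 else 2 * k + 2)" for k
    unfolding lessThan_Suc_atMost[symmetric] s by simp
  with 1 s show ?thesis using n(1) by (auto split: if_splits)
qed

end

text \<open>The unknown signs of \<open>AP_polar\<close> occur twice in each product and cancel, or
  disappear in absolute values.\<close>

lemma (in lk_alpha) AP_signs:
  assumes "w \<in> AP"
  shows "Re w * Re \<alpha> = norm w * norm \<alpha> * cos (Th (lnorm w)) * cos (Ph (lnorm w))"
    and "Im w * Im \<alpha> = norm w * norm \<alpha> * sin (Th (lnorm w)) * sin (Ph (lnorm w))"
    and "\<bar>Re \<alpha>\<bar> = norm \<alpha> * \<bar>cos (Ph (lnorm w))\<bar>" and "\<bar>Im \<alpha>\<bar> = norm \<alpha> * \<bar>sin (Ph (lnorm w))\<bar>"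
proof -
  have "Re w * Re \<alpha> = norm w * norm \<alpha> * cos (Th (lnorm w)) * cos (Ph (lnorm w)) \<and>
        Im w * Im \<alpha> = norm w * norm \<alpha> * sin (Th (lnorm w)) * sin (Ph (lnorm w)) \<and>
        \<bar>Re \<alpha>\<bar> = norm \<alpha> * \<bar>cos (Ph (lnorm w))\<bar> \<and> \<bar>Im \<alpha>\<bar> = norm \<alpha> * \<bar>sin (Ph (lnorm w))\<bar>"
  proof (rule AP_polar[OF assms])
    fix p q :: real
    assume pq: "p \<in> {1, -1}" "q \<in> {1, -1}"
      and a: "Re \<alpha> = p * norm \<alpha> * cos (Ph (lnorm w))" "Im \<alpha> = q * norm \<alpha> * sin (Ph (lnorm w))"
      and w: "Re w = p * norm w * cos (Th (lnorm w))" "Im w = q * norm w * sin (Th (lnorm w))"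
    have "p * p = 1" "q * q = 1" "\<bar>p\<bar> = 1" "\<bar>q\<bar> = 1" using pq by auto
    moreover have "p * norm w * ct * (p * norm \<alpha> * cp) = (p * p) * (norm w * norm \<alpha> * ct * cp)"
       "q * norm w * ct * (q * norm \<alpha> * cp) = (q * q) * (norm w * norm \<alpha> * ct * cp)" for ct cp :: real
      by (simp_all add: mult_ac)
    ultimately show ?thesis unfolding a w by (simp add: abs_mult)
  qed
  thus "Re w * Re \<alpha> = norm w * norm \<alpha> * cos (Th (lnorm w)) * cos (Ph (lnorm w))"
    and "Im w * Im \<alpha> = norm w * norm \<alpha> * sin (Th (lnorm w)) * sin (Ph (lnorm w))"
    and "\<bar>Re \<alpha>\<bar> = norm \<alpha> * \<bar>cos (Ph (lnorm w))\<bar>" and "\<bar>Im \<alpha>\<bar> = norm \<alpha> * \<bar>sin (Ph (lnorm w))\<bar>"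
    by blast+
qed

context lk_axis
begin

lemma key_less_norm:
  assumes "w \<in> AP" "w' \<in> AP" "key w < key w'"
  shows "norm w < norm w'"
  using key_mono[OF assms(2,1)] assms(3) by linarith

lemma same_key_edge:
  assumes w: "w \<in> AP" "w' \<in> AP" and k: "key w = key w'" and n: "norm w < norm w'"
  shows "E b (lnorm w) = 0" "E b (lnorm w') = 0"
proof -
  have l: "lnorm w < lnorm w'" using norm_less_iff_lnorm AP_nz w n by blast
  have "Ph (lnorm w') = lev b (key w)" using Ph_key[OF w(2)] k by simp
  from level_pair[OF l Ph_key[OF w(1)] this]
  show "E b (lnorm w) = 0" "E b (lnorm w') = 0"
    using key_Lv[OF w(1)] key_Lv[OF w(2)] by (auto simp: Lv_def)
qed

text \<open>Off the edge the points are simple, so two indices cannot carry the same point and must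
  carry a point and its partner; on the edge a point is its own partner.\<close>

lemma equal_norm_partner:
  assumes z: "enumerates_alpha_points F \<alpha> N z"
    and mn: "1 \<le> m" "enat m \<le> N" "1 \<le> n" "enat n \<le> N" "m \<noteq> n" and eq: "norm (z m) = norm (z n)"
  shows "z m = partner (z n)"
proof -
  have AP: "z m \<in> AP" "z n \<in> AP" using z mn by (auto simp: enumerates_alpha_points_def)
  have "lnorm (z n) = lnorm (z m)" using eq by (simp add: lnorm_def)
  with same_norm_AP[OF AP(2,1)] have d: "z m = z n \<or> z m = partner (z n)" by blast
  show ?thesis
  proof (cases "E b (lnorm (z n)) = 0")
    case True
    hence "partner (z n) = z n" using partner_eq_iff[OF AP(2)] by blast
    thus ?thesis using d by metis
  next
    case False
    hence "mult (z n) = 1" by (rule interior_of_E_pos(3)[OF AP(2)])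
    from enumeration_distinct_of_mult_1[OF z mn(3,4,1,2) _ this] mn(5) have "z n \<noteq> z m" by blast
    thus ?thesis using d by metis
  qed
qed

lemma mult_1_or_2:
  assumes "w \<in> AP"
  shows "mult w \<in> {1, 2}"
proof (cases "E b (lnorm w) = 0")
  case True
  from mult_edge[OF assms this] wt_range[of b "lnorm w"] show ?thesis by auto
next
  case False
  from interior_of_E_pos(3)[OF assms this] show ?thesis by simp
qed

lemma mult_1_of_not_fixed:
  assumes "w \<in> AP" "partner w \<noteq> w"
  shows "mult w = 1"
proof -
  have "E b (lnorm w) \<noteq> 0" using partner_eq_iff[OF assms(1)] assms(2) by blast
  thus ?thesis by (rule interior_of_E_pos(3)[OF assms(1)])
qed

text \<open>On level \<open>k\<close> the cosine or sine of \<open>Ph\<close> is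
  \<open>(-1) ^ k\<close>, while that of \<open>Th\<close> is positive because the curve is not on
  the other edge. So the relevant coordinate changes its sign from level to level.\<close>

lemma axis_sign:
  assumes "w \<in> AP"
  shows "0 < (-1) ^ key w * (if b then Re w * Re \<alpha> else Im w * Im \<alpha>)"
proof -
  have P: "Ph (lnorm w) = lev b (key w)" by (rule Ph_key[OF assms])
  note ne = Th_not_other_edge[OF P]
  have pos: "norm w * norm \<alpha> > 0" using AP_nz[OF assms] alpha_nz by simp
  have sq: "(-1) ^ k * (x * (-1) ^ k) = (x :: real)" for k x by (cases "even k") auto
  show ?thesis
  proof (cases b)
    case True
    have "Th (lnorm w) \<noteq> pi / 2" using ne True by (simp add: edge_def)
    hence "cos (Th (lnorm w)) > 0" using Th_range[of "lnorm w"] by (intro cos_gt_zero_pi) linarith+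
    moreover have "cos (Ph (lnorm w)) = (-1) ^ key w" using cos_sin_lev(1)[OF True] P by simp
    moreover have "(-1) ^ key w * (if b then Re w * Re \<alpha> else Im w * Im \<alpha>) =
      (-1) ^ key w * (norm w * norm \<alpha> * cos (Th (lnorm w)) * cos (Ph (lnorm w)))"
      unfolding AP_signs(1)[OF assms] using True by simp
    ultimately show ?thesis using pos by (simp only: sq mult_pos_pos)
  next
    case False
    have "Th (lnorm w) \<noteq> 0" using ne False by (simp add: edge_def)
    hence "sin (Th (lnorm w)) > 0" using Th_range[of "lnorm w"] pi_gt_zero by (intro sin_gt_zero) linarith+
    moreover have "sin (Ph (lnorm w)) = (-1) ^ key w" using cos_sin_lev(4)[OF False] P by simp
    moreover have "(-1) ^ key w * (if b then Re w * Re \<alpha> else Im w * Im \<alpha>) =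
      (-1) ^ key w * (norm w * norm \<alpha> * sin (Th (lnorm w)) * sin (Ph (lnorm w)))"
      unfolding AP_signs(2)[OF assms] using False by simp
    ultimately show ?thesis using pos by (simp only: sq mult_pos_pos)
  qed
qed

end

section \<open>The assertions for \<alpha> on an axis\<close>

lemma Arg_real_axis:
  assumes "Im w = 0"
  shows "Arg w = (if Re w < 0 then pi else 0)"
  using Arg_of_real[of "Re w"] assms by (metis complex_is_Real_iff of_real_Re)

lemma Arg_imaginary_axis:
  assumes "Re w = 0" "Im w \<noteq> 0"
  shows "Arg w = (if Im w < 0 then - (pi / 2) else pi / 2)"
proof (cases "Im w < 0")
  case True
  have "w = of_real (- Im w) * (- \<i>)" using assms by (simp add: complex_eq_iff)
  hence "Arg w = Arg (- \<i>)" using True Arg_times_of_real2 by (metis Arg_times_of_real neg_0_less_iff_less)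
  thus ?thesis using True by simp
next
  case False
  have "w = of_real (Im w) * \<i>" using assms by (simp add: complex_eq_iff)
  hence "Arg w = Arg \<i>" using False assms by (metis Arg_times_of_real linorder_neqE)
  thus ?thesis using False by simp
qed

text \<open>By \<open>key_index\<close> the \<alpha>-points lie successively on the levels 0, 1, 1,
  2, 2, and so on. Neighbours on different levels differ in modulus and in the sign of the real
  part; neighbours on one level are conjugate or both real.\<close>

lemma real_alpha:
  assumes "lk_axis c d A \<alpha> True" and z: "enumerates_alpha_points (lk_function.F c d j A) \<alpha> N z"
  defines "AP \<equiv> alpha_points (lk_function.F c d j A) \<alpha>"
    and "\<mu> \<equiv> alpha_mult (lk_function.F c d j A) \<alpha>"
  shows "enat 1 \<le> N \<Longrightarrow> 0 < norm (z 1)"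
    and "n \<ge> 1 \<Longrightarrow> enat (2 * n) \<le> N \<Longrightarrow> norm (z (2 * n - 1)) < norm (z (2 * n))"
    and "w \<in> AP \<Longrightarrow> Re w \<noteq> 0"
    and "w \<in> AP \<Longrightarrow> \<mu> w \<in> {1, 2}"
    and "w \<in> AP \<Longrightarrow> Im w \<noteq> 0 \<Longrightarrow> \<mu> w = 1"
    and "n \<ge> 1 \<Longrightarrow> enat (2 * n + 1) \<le> N \<Longrightarrow> norm (z (2 * n)) = norm (z (2 * n + 1)) \<Longrightarrow> z (2 * n) = cnj (z (2 * n + 1))"
    and "n \<ge> 1 \<Longrightarrow> enat (2 * n + 1) \<le> N \<Longrightarrow> norm (z (2 * n)) < norm (z (2 * n + 1)) \<Longrightarrow>
           Arg (z (2 * n)) = Arg (z (2 * n + 1)) \<and> Arg (z (2 * n + 1)) \<in> {0, pi}"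
    and "n \<ge> 1 \<Longrightarrow> enat (2 * n) \<le> N \<Longrightarrow> Re (z (2 * n - 1)) * Re (z (2 * n)) < 0"
    and "enat 1 \<le> N \<Longrightarrow> Im (z 1) = 0 \<and> Im (\<alpha> * z 1) = 0 \<and> Re (\<alpha> * z 1) > 0"
proof -
  interpret lk_axis c d j A \<alpha> True by (rule assms(1))
  have AP: "z n \<in> alpha_points F \<alpha>" if "n \<ge> 1" "enat n \<le> N" for n
    using z that by (auto simp: enumerates_alpha_points_def)
  have key: "key (z n) = n div 2" if "n \<ge> 1" "enat n \<le> N" for n
    using key_index[OF z that] by simp
  have sgn: "0 < (-1) ^ key w * (Re w * Re \<alpha>)" if "w \<in> alpha_points F \<alpha>" for w
    using axis_sign[OF that] by simp
  have partner: "partner w = cnj w" for w by (rule partner_eq) simp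
  have Im\<alpha>: "Im \<alpha> = 0" using axis by simp
  have le: "enat m \<le> N" if "m \<le> n" "enat n \<le> N" for m n
    using that by (meson enat_ord_simps(1) order_trans)
  show "enat 1 \<le> N \<Longrightarrow> 0 < norm (z 1)" using AP_nz[OF AP[of 1]] by simp
  show "n \<ge> 1 \<Longrightarrow> enat (2 * n) \<le> N \<Longrightarrow> norm (z (2 * n - 1)) < norm (z (2 * n))"
  proof -
    assume n: "n \<ge> 1" "enat (2 * n) \<le> N"
    have 1: "2 * n - 1 \<ge> 1" "enat (2 * n - 1) \<le> N" "2 * n \<ge> 1" using n le[of "2 * n - 1" "2 * n"] by auto
    have "(2 * n - 1) div 2 < (2 * n) div 2" using n(1) by (cases n) simp_all
    thus ?thesis using key_less_norm[OF AP[OF 1(1,2)] AP[OF 1(3) n(2)]] key[OF 1(1,2)] key[OF 1(3) n(2)] by simp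
  qed
  show "w \<in> AP \<Longrightarrow> Re w \<noteq> 0" using sgn[of w] unfolding AP_def by auto
  show "w \<in> AP \<Longrightarrow> \<mu> w \<in> {1, 2}" using mult_1_or_2[of w] unfolding AP_def \<mu>_def by blast
  show "w \<in> AP \<Longrightarrow> Im w \<noteq> 0 \<Longrightarrow> \<mu> w = 1"
    using mult_1_of_not_fixed[of w] partner[of w] unfolding AP_def \<mu>_def by (auto simp: complex_eq_iff)
  show "z (2 * n) = cnj (z (2 * n + 1))"
    if n: "n \<ge> 1" "enat (2 * n + 1) \<le> N" "norm (z (2 * n)) = norm (z (2 * n + 1))"
    using equal_norm_partner[OF z _ le[of "2 * n" "2 * n + 1"] _ n(2) _ n(3)] n partner by simp
  show "Arg (z (2 * n)) = Arg (z (2 * n + 1)) \<and> Arg (z (2 * n + 1)) \<in> {0, pi}"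
    if n: "n \<ge> 1" "enat (2 * n + 1) \<le> N" "norm (z (2 * n)) < norm (z (2 * n + 1))"
  proof -
    have 1: "2 * n \<ge> 1" "enat (2 * n) \<le> N" "2 * n + 1 \<ge> 1" using n le[of "2 * n" "2 * n + 1"] by auto
    note p = AP[OF 1(1,2)] AP[OF 1(3) n(2)]
    have k: "key (z (2 * n)) = n" "key (z (2 * n + 1)) = n" using key[OF 1(1,2)] key[OF 1(3) n(2)] by simp_all
    have "E True (lnorm (z (2 * n))) = 0" "E True (lnorm (z (2 * n + 1))) = 0"
      using same_key_edge[OF p _ n(3)] k by simp_all
    hence "cnj (z (2 * n)) = z (2 * n)" "cnj (z (2 * n + 1)) = z (2 * n + 1)"
      using partner_eq_iff[OF p(1)] partner_eq_iff[OF p(2)] partner by simp_all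
    hence "Im (z (2 * n)) = 0" "Im (z (2 * n + 1)) = 0" by (simp_all add: complex_eq_iff)
    moreover have "Re (z (2 * n)) < 0 \<longleftrightarrow> Re (z (2 * n + 1)) < 0"
      using sgn[OF p(1)] sgn[OF p(2)] unfolding k by (auto simp: zero_less_mult_iff mult_less_0_iff)
    ultimately show ?thesis by (simp add: Arg_real_axis)
  qed
  show "Re (z (2 * n - 1)) * Re (z (2 * n)) < 0" if n: "n \<ge> 1" "enat (2 * n) \<le> N"
  proof -
    have 1: "2 * n - 1 \<ge> 1" "enat (2 * n - 1) \<le> N" "2 * n \<ge> 1" using n le[of "2 * n - 1" "2 * n"] by auto
    have "(2 * n - 1) div 2 = n - 1" using n(1) by (cases n) simp_all
    hence "key (z (2 * n)) = Suc (key (z (2 * n - 1)))" using key[OF 1(1,2)] key[OF 1(3) n(2)] n by simp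
    thus ?thesis using sgn[OF AP[OF 1(1,2)]] sgn[OF AP[OF 1(3) n(2)]]
      by (auto simp: zero_less_mult_iff mult_less_0_iff)
  qed
  show "Im (z 1) = 0 \<and> Im (\<alpha> * z 1) = 0 \<and> Re (\<alpha> * z 1) > 0" if N: "enat 1 \<le> N"
  proof -
    have p: "z 1 \<in> alpha_points F \<alpha>" by (rule AP[OF _ N]) simp
    have k: "key (z 1) = 0" using key[OF _ N] by simp
    \<comment> \<open>Level 0 keeps the curve on the lower edge, which makes the first
      \<alpha>-point real.\<close>
    have "Ph (lnorm (z 1)) = 0" using Ph_key[OF p] k by (simp add: lev_def edge_def)
    hence "Th (lnorm (z 1)) = 0" using Ph_pos[of "lnorm (z 1)"] Th_range(1)[of "lnorm (z 1)"] by linarith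
    hence "E True (lnorm (z 1)) = 0"
      using Th_edge_iff[of "lnorm (z 1)" True] key_Lv[OF p] by (auto simp: edge_def Lv_def)
    hence "cnj (z 1) = z 1" using partner_eq_iff[OF p] partner by simp
    hence "Im (z 1) = 0" by (simp add: complex_eq_iff)
    moreover have "Re (z 1) * Re \<alpha> > 0" using sgn[OF p] k by simp
    ultimately show ?thesis using Im\<alpha> by (simp add: mult.commute)
  qed
qed

text \<open>Here the successive levels are 0, 0, 1, 1, 2, 2, and so on, because level 0 is the value
  \<open>pi / 2\<close> and the curve starts below it.\<close>

lemma imaginary_alpha:
  assumes "lk_axis c d A \<alpha> False" and z: "enumerates_alpha_points (lk_function.F c d j A) \<alpha> N z"
  defines "AP \<equiv> alpha_points (lk_function.F c d j A) \<alpha>"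
    and "\<mu> \<equiv> alpha_mult (lk_function.F c d j A) \<alpha>"
  shows "enat 1 \<le> N \<Longrightarrow> 0 < norm (z 1)"
    and "n \<ge> 1 \<Longrightarrow> enat (2 * n + 1) \<le> N \<Longrightarrow> norm (z (2 * n)) < norm (z (2 * n + 1))"
    and "w \<in> AP \<Longrightarrow> Im w \<noteq> 0"
    and "w \<in> AP \<Longrightarrow> \<mu> w \<in> {1, 2}"
    and "w \<in> AP \<Longrightarrow> Re w \<noteq> 0 \<Longrightarrow> \<mu> w = 1"
    and "n \<ge> 1 \<Longrightarrow> enat (2 * n) \<le> N \<Longrightarrow> norm (z (2 * n - 1)) = norm (z (2 * n)) \<Longrightarrow> z (2 * n - 1) = - cnj (z (2 * n))"
    and "n \<ge> 1 \<Longrightarrow> enat (2 * n) \<le> N \<Longrightarrow> norm (z (2 * n - 1)) < norm (z (2 * n)) \<Longrightarrow>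
           Arg (z (2 * n - 1)) = Arg (z (2 * n)) \<and> Arg (z (2 * n)) \<in> {- (pi / 2), pi / 2}"
    and "n \<ge> 1 \<Longrightarrow> enat (2 * n + 1) \<le> N \<Longrightarrow> Im (z (2 * n)) * Im (z (2 * n + 1)) < 0"
    and "enat 1 \<le> N \<Longrightarrow> Im \<alpha> * Im (z 1) > 0"
    and "enat 2 \<le> N \<Longrightarrow> norm (z 1) < norm (z 2) \<Longrightarrow> j = 0"
proof -
  interpret lk_axis c d j A \<alpha> False by (rule assms(1))
  have AP: "z n \<in> alpha_points F \<alpha>" if "n \<ge> 1" "enat n \<le> N" for n
    using z that by (auto simp: enumerates_alpha_points_def)
  have key: "key (z n) = (n - 1) div 2" if "n \<ge> 1" "enat n \<le> N" for n
    using key_index[OF z that] by simp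
  have sgn: "0 < (-1) ^ key w * (Im w * Im \<alpha>)" if "w \<in> alpha_points F \<alpha>" for w
    using axis_sign[OF that] by simp
  have partner: "partner w = - cnj w" for w by (rule partner_eq) simp
  have le: "enat m \<le> N" if "m \<le> n" "enat n \<le> N" for m n
    using that by (meson enat_ord_simps(1) order_trans)
  show "enat 1 \<le> N \<Longrightarrow> 0 < norm (z 1)" using AP_nz[OF AP[of 1]] by simp
  show "norm (z (2 * n)) < norm (z (2 * n + 1))" if n: "n \<ge> 1" "enat (2 * n + 1) \<le> N"
  proof -
    have 1: "2 * n \<ge> 1" "enat (2 * n) \<le> N" "2 * n + 1 \<ge> 1" using n le[of "2 * n" "2 * n + 1"] by auto
    have "(2 * n - 1) div 2 < (2 * n + 1 - 1) div 2" using n(1) by (cases n) simp_all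
    thus ?thesis using key_less_norm[OF AP[OF 1(1,2)] AP[OF 1(3) n(2)]] key[OF 1(1,2)] key[OF 1(3) n(2)] by simp
  qed
  show "w \<in> AP \<Longrightarrow> Im w \<noteq> 0" using sgn[of w] unfolding AP_def by auto
  show "w \<in> AP \<Longrightarrow> \<mu> w \<in> {1, 2}" using mult_1_or_2[of w] unfolding AP_def \<mu>_def by blast
  show "w \<in> AP \<Longrightarrow> Re w \<noteq> 0 \<Longrightarrow> \<mu> w = 1"
    using mult_1_of_not_fixed[of w] partner[of w] unfolding AP_def \<mu>_def by (auto simp: complex_eq_iff)
  show "z (2 * n - 1) = - cnj (z (2 * n))"
    if n: "n \<ge> 1" "enat (2 * n) \<le> N" "norm (z (2 * n - 1)) = norm (z (2 * n))"
  proof -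
    have 1: "2 * n - 1 \<ge> 1" "enat (2 * n - 1) \<le> N" "2 * n \<ge> 1" "2 * n - 1 \<noteq> 2 * n"
      using n le[of "2 * n - 1" "2 * n"] by auto
    show ?thesis using equal_norm_partner[OF z 1(1,2,3) n(2) 1(4) n(3)] partner by simp
  qed
  have edge_pair: "Arg (z (2 * n - 1)) = Arg (z (2 * n)) \<and> Arg (z (2 * n)) \<in> {- (pi / 2), pi / 2} \<and>
      E False (lnorm (z (2 * n - 1))) = 0"
    if n: "n \<ge> 1" "enat (2 * n) \<le> N" "norm (z (2 * n - 1)) < norm (z (2 * n))" for n
  proof -
    have 1: "2 * n - 1 \<ge> 1" "enat (2 * n - 1) \<le> N" "2 * n \<ge> 1" using n le[of "2 * n - 1" "2 * n"] by auto
    note p = AP[OF 1(1,2)] AP[OF 1(3) n(2)]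
    have "(2 * n - 1 - 1) div 2 = n - 1" "(2 * n - 1) div 2 = n - 1" using n(1) by (cases n; simp)+
    hence k: "key (z (2 * n - 1)) = n - 1" "key (z (2 * n)) = n - 1"
      using key[OF 1(1,2)] key[OF 1(3) n(2)] by simp_all
    have e: "E False (lnorm (z (2 * n - 1))) = 0" "E False (lnorm (z (2 * n))) = 0"
      using same_key_edge[OF p _ n(3)] k by simp_all
    hence "- cnj (z (2 * n - 1)) = z (2 * n - 1)" "- cnj (z (2 * n)) = z (2 * n)"
      using partner_eq_iff[OF p(1)] partner_eq_iff[OF p(2)] partner by simp_all
    hence "Re (z (2 * n - 1)) = 0" "Re (z (2 * n)) = 0" by (simp_all add: complex_eq_iff)
    moreover have "Im (z (2 * n - 1)) \<noteq> 0" "Im (z (2 * n)) \<noteq> 0" using sgn[OF p(1)] sgn[OF p(2)] by auto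
    moreover have "Im (z (2 * n - 1)) < 0 \<longleftrightarrow> Im (z (2 * n)) < 0"
      using sgn[OF p(1)] sgn[OF p(2)] unfolding k by (auto simp: zero_less_mult_iff mult_less_0_iff)
    ultimately show ?thesis using e by (simp add: Arg_imaginary_axis)
  qed
  show "Arg (z (2 * n - 1)) = Arg (z (2 * n)) \<and> Arg (z (2 * n)) \<in> {- (pi / 2), pi / 2}"
    if "n \<ge> 1" "enat (2 * n) \<le> N" "norm (z (2 * n - 1)) < norm (z (2 * n))"
    using edge_pair[OF that] by blast
  show "Im (z (2 * n)) * Im (z (2 * n + 1)) < 0" if n: "n \<ge> 1" "enat (2 * n + 1) \<le> N"
  proof -
    have 1: "2 * n \<ge> 1" "enat (2 * n) \<le> N" "2 * n + 1 \<ge> 1" using n le[of "2 * n" "2 * n + 1"] by auto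
    have "(2 * n - 1) div 2 = n - 1" using n(1) by (cases n) simp_all
    hence "key (z (2 * n + 1)) = Suc (key (z (2 * n)))" using key[OF 1(1,2)] key[OF 1(3) n(2)] n by simp
    thus ?thesis using sgn[OF AP[OF 1(1,2)]] sgn[OF AP[OF 1(3) n(2)]]
      by (auto simp: zero_less_mult_iff mult_less_0_iff)
  qed
  show "Im \<alpha> * Im (z 1) > 0" if N: "enat 1 \<le> N"
  proof -
    have p: "z 1 \<in> alpha_points F \<alpha>" by (rule AP[OF _ N]) simp
    have k: "key (z 1) = 0" using key[OF _ N] by simp
    show ?thesis using sgn[OF p] k by (simp add: mult.commute)
  qed
  show "j = 0" if N: "enat 2 \<le> N" and lt: "norm (z 1) < norm (z 2)"
  proof -
    have p: "z 1 \<in> alpha_points F \<alpha>" by (rule AP[OF _ le[OF _ N]]) simp_all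
    have "E False (lnorm (z 1)) = 0" using edge_pair[of 1] N lt by simp
    hence "E False (lnorm (z 1)) \<le> 0" by (simp only: order_refl)
    hence "Th (lnorm (z 1)) = edge False" by (rule Th_edge_iff[THEN iffD2])
    hence T: "Th (lnorm (z 1)) = pi / 2" by (simp only: edge_def if_False)
    have "Im (curve (lnorm (z 1))) = pi / 2" by (simp only: curve_def complex.sel T)
    \<comment> \<open>The first point is on level 0, where \<open>Ph\<close> is
      \<open>pi / 2\<close>, and on the upper edge; the lower bound for the argument there leaves
      only \<open>j = 0\<close>.\<close>
    from Im_Lt_top_ge[OF curve_dom this] have "real (2 * j + 1) * (pi / 2) \<le> Ph (lnorm (z 1))"
      by (simp add: Ph_def)
    also have "\<dots> = pi / 2" using Ph_key[OF p] key[of 1, OF _ le[OF _ N]] by (simp add: lev_def edge_def)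
    finally have "real (2 * j + 1) * (pi / 2) \<le> 1 * (pi / 2)" by simp
    hence "real (2 * j + 1) \<le> 1" by (simp only: mult_le_cancel_right) simp
    thus ?thesis by simp
  qed
qed

section \<open>Points \<open>\<alpha>\<close> off the axes\<close>

lemma cos_sin_quarter:
  "cos (real k * (pi / 2) + x) = (if even k then (-1) ^ (k div 2) * cos x else - ((-1) ^ (k div 2) * sin x))"
  "sin (real k * (pi / 2) + x) = (if even k then (-1) ^ (k div 2) * sin x else (-1) ^ (k div 2) * cos x)"
proof -
  have "cos (real k * (pi / 2) + x) = (if even k then (-1) ^ (k div 2) * cos x else - ((-1) ^ (k div 2) * sin x)) \<and>
    sin (real k * (pi / 2) + x) = (if even k then (-1) ^ (k div 2) * sin x else (-1) ^ (k div 2) * cos x)"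
  proof (cases "even k")
    case True
    then obtain m where m: "k = 2 * m" by (rule evenE)
    have "real k * (pi / 2) + x = real m * pi + x" by (simp add: m)
    thus ?thesis using m by (simp add: cos_add sin_add cos_npi sin_npi)
  next
    case False
    then obtain m where m: "k = 2 * m + 1" by (rule oddE)
    have ke: "real k * (pi / 2) + x = real m * pi + (pi / 2 + x)" by (simp add: m algebra_simps)
    have q: "cos (pi / 2 + x) = - sin x" "sin (pi / 2 + x) = cos x" by (simp_all add: cos_add sin_add)
    have h: "cos (real m * pi + y) = (-1) ^ m * cos y" "sin (real m * pi + y) = (-1) ^ m * sin y" for y
      by (simp_all add: cos_add sin_add cos_npi sin_npi)
    have "odd k" "k div 2 = m" using m by simp_all
    thus ?thesis unfolding ke h q by simp
  qed
  thus "cos (real k * (pi / 2) + x) = (if even k then (-1) ^ (k div 2) * cos x else - ((-1) ^ (k div 2) * sin x))"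
    "sin (real k * (pi / 2) + x) = (if even k then (-1) ^ (k div 2) * sin x else (-1) ^ (k div 2) * cos x)"
    by blast+
qed

text \<open>Passing to the next quarter changes the sign of exactly one of cosine and sine: of the
  cosine if their product is positive, of the sine otherwise.\<close>

lemma quarter_step:
  fixes x y :: real and k :: nat
  assumes x: "0 < x" "x < pi / 2" and y: "0 < y" "y < pi / 2"
  defines "P \<equiv> real k * (pi / 2) + x" and "Q \<equiv> real (Suc k) * (pi / 2) + y"
  shows "cos P * cos Q < 0 \<and> sin P * sin Q > 0 \<and> cos P * sin P > 0 \<or>
         cos P * cos Q > 0 \<and> sin P * sin Q < 0 \<and> cos P * sin P < 0"
proof -
  define e :: real where "e = (-1) ^ (k div 2)"
  have pos: "cos x > 0" "sin x > 0" "cos y > 0" "sin y > 0"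
    using x y by (auto intro!: cos_gt_zero_pi sin_gt_zero)
  have ee: "e * e = 1" by (simp add: e_def flip: power_add mult_2)
  show ?thesis
  proof (cases "even k")
    case True
    hence "Suc k div 2 = k div 2" by simp
    hence c: "cos P = e * cos x" "sin P = e * sin x" "cos Q = - (e * sin y)" "sin Q = e * cos y"
      unfolding P_def Q_def cos_sin_quarter e_def using True by simp_all
    have "e * cos x * - (e * sin y) = - (e * e) * (cos x * sin y)"
      "e * sin x * (e * cos y) = e * e * (sin x * cos y)" "e * cos x * (e * sin x) = e * e * (cos x * sin x)"
      by (simp_all add: mult_ac)
    thus ?thesis using pos unfolding c ee by (simp only:) simp
  next
    case False
    hence "(-1) ^ (Suc k div 2) = - e" by (simp add: e_def)
    hence c: "cos P = - (e * sin x)" "sin P = e * cos x" "cos Q = - (e * cos y)" "sin Q = - (e * sin y)"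
      unfolding P_def Q_def cos_sin_quarter e_def[symmetric] using False by simp_all
    have "- (e * sin x) * - (e * cos y) = e * e * (sin x * cos y)"
      "e * cos x * - (e * sin y) = - (e * e) * (cos x * sin y)" "- (e * sin x) * (e * cos x) = - (e * e) * (cos x * sin x)"
      by (simp_all add: mult_ac)
    thus ?thesis using pos unfolding c ee by (simp only:) simp
  qed
qed

lemma Arg_first_quadrant: "z \<noteq> 0 \<and> 0 < Arg z \<and> Arg z < pi / 2 \<longleftrightarrow> 0 < Re z \<and> 0 < Im z"
proof (cases "z = 0")
  case False
  thus ?thesis
    using Im_Ln_pos_lt[OF False] Re_Ln_pos_lt[OF False] pi_gt_zero
    by (auto simp: Arg_eq_Im_Ln[OF False] simp del: pi_gt_zero)
qed simp

lemma quadrant_iff: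
  "z \<in> quadrant l \<longleftrightarrow> l mod 4 = 0 \<and> 0 < Re z \<and> 0 < Im z \<or> l mod 4 = 1 \<and> Re z < 0 \<and> 0 < Im z \<or>
     l mod 4 = 2 \<and> Re z < 0 \<and> Im z < 0 \<or> l mod 4 = 3 \<and> 0 < Re z \<and> Im z < 0"
proof -
  define r where "r = l mod 4"
  have i4: "\<i> powi 4 = (1 :: complex)" by (simp add: power_int_def numeral_eq_Suc)
  have l: "- l = 4 * (- (l div 4)) + - r" unfolding r_def by presburger
  have "\<i> powi (4 * (- (l div 4)) + - r) = \<i> powi (4 * (- (l div 4))) * \<i> powi (- r)"
    by (rule power_int_add) simp
  also have "\<i> powi (4 * (- (l div 4))) = (1 :: complex)" unfolding power_int_mult i4 by simp
  finally have p: "\<i> powi (- l) = \<i> powi (- r)" unfolding l[symmetric] by simp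
  have q: "z \<in> quadrant l \<longleftrightarrow> 0 < Re (z * \<i> powi (- r)) \<and> 0 < Im (z * \<i> powi (- r))"
    unfolding quadrant_def p Arg_first_quadrant[symmetric] by auto
  have "r = 0 \<or> r = 1 \<or> r = 2 \<or> r = 3" unfolding r_def by presburger
  thus ?thesis
  proof (elim disjE)
    assume r: "r = 0"
    show ?thesis unfolding q r_def[symmetric] r by simp
  next
    assume r: "r = 1"
    have e: "\<i> powi (- 1) = - \<i>" by (simp add: power_int_minus)
    show ?thesis unfolding q r_def[symmetric] r e by auto
  next
    assume r: "r = 2"
    have e: "\<i> powi (- 2) = (- 1 :: complex)" by (simp add: power_int_minus)
    show ?thesis unfolding q r_def[symmetric] r e by simp
  next
    assume r: "r = 3"
    have e: "\<i> powi (- 3) = \<i>" by (simp add: power_int_minus power3_eq_cube)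
    show ?thesis unfolding q r_def[symmetric] r e by auto
  qed
qed

text \<open>The sign pattern describes a step to a neighbouring quadrant, counterclockwise for
  \<open>s > 0\<close> and clockwise for \<open>s < 0\<close>; it excludes
  \<open>s = 0\<close>.\<close>

lemma quadrant_step:
  assumes w: "w \<in> quadrant l"
    and s: "Re w * Re v < 0 \<and> Im w * Im v > 0 \<and> Re w * Im w * s > 0 \<or>
            Re w * Re v > 0 \<and> Im w * Im v < 0 \<and> Re w * Im w * s < 0"
  shows "v \<in> quadrant (l + \<lfloor>sgn s\<rfloor>)"
proof -
  define r where "r = l mod 4"
  have up: "(l + 1) mod 4 = (if r = 3 then 0 else r + 1)" and down: "(l - 1) mod 4 = (if r = 0 then 3 else r - 1)"
    unfolding r_def by presburger+
  from w consider "r = 0" "0 < Re w" "0 < Im w" | "r = 1" "Re w < 0" "0 < Im w"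
      | "r = 2" "Re w < 0" "Im w < 0" | "r = 3" "0 < Re w" "Im w < 0"
    unfolding quadrant_iff r_def by blast
  note cases = this
  show ?thesis
  proof (cases "s > 0")
    case True
    hence "Re w * Re v < 0 \<and> Im w * Im v > 0 \<and> Re w * Im w > 0 \<or>
           Re w * Re v > 0 \<and> Im w * Im v < 0 \<and> Re w * Im w < 0"
      using s by (simp add: zero_less_mult_iff[of _ s] mult_less_0_iff[of _ s])
    moreover have "\<lfloor>sgn s\<rfloor> = 1" using True by simp
    ultimately show ?thesis unfolding quadrant_iff
      by (cases rule: cases) (simp_all add: up zero_less_mult_iff mult_less_0_iff)
  next
    case False
    hence "s < 0" using s by (cases "s = 0") auto
    hence "Re w * Re v < 0 \<and> Im w * Im v > 0 \<and> Re w * Im w < 0 \<or>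
           Re w * Re v > 0 \<and> Im w * Im v < 0 \<and> Re w * Im w > 0"
      using s by (simp add: zero_less_mult_iff[of _ s] mult_less_0_iff[of _ s])
    moreover have "\<lfloor>sgn s\<rfloor> = - 1" using \<open>s < 0\<close> by (simp add: floor_eq_iff)
    ultimately show ?thesis unfolding quadrant_iff
      by (cases rule: cases) (simp_all add: down zero_less_mult_iff mult_less_0_iff)
  qed
qed

section \<open>Levels of the argument for \<alpha> off both axes\<close>

locale lk_generic = lk_alpha +
  assumes Re_nz: "Re \<alpha> \<noteq> 0" and Im_nz: "Im \<alpha> \<noteq> 0"
begin

text \<open>If \<open>Ph = k * (pi / 2) + x\<close> lies in the quarter with number
  \<open>k\<close>, then \<open>cos x\<close> is the absolute cosine of \<open>Ph\<close> for even
  \<open>k\<close> and its absolute sine for odd \<open>k\<close>; an \<alpha>-point therefore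
  requires \<open>cos x = ratio k\<close>.\<close>

definition ratio :: "nat \<Rightarrow> real" where
  "ratio k = (if even k then \<bar>Re \<alpha>\<bar> else \<bar>Im \<alpha>\<bar>) / norm \<alpha>"

definition offset :: "nat \<Rightarrow> real" where "offset k = arccos (ratio k)"

definition qlev :: "nat \<Rightarrow> real" where "qlev k = real k * (pi / 2) + offset k"

lemma norm_sq: "\<bar>Re \<alpha>\<bar>\<^sup>2 + \<bar>Im \<alpha>\<bar>\<^sup>2 = (norm \<alpha>)\<^sup>2"
  by (simp add: cmod_power2)

lemma ratio_range: "0 < ratio k" "ratio k < 1"
proof -
  have n: "norm \<alpha> > 0" using alpha_nz by simp
  show "0 < ratio k" using n Re_nz Im_nz by (simp add: ratio_def)
  have "\<bar>Re \<alpha>\<bar> < norm \<alpha>" by (rule power2_less_imp_less) (use norm_sq Im_nz in \<open>simp_all add: cmod_power2\<close>)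
  moreover have "\<bar>Im \<alpha>\<bar> < norm \<alpha>" by (rule power2_less_imp_less) (use norm_sq Re_nz in \<open>simp_all add: cmod_power2\<close>)
  ultimately show "ratio k < 1" using n by (simp add: ratio_def)
qed

lemma offset_range: "0 < offset k" "offset k < pi / 2"
  using ratio_range[of k] arccos_lt_bounded[of "ratio k"] arccos_less_arccos[of 0 "ratio k"]
  by (simp_all add: offset_def)

lemma cos_offset: "cos (offset k) = ratio k"
  using ratio_range[of k] by (simp add: offset_def)

lemma sin_offset: "sin (offset k) = ratio (Suc k)"
proof -
  have "(sin (offset k))\<^sup>2 = (ratio (Suc k))\<^sup>2"
  proof -
    have "(ratio k)\<^sup>2 + (ratio (Suc k))\<^sup>2 = 1"
      using norm_sq alpha_nz by (auto simp: ratio_def power_divide add_divide_distrib[symmetric] add.commute)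
    thus ?thesis using sin_cos_squared_add[of "offset k"] by (simp add: cos_offset)
  qed
  moreover have "sin (offset k) \<ge> 0" using offset_range[of k] by (intro sin_ge_zero) linarith+
  ultimately show ?thesis using ratio_range[of "Suc k"] by (simp add: power2_eq_iff_nonneg)
qed

lemma abs_cos_sin_qlev: "\<bar>cos (qlev k)\<bar> = \<bar>Re \<alpha>\<bar> / norm \<alpha>" "\<bar>sin (qlev k)\<bar> = \<bar>Im \<alpha>\<bar> / norm \<alpha>"
  unfolding qlev_def cos_sin_quarter cos_offset sin_offset
  by (auto simp: abs_mult power_abs ratio_def)

lemma qlev_less_iff: "qlev k < qlev l \<longleftrightarrow> k < l"
proof -
  have lt: "qlev k < qlev l" if "k < l" for k l
  proof -
    have "real k + 1 \<le> real l" using that by simp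
    hence "(real k + 1) * (pi / 2) \<le> real l * (pi / 2)" by (intro mult_right_mono) auto
    thus ?thesis using offset_range[of k] offset_range[of l] by (simp add: qlev_def algebra_simps)
  qed
  show ?thesis using lt[of k l] lt[of l k] by (cases k l rule: linorder_cases) auto
qed

lemma qlev_eq_iff: "qlev k = qlev l \<longleftrightarrow> k = l"
  using qlev_less_iff[of k l] qlev_less_iff[of l k] by (cases k l rule: linorder_cases) auto

lemma AP_qlev:
  assumes "w \<in> AP"
  shows "\<exists>k. Ph (lnorm w) = qlev k"
proof -
  define P where "P = Ph (lnorm w)"
  define k where "k = nat \<lfloor>P / (pi / 2)\<rfloor>"
  define x where "x = P - real k * (pi / 2)"
  have P0: "P \<ge> 0" by (simp add: P_def Ph_nonneg)
  have "real k = of_int \<lfloor>P / (pi / 2)\<rfloor>" using P0 by (simp add: k_def)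
  hence "real k \<le> P / (pi / 2)" "P / (pi / 2) < real k + 1" by linarith+
  hence "real k * (pi / 2) \<le> P" "P < (real k + 1) * (pi / 2)"
    by (simp_all add: pos_le_divide_eq pos_divide_less_eq)
  hence x: "0 \<le> x" "x < pi / 2" by (simp_all add: x_def algebra_simps)
  have Px: "P = real k * (pi / 2) + x" by (simp add: x_def)
  have "cos x \<ge> 0" using x by (intro cos_ge_zero) linarith+
  moreover have "norm \<alpha> * \<bar>if even k then cos P else sin P\<bar> = norm \<alpha> * \<bar>cos x\<bar>"
    unfolding Px cos_sin_quarter by (simp add: abs_mult power_abs)
  moreover have "norm \<alpha> * \<bar>if even k then cos P else sin P\<bar> = ratio k * norm \<alpha>"
    using AP_signs(3,4)[OF assms] alpha_nz by (simp add: ratio_def P_def)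
  ultimately have cx: "cos x = ratio k" using alpha_nz by simp
  have "x \<le> pi" using x pi_gt_zero by linarith
  hence "offset k = x" unfolding offset_def cx[symmetric] by (rule arccos_cos[OF x(1)])
  thus ?thesis using Px by (auto simp: qlev_def P_def)
qed

text \<open>On the edges \<open>Ph\<close> is a multiple of \<open>pi / 2\<close>, where the cosine
  or the sine vanishes, unlike at \<open>qlev k\<close>.\<close>

lemma qlev_interior:
  assumes "Ph s = qlev k"
  shows "0 < Th s" "Th s < pi / 2" "M s (Th s) = 0"
proof -
  have "cos (qlev k) \<noteq> 0" "sin (qlev k) \<noteq> 0" using abs_cos_sin_qlev[of k] Re_nz Im_nz alpha_nz by auto
  hence ne: "Ph s \<noteq> of_int n * pi" "Ph s \<noteq> pi / 2 + of_int n * pi" for n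
    unfolding assms by (metis sin_zero_iff_int2, metis add.commute cos_zero_iff_int2)
  have "Th s \<noteq> 0" using Ph_bottom[of s] Th_bottom_iff[of s] ne by blast
  moreover have "Th s \<noteq> pi / 2" using Ph_top[of s] Th_top_iff[of s] ne by blast
  ultimately show 1: "0 < Th s" "Th s < pi / 2" using Th_range[of s] by linarith+
  thus "M s (Th s) = 0" using M_Th_le[of s] M_Th_ge[of s] by linarith
qed

definition qkey :: "complex \<Rightarrow> nat" where "qkey w = (THE k. Ph (lnorm w) = qlev k)"

lemma qkey_eq: "Ph (lnorm w) = qlev k \<Longrightarrow> qkey w = k"
  unfolding qkey_def by (rule the_equality) (simp_all add: qlev_eq_iff)

lemma Ph_qkey: "w \<in> AP \<Longrightarrow> Ph (lnorm w) = qlev (qkey w)"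
  using AP_qlev qkey_eq by blast

lemma qkey_mono: "w \<in> AP \<Longrightarrow> w' \<in> AP \<Longrightarrow> norm w \<le> norm w' \<Longrightarrow> qkey w \<le> qkey w'"
  using Ph_mono[OF lnorm_mono] Ph_qkey qlev_less_iff by (metis linorder_not_le)

lemma mult_1: "w \<in> AP \<Longrightarrow> mult w = 1"
  using mult_interior qlev_interior[OF Ph_qkey] by blast

text \<open>Off the edges \<open>Ph\<close> is strictly increasing, so the level determines the
  modulus; \<open>AP_signs\<close> then recovers both coordinates of \<open>w\<close>, as neither
  coordinate of \<alpha> is 0.\<close>

lemma qkey_inj:
  assumes w: "w \<in> AP" "w' \<in> AP" and k: "qkey w = qkey w'"
  shows "w = w'"
proof -
  have eq: "Ph (lnorm w) = Ph (lnorm w')" using Ph_qkey w k by simp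
  have l: "lnorm w = lnorm w'"
  proof (rule ccontr)
    assume "lnorm w \<noteq> lnorm w'"
    moreover have "\<not> lnorm x < lnorm y" if "x \<in> AP" "y \<in> AP" "Ph (lnorm x) = Ph (lnorm y)" for x y
      using Ph_strict[of "lnorm x" "lnorm y"] qlev_interior[OF Ph_qkey[OF that(1)]] that(3) by force
    ultimately show False using w eq by (metis linorder_neqE_linordered_idom)
  qed
  have n: "norm w = norm w'" using l AP_nz[OF w(1)] AP_nz[OF w(2)] by (simp add: lnorm_def)
  have "Re w * Re \<alpha> = Re w' * Re \<alpha>" "Im w * Im \<alpha> = Im w' * Im \<alpha>"
    unfolding AP_signs(1,2)[OF w(1)] AP_signs(1,2)[OF w(2)] l n by (rule HOL.refl)+
  thus ?thesis using Re_nz Im_nz by (simp add: complex_eq_iff)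
qed

lemma qlev_nonempty:
  assumes "Ph s = qlev k"
  shows "\<exists>w\<in>AP. lnorm w = s"
proof -
  have "\<exists>p\<in>{1, -1}. x = p * n * y" if "\<bar>y\<bar> = \<bar>x\<bar> / n" "n > 0" for x y n :: real
  proof -
    have "\<bar>x\<bar> = \<bar>n * y\<bar>" using that by (simp add: abs_mult)
    hence "x = n * y \<or> x = - (n * y)" by (simp add: abs_eq_iff)
    thus ?thesis by auto
  qed
  note sg = this
  have n: "norm \<alpha> > 0" using alpha_nz by simp
  obtain p where p: "p \<in> {1, -1}" "Re \<alpha> = p * norm \<alpha> * cos (qlev k)"
    using sg[OF abs_cos_sin_qlev(1)[of k] n] by blast
  obtain q where q: "q \<in> {1, -1}" "Im \<alpha> = q * norm \<alpha> * sin (qlev k)"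
    using sg[OF abs_cos_sin_qlev(2)[of k] n] by blast
  from AP_I[OF p(1) q(1) qlev_interior(3)[OF assms] p(2)[folded assms] q(2)[folded assms]] show ?thesis by blast
qed

lemma qkey_fibre: "{w \<in> AP. qkey w = k} = {} \<or> (\<exists>w\<in>AP. {w \<in> AP. qkey w = k} = {w})"
  using qkey_inj by blast

text \<open>Each level has at most one \<alpha>-point, a simple one, and the intermediate value
  theorem provides one on every level below a level that is reached. So all capacities are
  1.\<close>

lemma qkey_index:
  assumes z: "enumerates_alpha_points F \<alpha> N z" and n: "1 \<le> n" "enat n \<le> N"
  shows "qkey (z n) = n - 1"
proof -
  have le: "(\<Sum>w | w \<in> AP \<and> qkey w = k. mult w) \<le> int ((\<lambda>_. 1) k)" for k
    using qkey_fibre[of k]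
  proof (elim disjE bexE)
    assume e: "{w \<in> AP. qkey w = k} = {}"
    show ?thesis unfolding e by simp
  next
    fix w assume e: "{w \<in> AP. qkey w = k} = {w}" and w: "w \<in> AP"
    show ?thesis unfolding e using mult_1[OF w] by simp
  qed
  have eq: "(\<Sum>w | w \<in> AP \<and> qkey w = k. mult w) = int ((\<lambda>_. 1) k)" if v: "v \<in> AP" "k < qkey v" for k v
  proof -
    have "qlev k \<le> Ph (lnorm v)" using Ph_qkey v qlev_less_iff by (simp add: less_imp_le)
    moreover have "0 \<le> qlev k" using offset_range[of k] by (simp add: qlev_def)
    ultimately obtain s where "Ph s = qlev k" using Ph_IVT by blast
    from qlev_nonempty[OF this] obtain w where "w \<in> AP" "lnorm w = s" by blast
    with \<open>Ph s = qlev k\<close> have "w \<in> {w \<in> AP. qkey w = k}" using qkey_eq by blast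
    with qkey_fibre[of k] obtain v where e: "{w \<in> AP. qkey w = k} = {v}" and v: "v \<in> AP" by blast
    show ?thesis unfolding e using mult_1[OF v] by simp
  qed
  have fin: "finite {w \<in> AP. qkey w = k}" for k
    using qkey_fibre[of k] by (elim disjE bexE) (simp_all only: finite.emptyI finite_insert)
  have "(\<Sum>i<qkey (z n). 1) < n" "n \<le> (\<Sum>i\<le>qkey (z n). 1)"
    using enumeration_level_index[OF z qkey_mono fin le eq n] by simp_all
  thus ?thesis by simp
qed

text \<open>Up to positive factors \<open>Re w * Re \<alpha>\<close> is the cosine and
  \<open>Im w * Im \<alpha>\<close> the sine of the argument. In the products for \<open>w\<close>
  and \<open>w'\<close> the coordinates of \<alpha> enter squared, and their mixed product is
  \<open>Im (\<alpha>\<^sup>2) / 2\<close>; what remains is \<open>quarter_step\<close>.\<close>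

lemma AP_step:
  assumes w: "w \<in> AP" "w' \<in> AP" and k: "qkey w' = Suc (qkey w)"
  shows "Re w * Re w' < 0 \<and> Im w * Im w' > 0 \<and> Re w * Im w * Im (\<alpha>\<^sup>2) > 0 \<or>
         Re w * Re w' > 0 \<and> Im w * Im w' < 0 \<and> Re w * Im w * Im (\<alpha>\<^sup>2) < 0"
proof -
  have ex: "\<exists>P Q. P > 0 \<and> Q > 0 \<and> Re v * Re \<alpha> = P * cos (Ph (lnorm v)) \<and> Im v * Im \<alpha> = Q * sin (Ph (lnorm v))"
    if v: "v \<in> AP" for v
  proof (intro exI conjI)
    have "cos (Th (lnorm v)) > 0" "sin (Th (lnorm v)) > 0"
      using qlev_interior[OF Ph_qkey[OF v]] by (auto intro!: cos_gt_zero_pi sin_gt_zero)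
    thus "norm v * norm \<alpha> * cos (Th (lnorm v)) > 0" "norm v * norm \<alpha> * sin (Th (lnorm v)) > 0"
      using AP_nz[OF v] alpha_nz by simp_all
  qed (rule AP_signs[OF v])+
  obtain P Q where 1: "P > 0" "Q > 0" "Re w * Re \<alpha> = P * cos (Ph (lnorm w))" "Im w * Im \<alpha> = Q * sin (Ph (lnorm w))"
    using ex[OF w(1)] by blast
  obtain P' Q' where 2: "P' > 0" "Q' > 0" "Re w' * Re \<alpha> = P' * cos (Ph (lnorm w'))" "Im w' * Im \<alpha> = Q' * sin (Ph (lnorm w'))"
    using ex[OF w(2)] by blast
  define C S C' S' where "C = cos (Ph (lnorm w))" "S = sin (Ph (lnorm w))" "C' = cos (Ph (lnorm w'))" "S' = sin (Ph (lnorm w'))"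
  have st: "C * C' < 0 \<and> S * S' > 0 \<and> C * S > 0 \<or> C * C' > 0 \<and> S * S' < 0 \<and> C * S < 0"
    using quarter_step[OF offset_range[of "qkey w"] offset_range[of "Suc (qkey w)"], of "qkey w"]
    by (simp only: C_S_C'_S'_def Ph_qkey[OF w(1)] Ph_qkey[OF w(2)] k qlev_def)
  have e1: "(Re w * Re w') * (Re \<alpha> * Re \<alpha>) = (P * P') * (C * C')"
  proof -
    have "(Re w * Re w') * (Re \<alpha> * Re \<alpha>) = (Re w * Re \<alpha>) * (Re w' * Re \<alpha>)" by (simp add: mult_ac)
    thus ?thesis unfolding 1 2 C_S_C'_S'_def by (simp add: mult_ac)
  qed
  have e2: "(Im w * Im w') * (Im \<alpha> * Im \<alpha>) = (Q * Q') * (S * S')"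
  proof -
    have "(Im w * Im w') * (Im \<alpha> * Im \<alpha>) = (Im w * Im \<alpha>) * (Im w' * Im \<alpha>)" by (simp add: mult_ac)
    thus ?thesis unfolding 1 2 C_S_C'_S'_def by (simp add: mult_ac)
  qed
  have e3: "Re w * Im w * Im (\<alpha>\<^sup>2) = (2 * P * Q) * (C * S)"
  proof -
    have "Re w * Im w * Im (\<alpha>\<^sup>2) = 2 * ((Re w * Re \<alpha>) * (Im w * Im \<alpha>))"
      by (simp add: power2_eq_square mult_ac)
    thus ?thesis unfolding 1 C_S_C'_S'_def by (simp add: mult_ac)
  qed
  have scale: "(x > 0 \<longleftrightarrow> y > 0) \<and> (x < 0 \<longleftrightarrow> y < 0)" if "x * a = b * y" "a > 0" "b > 0" for x y a b :: real
  proof -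
    have "(x * a > 0 \<longleftrightarrow> b * y > 0) \<and> (x * a < 0 \<longleftrightarrow> b * y < 0)" using that by simp
    thus ?thesis using that(2,3) by (simp add: zero_less_mult_iff mult_less_0_iff)
  qed
  have "Re \<alpha> * Re \<alpha> > 0" "Im \<alpha> * Im \<alpha> > 0" using Re_nz Im_nz by (simp_all add: zero_less_mult_iff linorder_neq_iff[symmetric])
  with scale[OF e1] scale[OF e2] scale[of _ 1, OF trans[OF mult_1_right e3]] 1 2 st show ?thesis by simp
qed

lemma AP_first:
  assumes w: "w \<in> AP" and k: "qkey w = 0"
  shows "Re \<alpha> * Re w > 0" "Im \<alpha> * Im w > 0"
proof -
  note i = qlev_interior[OF Ph_qkey[OF w]]
  have "cos (Th (lnorm w)) > 0" "sin (Th (lnorm w)) > 0"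
    using i by (auto intro!: cos_gt_zero_pi sin_gt_zero)
  moreover have "Ph (lnorm w) = offset 0" using Ph_qkey[OF w] k by (simp add: qlev_def)
  hence "cos (Ph (lnorm w)) > 0" "sin (Ph (lnorm w)) > 0"
    using offset_range[of 0] by (auto intro!: cos_gt_zero_pi sin_gt_zero)
  moreover have "norm w * norm \<alpha> > 0" using AP_nz[OF w] alpha_nz by simp
  ultimately have "Re w * Re \<alpha> > 0" "Im w * Im \<alpha> > 0"
    unfolding AP_signs(1,2)[OF w] by simp_all
  thus "Re \<alpha> * Re w > 0" "Im \<alpha> * Im w > 0" by (simp_all add: mult.commute)
qed

lemma AP_off_axes:
  assumes w: "w \<in> AP"
  shows "Im (w\<^sup>2) \<noteq> 0"
proof -
  note i = qlev_interior[OF Ph_qkey[OF w]]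
  have "cos (Th (lnorm w)) > 0" "sin (Th (lnorm w)) > 0"
    using i by (auto intro!: cos_gt_zero_pi sin_gt_zero)
  moreover have "cos (Ph (lnorm w)) \<noteq> 0" "sin (Ph (lnorm w)) \<noteq> 0"
    using AP_signs(3,4)[OF w] Re_nz Im_nz by auto
  ultimately have "Re w * Re \<alpha> \<noteq> 0" "Im w * Im \<alpha> \<noteq> 0"
    unfolding AP_signs(1,2)[OF w] using AP_nz[OF w] alpha_nz by simp_all
  thus ?thesis by (simp add: power2_eq_square)
qed

end

lemma generic_alpha:
  assumes "lk_generic c d A \<alpha>" and z: "enumerates_alpha_points (lk_function.F c d j A) \<alpha> N z"
  defines "AP \<equiv> alpha_points (lk_function.F c d j A) \<alpha>"
  shows "w \<in> AP \<Longrightarrow> alpha_mult (lk_function.F c d j A) \<alpha> w = 1"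
    and "enat 1 \<le> N \<Longrightarrow> 0 < norm (z 1)"
    and "n \<ge> 1 \<Longrightarrow> enat (n + 1) \<le> N \<Longrightarrow> norm (z n) < norm (z (n + 1))"
    and "n \<ge> 1 \<Longrightarrow> enat n \<le> N \<Longrightarrow> Im ((z n)\<^sup>2) \<noteq> 0"
    and "n \<ge> 1 \<Longrightarrow> enat (n + 1) \<le> N \<Longrightarrow> z n \<in> quadrant l \<Longrightarrow> z (n + 1) \<in> quadrant (l + \<lfloor>sgn (Im (\<alpha>\<^sup>2))\<rfloor>)"
    and "enat 1 \<le> N \<Longrightarrow> Im \<alpha> * Im (z 1) > 0 \<and> Re \<alpha> * Re (z 1) > 0"
proof -
  interpret lk_generic c d j A \<alpha> by (rule assms(1))
  have pt: "z n \<in> alpha_points F \<alpha>" if "n \<ge> 1" "enat n \<le> N" for n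
    using z that by (auto simp: enumerates_alpha_points_def)
  show "w \<in> AP \<Longrightarrow> alpha_mult F \<alpha> w = 1" using mult_1 unfolding AP_def by blast
  show "enat 1 \<le> N \<Longrightarrow> 0 < norm (z 1)" using AP_nz[OF pt[of 1]] by simp
  show "n \<ge> 1 \<Longrightarrow> enat n \<le> N \<Longrightarrow> Im ((z n)\<^sup>2) \<noteq> 0" by (rule AP_off_axes[OF pt])
  have succ: "z n \<in> alpha_points F \<alpha>" "z (n + 1) \<in> alpha_points F \<alpha>" "qkey (z (n + 1)) = Suc (qkey (z n))"
    if n: "n \<ge> 1" "enat (n + 1) \<le> N"
  proof -
    have N: "enat n \<le> N" "n + 1 \<ge> 1" using n(2) by (meson enat_ord_simps(1) le_add1 order_trans) simp
    show "z n \<in> alpha_points F \<alpha>" "z (n + 1) \<in> alpha_points F \<alpha>" by (rule pt[OF n(1) N(1)], rule pt[OF N(2) n(2)])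
    show "qkey (z (n + 1)) = Suc (qkey (z n))"
      unfolding qkey_index[OF z n(1) N(1)] qkey_index[OF z N(2) n(2)] using n(1) by simp
  qed
  show "norm (z n) < norm (z (n + 1))" if n: "n \<ge> 1" "enat (n + 1) \<le> N"
    using qkey_mono[OF succ(2,1)[OF n]] succ(3)[OF n] by linarith
  show "z (n + 1) \<in> quadrant (l + \<lfloor>sgn (Im (\<alpha>\<^sup>2))\<rfloor>)"
    if n: "n \<ge> 1" "enat (n + 1) \<le> N" and q: "z n \<in> quadrant l"
    by (rule quadrant_step[OF q AP_step[OF succ[OF n]]])
  show "Im \<alpha> * Im (z 1) > 0 \<and> Re \<alpha> * Re (z 1) > 0" if N: "enat 1 \<le> N"
  proof -
    have "qkey (z 1) = 0" using qkey_index[OF z _ N] by simp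
    from AP_first[OF pt[OF _ N] this] show ?thesis by simp
  qed
qed

section \<open>The theorem\<close>

text \<open>The sign \<open>\<sigma>\<close> covers numerator and denominator. At the argument 1 the
  padded factors differ from 1 by \<open>\<sigma> * c k\<close>, so absolute convergence there
  yields the summability of \<open>c\<close>.\<close>

lemma pad_coefficients:
  fixes a :: "nat \<Rightarrow> real"
  assumes pos: "\<And>\<nu>. 1 \<le> \<nu> \<Longrightarrow> enat \<nu> \<le> \<omega> \<Longrightarrow> a \<nu> > 0"
    and \<sigma>: "\<sigma> = 1 \<or> \<sigma> = -1"
    and conv: "abs_convergent_eprod \<omega> (\<lambda>\<nu>. 1 + of_real \<sigma> * 1\<^sup>2 / of_real (a \<nu>))"
  defines "c \<equiv> (\<lambda>k. if enat (Suc k) \<le> \<omega> then 1 / a (Suc k) else 0)"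
  shows "coeff_seq c" and "eprod \<omega> (\<lambda>\<nu>. 1 + of_real \<sigma> * x / of_real (a \<nu>)) = coeff_seq.gprod c (of_real \<sigma> * x)"
    and "0 < \<omega> \<Longrightarrow> 0 < c 0"
proof -
  have c0: "c k \<ge> 0" for k using pos[of "Suc k"] by (auto simp: c_def less_imp_le)
  have pad: "pad_factors \<omega> (\<lambda>\<nu>. 1 + of_real \<sigma> * x / of_real (a \<nu>)) k = 1 + of_real (c k) * (of_real \<sigma> * x)" for x k
    by (simp add: pad_factors_def c_def)
  have "summable (\<lambda>k. norm (pad_factors \<omega> (\<lambda>\<nu>. 1 + of_real \<sigma> * 1\<^sup>2 / of_real (a \<nu>)) k - 1))"
    using conv unfolding abs_convergent_eprod_def by (rule abs_convergent_prod_imp_summable)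
  also have "(\<lambda>k. norm (pad_factors \<omega> (\<lambda>\<nu>. 1 + of_real \<sigma> * 1\<^sup>2 / of_real (a \<nu>)) k - 1)) = c"
    unfolding pad using c0 \<sigma> by (auto simp: norm_mult)
  finally show cs: "coeff_seq c" using c0 by unfold_locales
  show "eprod \<omega> (\<lambda>\<nu>. 1 + of_real \<sigma> * x / of_real (a \<nu>)) = coeff_seq.gprod c (of_real \<sigma> * x)"
    unfolding eprod_def pad coeff_seq.gprod_def[OF cs] ..
  show "0 < c 0" if "0 < \<omega>"
  proof -
    have "enat 1 \<le> \<omega>" using that ileI1[of 0 \<omega>] by (simp add: one_eSuc[symmetric] one_enat_def)
    thus ?thesis using pos[of 1] by (simp add: c_def)
  qed
qed

theorem theorem28:
  fixes j :: nat and A :: real and \<omega>1 \<omega>2 N :: enat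
    and a b :: "nat \<Rightarrow> real" and \<alpha> :: complex
    and F :: "complex \<Rightarrow> complex" and z :: "nat \<Rightarrow> complex"
  assumes omega: "0 < \<omega>1" "0 < \<omega>2"
    and A: "A \<ge> 0"
    and a_pos: "\<And>\<nu>. 1 \<le> \<nu> \<Longrightarrow> enat \<nu> \<le> \<omega>1 \<Longrightarrow> a \<nu> > 0"
    and b_pos: "\<And>\<mu>. 1 \<le> \<mu> \<Longrightarrow> enat \<mu> \<le> \<omega>2 \<Longrightarrow> b \<mu> > 0"
    and conv_a: "\<And>x. abs_convergent_eprod \<omega>1 (\<lambda>\<nu>. 1 + x\<^sup>2 / of_real (a \<nu>))"
    and conv_b: "\<And>x. abs_convergent_eprod \<omega>2 (\<lambda>\<mu>. 1 - x\<^sup>2 / of_real (b \<mu>))"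
    and F: "F = (\<lambda>x. x ^ (2 * j + 1) * exp (of_real A * x\<^sup>2) *
                (eprod \<omega>1 (\<lambda>\<nu>. 1 + x\<^sup>2 / of_real (a \<nu>)) /
                 eprod \<omega>2 (\<lambda>\<mu>. 1 - x\<^sup>2 / of_real (b \<mu>))))"
    and F_nontrivial: "F \<noteq> (\<lambda>x. x ^ (2 * j + 1))"
    and \<alpha>: "\<alpha> \<noteq> 0"
    and z: "enumerates_alpha_points F \<alpha> N z"
  shows
    "(Im (\<alpha>\<^sup>2) \<noteq> 0 \<longrightarrow>
        (\<forall>w\<in>alpha_points F \<alpha>. alpha_mult F \<alpha> w = 1) \<and>
        (enat 1 \<le> N \<longrightarrow> 0 < norm (z 1)) \<and>
        (\<forall>n\<ge>1. enat (n + 1) \<le> N \<longrightarrow> norm (z n) < norm (z (n + 1))) \<and>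
        (\<forall>n\<ge>1. enat n \<le> N \<longrightarrow> Im ((z n)\<^sup>2) \<noteq> 0) \<and>
        (\<forall>l. \<forall>n\<ge>1. enat (n + 1) \<le> N \<longrightarrow> z n \<in> quadrant l \<longrightarrow>
            z (n + 1) \<in> quadrant (l + \<lfloor>sgn (Im (\<alpha>\<^sup>2))\<rfloor>)) \<and>
        (enat 1 \<le> N \<longrightarrow> Im \<alpha> * Im (z 1) > 0 \<and> Re \<alpha> * Re (z 1) > 0))
     \<and>
     (Im \<alpha> = 0 \<longrightarrow>
        (enat 1 \<le> N \<longrightarrow> 0 < norm (z 1)) \<and>
        (\<forall>n\<ge>1. enat (2 * n) \<le> N \<longrightarrow> norm (z (2 * n - 1)) < norm (z (2 * n))) \<and>
        (\<forall>n\<ge>1. enat (2 * n + 1) \<le> N \<longrightarrow> norm (z (2 * n)) \<le> norm (z (2 * n + 1))) \<and>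
        (\<forall>w\<in>alpha_points F \<alpha>. Re w \<noteq> 0) \<and>
        (\<forall>w\<in>alpha_points F \<alpha>. Im w = 0 \<longrightarrow> alpha_mult F \<alpha> w \<in> {1, 2}) \<and>
        (\<forall>w\<in>alpha_points F \<alpha>. Im w \<noteq> 0 \<longrightarrow> alpha_mult F \<alpha> w = 1) \<and>
        (\<forall>n\<ge>1. enat (2 * n + 1) \<le> N \<longrightarrow>
            (norm (z (2 * n)) = norm (z (2 * n + 1)) \<longrightarrow>
               z (2 * n) = cnj (z (2 * n + 1))) \<and>
            (norm (z (2 * n)) < norm (z (2 * n + 1)) \<longrightarrow>
               Arg (z (2 * n)) = Arg (z (2 * n + 1)) \<and> Arg (z (2 * n + 1)) \<in> {0, pi})) \<and>
        (\<forall>n\<ge>1. enat (2 * n) \<le> N \<longrightarrow> Re (z (2 * n - 1)) * Re (z (2 * n)) < 0) \<and>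
        (enat 1 \<le> N \<longrightarrow> Im (z 1) = 0 \<and> Im (\<alpha> * z 1) = 0 \<and> Re (\<alpha> * z 1) > 0))
     \<and>
     (Re \<alpha> = 0 \<longrightarrow>
        (enat 1 \<le> N \<longrightarrow> 0 < norm (z 1)) \<and>
        (\<forall>n\<ge>1. enat (2 * n) \<le> N \<longrightarrow> norm (z (2 * n - 1)) \<le> norm (z (2 * n))) \<and>
        (\<forall>n\<ge>1. enat (2 * n + 1) \<le> N \<longrightarrow> norm (z (2 * n)) < norm (z (2 * n + 1))) \<and>
        (\<forall>w\<in>alpha_points F \<alpha>. Im w \<noteq> 0) \<and>
        (\<forall>w\<in>alpha_points F \<alpha>. Re w = 0 \<longrightarrow> alpha_mult F \<alpha> w \<in> {1, 2}) \<and>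
        (\<forall>w\<in>alpha_points F \<alpha>. Re w \<noteq> 0 \<longrightarrow> alpha_mult F \<alpha> w = 1) \<and>
        (\<forall>n\<ge>1. enat (2 * n) \<le> N \<longrightarrow>
            (norm (z (2 * n - 1)) = norm (z (2 * n)) \<longrightarrow>
               z (2 * n - 1) = - cnj (z (2 * n))) \<and>
            (norm (z (2 * n - 1)) < norm (z (2 * n)) \<longrightarrow>
               Arg (z (2 * n - 1)) = Arg (z (2 * n)) \<and>
               Arg (z (2 * n)) \<in> {- (pi / 2), pi / 2})) \<and>
        (\<forall>n\<ge>1. enat (2 * n + 1) \<le> N \<longrightarrow> Im (z (2 * n)) * Im (z (2 * n + 1)) < 0) \<and>
        (enat 1 \<le> N \<longrightarrow> Im \<alpha> * Im (z 1) > 0) \<and>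
        (enat 2 \<le> N \<longrightarrow> norm (z 1) < norm (z 2) \<longrightarrow> j = 0))"
proof -
  define c where "c = (\<lambda>k. if enat (Suc k) \<le> \<omega>1 then 1 / a (Suc k) else 0)"
  define d where "d = (\<lambda>k. if enat (Suc k) \<le> \<omega>2 then 1 / b (Suc k) else 0)"
  have convs: "abs_convergent_eprod \<omega>1 (\<lambda>\<nu>. 1 + of_real 1 * 1\<^sup>2 / of_real (a \<nu>))"
      "abs_convergent_eprod \<omega>2 (\<lambda>\<nu>. 1 + of_real (- 1) * 1\<^sup>2 / of_real (b \<nu>))"
    using conv_a[of 1] conv_b[of 1] by simp_all
  note pa = pad_coefficients[OF a_pos _ convs(1), simplified, folded c_def]
  note pb = pad_coefficients[OF b_pos _ convs(2), simplified, folded d_def]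
  have lk: "lk_function c d A"
  proof (intro lk_function.intro lk_function_axioms.intro pa(1) pb(1) A)
    show "0 < c 0" using pa(3) omega(1) by (simp add: c_def)
  qed
  have F': "F = lk_function.F c d j A"
  proof
    fix x
    interpret lk_function c d j A by (rule lk)
    have "eprod \<omega>1 (\<lambda>\<nu>. 1 + x\<^sup>2 / of_real (a \<nu>)) = num.gprod (x\<^sup>2)" by (rule pa(2))
    moreover have "eprod \<omega>2 (\<lambda>\<mu>. 1 - x\<^sup>2 / of_real (b \<mu>)) = den.gprod (- (x\<^sup>2))" by (rule pb(2))
    ultimately show "F x = lk_function.F c d j A x"
      unfolding F F_def Nm_def Dn_def by simp
  qed
  have la: "lk_alpha c d A \<alpha>"
    using lk \<alpha> by (intro lk_alpha.intro lk_alpha_axioms.intro)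
  note z' = z[unfolded F']
  have iv: "lk_generic c d A \<alpha>" if "Im (\<alpha>\<^sup>2) \<noteq> 0"
    using la that by (intro lk_generic.intro lk_generic_axioms.intro) (auto simp: power2_eq_square)
  have v: "lk_axis c d A \<alpha> True" if "Im \<alpha> = 0"
    using la that by (intro lk_axis.intro lk_axis_axioms.intro) auto
  have vi: "lk_axis c d A \<alpha> False" if "Re \<alpha> = 0"
    using la that by (intro lk_axis.intro lk_axis_axioms.intro) auto
  have mono: "norm (z m) \<le> norm (z (m + 1))" if "1 \<le> m" "enat (m + 1) \<le> N" for m
    by (rule enumerates_alpha_points_norm_mono[OF z]) (use that in auto)
  have mono': "norm (z (2 * n - 1)) \<le> norm (z (2 * n))" if "1 \<le> n" "enat (2 * n) \<le> N" for n
    by (rule enumerates_alpha_points_norm_mono[OF z]) (use that in auto)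
  show ?thesis unfolding F'
  proof (intro conjI impI)
    assume "Im (\<alpha>\<^sup>2) \<noteq> 0"
    note g = generic_alpha[OF iv[OF this] z']
    show "\<forall>w\<in>alpha_points (lk_function.F c d j A) \<alpha>. alpha_mult (lk_function.F c d j A) \<alpha> w = 1"
      "\<forall>n\<ge>1. enat (n + 1) \<le> N \<longrightarrow> norm (z n) < norm (z (n + 1))"
      "\<forall>n\<ge>1. enat n \<le> N \<longrightarrow> Im ((z n)\<^sup>2) \<noteq> 0"
      "\<forall>l. \<forall>n\<ge>1. enat (n + 1) \<le> N \<longrightarrow> z n \<in> quadrant l \<longrightarrow> z (n + 1) \<in> quadrant (l + \<lfloor>sgn (Im (\<alpha>\<^sup>2))\<rfloor>)"
      using g(1,3,4,5) by blast+
    show "0 < norm (z 1)" "Im \<alpha> * Im (z 1) > 0" "Re \<alpha> * Re (z 1) > 0" if "enat 1 \<le> N"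
      using g(2,6)[OF that] by blast+
  next
    assume "Im \<alpha> = 0"
    note g = real_alpha[OF v[OF this] z']
    show "\<forall>n\<ge>1. enat (2 * n) \<le> N \<longrightarrow> norm (z (2 * n - 1)) < norm (z (2 * n))"
      "\<forall>n\<ge>1. enat (2 * n + 1) \<le> N \<longrightarrow> norm (z (2 * n)) \<le> norm (z (2 * n + 1))"
      "\<forall>w\<in>alpha_points (lk_function.F c d j A) \<alpha>. Re w \<noteq> 0"
      "\<forall>w\<in>alpha_points (lk_function.F c d j A) \<alpha>. Im w = 0 \<longrightarrow> alpha_mult (lk_function.F c d j A) \<alpha> w \<in> {1, 2}"
      "\<forall>w\<in>alpha_points (lk_function.F c d j A) \<alpha>. Im w \<noteq> 0 \<longrightarrow> alpha_mult (lk_function.F c d j A) \<alpha> w = 1"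
      "\<forall>n\<ge>1. enat (2 * n) \<le> N \<longrightarrow> Re (z (2 * n - 1)) * Re (z (2 * n)) < 0"
      using g(2,3,4,5,8) mono by simp_all
    show "\<forall>n\<ge>1. enat (2 * n + 1) \<le> N \<longrightarrow>
            (norm (z (2 * n)) = norm (z (2 * n + 1)) \<longrightarrow> z (2 * n) = cnj (z (2 * n + 1))) \<and>
            (norm (z (2 * n)) < norm (z (2 * n + 1)) \<longrightarrow>
               Arg (z (2 * n)) = Arg (z (2 * n + 1)) \<and> Arg (z (2 * n + 1)) \<in> {0, pi})"
      using g(6,7) by blast
    show "0 < norm (z 1)" "Im (z 1) = 0" "Im (\<alpha> * z 1) = 0" "Re (\<alpha> * z 1) > 0" if "enat 1 \<le> N"
      using g(1,9)[OF that] by blast+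
  next
    assume "Re \<alpha> = 0"
    note g = imaginary_alpha[OF vi[OF this] z']
    show "\<forall>n\<ge>1. enat (2 * n) \<le> N \<longrightarrow> norm (z (2 * n - 1)) \<le> norm (z (2 * n))"
      "\<forall>n\<ge>1. enat (2 * n + 1) \<le> N \<longrightarrow> norm (z (2 * n)) < norm (z (2 * n + 1))"
      "\<forall>w\<in>alpha_points (lk_function.F c d j A) \<alpha>. Im w \<noteq> 0"
      "\<forall>w\<in>alpha_points (lk_function.F c d j A) \<alpha>. Re w = 0 \<longrightarrow> alpha_mult (lk_function.F c d j A) \<alpha> w \<in> {1, 2}"
      "\<forall>w\<in>alpha_points (lk_function.F c d j A) \<alpha>. Re w \<noteq> 0 \<longrightarrow> alpha_mult (lk_function.F c d j A) \<alpha> w = 1"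
      "\<forall>n\<ge>1. enat (2 * n + 1) \<le> N \<longrightarrow> Im (z (2 * n)) * Im (z (2 * n + 1)) < 0"
      using g(2,3,4,5,8) mono' by simp_all
    show "\<forall>n\<ge>1. enat (2 * n) \<le> N \<longrightarrow>
            (norm (z (2 * n - 1)) = norm (z (2 * n)) \<longrightarrow> z (2 * n - 1) = - cnj (z (2 * n))) \<and>
            (norm (z (2 * n - 1)) < norm (z (2 * n)) \<longrightarrow>
               Arg (z (2 * n - 1)) = Arg (z (2 * n)) \<and> Arg (z (2 * n)) \<in> {- (pi / 2), pi / 2})"
      using g(6,7) by blast
    show "0 < norm (z 1)" "Im \<alpha> * Im (z 1) > 0" if "enat 1 \<le> N"
      using g(1,9)[OF that] by blast+
    show "j = 0" if "enat 2 \<le> N" "norm (z 1) < norm (z 2)" using g(10)[OF that] .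
  qed
qed

end
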